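(* Let $\xi$ be a positive integer-valued random variable with $\xi\in\mathcal{P}(\alpha)$ for some $\alpha>0$, and let $\phi\sim\mathbb{C}_n^2(\xi)$ be a random 2-CNF on $n$ variables drawn from the configuration model. Then, as $n\to\infty$, $$\Pr[\phi \text{ is satisfiable}]\to\begin{cases}0, & \text{if } 0<\alpha<2,\\ 0, & \text{if } \alpha=2 \text{ or } \mathbb{E}\xi^2>3\,\mathbb{E}\xi,\\ 1, & \text{if } \mathbb{E}\xi^2<3\,\mathbb{E}\xi.\end{cases}$$
   Context: For a positive integer-valued random variable $\xi$, its tail function is $F_\xi(\ell)=\Pr[\xi\ge \ell]$. We write $\xi\in\mathcal{P}(\alpha)$ (power law with parameter $\alpha>0$) if there are constants $V,W>0$ with $W\ell^{-\alpha}\le F_\xi(\ell)\le V\ell^{-\alpha}$ for every integer $\ell\ge 1$. Configuration model $\mathbb{C}_n^k(\xi)$: take variables $v_1,\dots,v_n$; sample degrees $d_1,\dots,d_n$ independently from the distribution of $\xi$; if $\sum_i d_i$ is not a multiple of $k$, discard and resample. Create $d_i$ clones (copies) of $v_i$. Choose a uniformly random partition of the multiset of all clones into $k$-element sets (equivalently, repeatedly pick $k$ remaining clones uniformly at random without replacement); each set becomes a clause, and each clone in it is independently negated with probability $1/2$. The resulting $k$-CNF $\phi$ is the output. *)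

theory Defs
  imports "HOL-Probability.Probability"
begin

text \<open>A positive integer-valued random variable enters only through its law, which is given as a
  \<^typ>\<open>nat pmf\<close> that does not charge 0.\<close>

definition tail :: "nat pmf \<Rightarrow> nat \<Rightarrow> real" where
  "tail \<xi> l = measure_pmf.prob \<xi> {l..}"

definition power_law :: "real \<Rightarrow> nat pmf \<Rightarrow> bool" where
  "power_law \<alpha> \<xi> \<longleftrightarrow> (\<exists>V W. V > 0 \<and> W > 0 \<and>
     (\<forall>l\<ge>1. W * real l powr (- \<alpha>) \<le> tail \<xi> l \<and> tail \<xi> l \<le> V * real l powr (- \<alpha>)))"

text \<open>Moments take values in \<^typ>\<open>ennreal\<close>, since they may be infinite.\<close>

definition moment :: "nat \<Rightarrow> nat pmf \<Rightarrow> ennreal" where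
  "moment r \<xi> = (\<integral>\<^sup>+ x. of_nat (x ^ r) \<partial>measure_pmf \<xi>)"

datatype 'v literal = Pos 'v | Neg 'v

type_synonym 'v cnf = "'v literal multiset multiset"

fun lit_true :: "('v \<Rightarrow> bool) \<Rightarrow> 'v literal \<Rightarrow> bool" where
  "lit_true \<tau> (Pos v) = \<tau> v"
| "lit_true \<tau> (Neg v) = (\<not> \<tau> v)"

definition satisfiable :: "'v cnf \<Rightarrow> bool" where
  "satisfiable \<phi> \<longleftrightarrow> (\<exists>\<tau>. \<forall>C \<in># \<phi>. \<exists>l \<in># C. lit_true \<tau> l)"

text \<open>The variables are \<open>0, \<dots>, n - 1\<close>; the clone \<open>(i, j)\<close> is the \<open>j\<close>-th copy of variable \<open>i\<close>.\<close>

definition clones :: "nat \<Rightarrow> (nat \<Rightarrow> nat) \<Rightarrow> (nat \<times> nat) set" where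
  "clones n d = (SIGMA i:{..<n}. {..<d i})"

definition k_partitions :: "nat \<Rightarrow> 'a set \<Rightarrow> 'a set set set" where
  "k_partitions k A = {P. partition_on A P \<and> (\<forall>B\<in>P. card B = k)}"

definition iid_degrees :: "nat \<Rightarrow> nat pmf \<Rightarrow> (nat \<Rightarrow> nat) pmf" where
  "iid_degrees n \<xi> = Pi_pmf {..<n} 0 (\<lambda>_. \<xi>)"

definition divisible_degrees :: "nat \<Rightarrow> nat \<Rightarrow> (nat \<Rightarrow> nat) set" where
  "divisible_degrees k n = {d. k dvd (\<Sum>i<n. d i)}"

text \<open>Resampling until \<open>k\<close> divides the degree sum is conditioning on that event.  The event may be
  null (for example \<open>k = 2\<close>, \<open>n\<close> odd and \<open>\<xi>\<close> supported on odd numbers); then the sampling never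
  terminates and the model does not exist for this \<open>n\<close>.\<close>

definition admissible :: "nat \<Rightarrow> nat \<Rightarrow> nat pmf \<Rightarrow> bool" where
  "admissible k n \<xi> \<longleftrightarrow> measure_pmf.prob (iid_degrees n \<xi>) (divisible_degrees k n) > 0"

text \<open>A clone \<open>c\<close> is negated iff \<open>s c\<close>.\<close>

definition clone_literal :: "(nat \<times> nat \<Rightarrow> bool) \<Rightarrow> nat \<times> nat \<Rightarrow> nat literal" where
  "clone_literal s c = (if s c then Neg (fst c) else Pos (fst c))"

definition cnf_of :: "(nat \<times> nat) set set \<Rightarrow> (nat \<times> nat \<Rightarrow> bool) \<Rightarrow> nat cnf" where
  "cnf_of P s = image_mset (\<lambda>B. image_mset (clone_literal s) (mset_set B)) (mset_set P)"

definition config_model :: "nat \<Rightarrow> nat \<Rightarrow> nat pmf \<Rightarrow> nat cnf pmf" where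
  "config_model k n \<xi> =
     do {
       d \<leftarrow> cond_pmf (iid_degrees n \<xi>) (divisible_degrees k n);
       P \<leftarrow> pmf_of_set (k_partitions k (clones n d));
       s \<leftarrow> Pi_pmf (clones n d) False (\<lambda>_. bernoulli_pmf (1/2));
       return_pmf (cnf_of P s)
     }"

text \<open>The filter for \<open>n \<rightarrow> \<infinity>\<close> through those \<open>n\<close> for which the model exists.\<close>

definition admissible_sequentially :: "nat \<Rightarrow> nat pmf \<Rightarrow> nat filter" where
  "admissible_sequentially k \<xi> = inf sequentially (principal {n. admissible k n \<xi>})"

lemma admissible_multiple:
  assumes "k dvd n"
  shows "admissible k n \<xi>"
proof -
  obtain x where x: "x \<in> set_pmf \<xi>"
    using set_pmf_not_empty by fast
  define d where "d = (\<lambda>i. if i < n then x else 0)"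
  have "d \<in> set_pmf (iid_degrees n \<xi>)"
    using x by (auto simp: iid_degrees_def set_Pi_pmf PiE_dflt_def d_def)
  moreover have "d \<in> divisible_degrees k n"
    using assms by (simp add: divisible_degrees_def d_def)
  ultimately show ?thesis
    unfolding admissible_def by (rule measure_pmf_posI)
qed

lemma admissible_sequentially_neq_bot:
  assumes "k > 0"
  shows "admissible_sequentially k \<xi> \<noteq> bot"
proof -
  have "\<exists>n\<ge>N. admissible k n \<xi>" for N
    using assms by (intro exI[of _ "k * N"] conjI admissible_multiple) auto
  thus ?thesis
    by (auto simp: admissible_sequentially_def trivial_limit_def eventually_inf_principal
        eventually_sequentially)
qed

lemma k_partitions_finite:
  assumes "finite A"
  shows "finite (k_partitions k A)"
  using finitely_many_partition_on[OF assms]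
  by (rule rev_finite_subset) (auto simp: k_partitions_def)

lemma k_partitions_nonempty:
  assumes "finite A" "k > 0" "k dvd card A"
  shows "k_partitions k A \<noteq> {}"
proof -
  obtain m where "card A = k * m"
    using assms(3) by blast
  with assms(1) show ?thesis
  proof (induction m arbitrary: A)
    case 0
    hence "{} \<in> k_partitions k A"
      by (simp add: k_partitions_def partition_on_empty)
    thus ?case by blast
  next
    case (Suc m)
    then obtain B where B: "B \<subseteq> A" "card B = k"
      by (metis obtain_subset_with_card_n le_add1 mult_Suc_right)
    hence "card (A - B) = k * m"
      using Suc.prems by (simp add: card_Diff_subset finite_subset[OF B(1)])
    then obtain P where P: "P \<in> k_partitions k (A - B)"
      using Suc.IH[of "A - B"] Suc.prems by blast
    have "B \<noteq> {}"
      using B(2) assms(2) by auto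
    hence "insert B P \<in> k_partitions k A"
      using P B by (auto simp: k_partitions_def partition_on_def disjoint_def)
    thus ?case by blast
  qed
qed

end

theory Submission
  imports Defs "HOL-Real_Asymp.Real_Asymp"
begin

text \<open>
  Reveal the degrees and the signs of all clones first, so that only the uniform perfect matching of
  the clones is random.  If variable \<open>i\<close> has \<open>p\<^sub>i\<close> positive and \<open>q\<^sub>i\<close> negative clones, then a clone
  reached along an implication path has on average \<open>\<Sum> 2 p\<^sub>i q\<^sub>i / \<Sum> (p\<^sub>i + q\<^sub>i)\<close> successors, and by the
  law of large numbers this ratio is close to \<open>(E \<xi>\<^sup>2 - E \<xi>) / (2 E \<xi>)\<close>, which crosses 1 exactly when
  \<open>E \<xi>\<^sup>2 = 3 E \<xi>\<close>.

  Above the threshold, start from a variable \<open>x\<close> with many clones of both signs, fix its value, and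
  explore the consequences.  The exploration survives with probability close to 1 until it has
  produced far more than the square root of the number of clones as false unmatched clones; two of
  these are then matched to each other, which refutes the chosen value of \<open>x\<close>.  The
  exploration may ignore variables of large degree, so bounded degrees suffice here.  If \<open>\<alpha> < 2\<close>, a single variable already
  has that many clones and no exploration is needed.

  Below the threshold, an unsatisfiable formula contains a bicycle, and the expected number of
  bicycles tends to 0 because all degrees are of smaller order than the square root of \<open>n\<close>.
\<close>


section \<open>Uniform perfect matchings\<close>

text \<open>The square root is the birthday threshold: among \<open>N\<close> unmatched clones,
  \<open>a\<close> false ones avoid being matched to each other with probability about
  \<open>exp (- a^2 / (2 * N))\<close>. The ratio of moments arises because two clones of one
  variable differ in sign with probability 1/2, so \<open>2 * p * q\<close> has mean
  \<open>d * (d - 1) / 2\<close> for degree \<open>d\<close>. For \<alpha> \<le> 2 the second moment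
  is infinite. Hence the satisfiable case forces \<alpha> > 2, which is what keeps all degrees below
  the square root of \<open>n\<close>; and \<alpha> = 2, where the mean is finite, falls under the
  supercritical case once degrees are truncated. Two dependencies stand in the way. The condition on
  the parity of the degree sum is removed by division: its probability is bounded below over all
  admissible \<open>n\<close>, so events that are rare for independent degrees stay rare. The
  degrees and signs enter the matching estimates only through a few sums and maxima, and these
  estimates are uniform otherwise; so it remains to control sums of independent identically
  distributed terms.\<close>

abbreviation (input) matchings :: "'a set \<Rightarrow> 'a set set set" where
  "matchings \<equiv> k_partitions 2"

text \<open>A quotient of cardinalities is 0 when no perfect matching exists, so monotonicity and
  union bounds hold for every finite \<open>R\<close>; evenness of \<open>card R\<close> is assumed
  where normalisation matters.\<close>

definition matching_prob :: "'a set \<Rightarrow> ('a set set \<Rightarrow> bool) \<Rightarrow> real" where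
  "matching_prob R E = real (card {M \<in> matchings R. E M}) / real (card (matchings R))"

lemma matching_prob_mono:
  assumes "finite R" "\<And>M. M \<in> matchings R \<Longrightarrow> E M \<Longrightarrow> F M"
  shows "matching_prob R E \<le> matching_prob R F"
proof -
  have "{M \<in> matchings R. E M} \<subseteq> {M \<in> matchings R. F M}"
    using assms(2) by blast
  thus ?thesis
    unfolding matching_prob_def
    by (intro divide_right_mono of_nat_mono card_mono)
       (auto simp: k_partitions_finite[OF assms(1)])
qed

lemma matching_prob_le_1:
  assumes "finite R"
  shows "matching_prob R E \<le> 1"
proof -
  have "card {M \<in> matchings R. E M} \<le> card (matchings R)"
    by (intro card_mono k_partitions_finite assms) auto
  thus ?thesis
    by (cases "card (matchings R) = 0") (simp_all add: matching_prob_def divide_le_eq_1)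
qed

lemma matching_prob_eq_0:
  assumes "\<And>M. M \<in> matchings R \<Longrightarrow> \<not> E M"
  shows "matching_prob R E = 0"
proof -
  have "{M \<in> matchings R. E M} = {}" using assms by blast
  thus ?thesis by (simp only: matching_prob_def card.empty)
qed

lemma matching_prob_disj:
  assumes "finite R"
  shows "matching_prob R (\<lambda>M. E M \<or> F M) \<le> matching_prob R E + matching_prob R F"
proof -
  have "{M \<in> matchings R. E M \<or> F M} =
        {M \<in> matchings R. E M} \<union> {M \<in> matchings R. F M}"
    by blast
  hence "real (card {M \<in> matchings R. E M \<or> F M}) \<le>
      real (card {M \<in> matchings R. E M}) + real (card {M \<in> matchings R. F M})"
    using of_nat_mono[OF card_Un_le, where ?'a = real] by simp
  thus ?thesis
    unfolding matching_prob_def add_divide_distrib[symmetric]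
    by (rule divide_right_mono) simp
qed

lemma matching_prob_Bex:
  assumes "finite R" "finite I"
  shows "matching_prob R (\<lambda>M. \<exists>i\<in>I. E i M) \<le> (\<Sum>i\<in>I. matching_prob R (E i))"
  using assms(2)
proof (induction I rule: finite_induct)
  case empty
  thus ?case by (simp add: matching_prob_eq_0)
next
  case (insert x I)
  have "matching_prob R (\<lambda>M. \<exists>i\<in>insert x I. E i M) \<le>
        matching_prob R (E x) + matching_prob R (\<lambda>M. \<exists>i\<in>I. E i M)"
    using matching_prob_disj[OF assms(1)] by simp
  thus ?case using insert by simp
qed

lemma doubleton_block:
  assumes "M \<in> matchings R" "c \<in> R"
  obtains b where "b \<in> R - {c}" "{c, b} \<in> M"
proof -
  have "\<Union>M = R" "\<forall>B\<in>M. card B = 2"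
    using assms(1) by (auto simp: k_partitions_def partition_on_def)
  then obtain B where B: "B \<in> M" "c \<in> B" "card B = 2"
    using assms(2) by blast
  then obtain b where "B = {c, b}" "b \<noteq> c"
    by (metis card_2_iff doubleton_eq_iff insertE singletonD)
  moreover have "b \<in> R"
    using B \<open>\<Union>M = R\<close> \<open>B = {c, b}\<close> by blast
  ultimately show ?thesis
    using B that[of b] by simp
qed

lemma block_unique:
  assumes "M \<in> matchings R" "B \<in> M" "B' \<in> M" "c \<in> B" "c \<in> B'"
  shows "B = B'"
  using assms by (auto simp: k_partitions_def partition_on_def disjoint_def)

lemma insert_doubleton_partition:
  assumes "M \<in> matchings (R - {c, b})" "c \<in> R" "b \<in> R" "b \<noteq> c"
  shows "insert {c, b} M \<in> matchings R"
proof -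
  have M: "partition_on (R - {c, b}) M" "\<forall>B\<in>M. card B = 2"
    using assms(1) by (auto simp: k_partitions_def)
  have "partition_on R (insert {c, b} M)"
    unfolding partition_on_def
  proof (intro conjI)
    show "disjoint (insert {c, b} M)"
      using M(1) by (intro disjointI) (auto simp: partition_on_def disjoint_def)
  qed (use M(1) assms in \<open>auto simp: partition_on_def\<close>)
  thus ?thesis
    using M(2) assms(4) by (simp add: k_partitions_def)
qed

lemma remove_doubleton_partition:
  assumes "M \<in> matchings R" "{c, b} \<in> M"
  shows "M - {{c, b}} \<in> matchings (R - {c, b})"
proof -
  have M: "partition_on R M" "\<forall>B\<in>M. card B = 2"
    using assms(1) by (auto simp: k_partitions_def)
  have "\<Union>(M - {{c, b}}) = R - {c, b}"
  proof (intro equalityI subsetI)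
    fix x assume "x \<in> \<Union>(M - {{c, b}})"
    then obtain B where B: "x \<in> B" "B \<in> M" "B \<noteq> {c, b}" by blast
    hence "x \<notin> {c, b}"
      using block_unique[OF assms(1) _ assms(2)] by metis
    thus "x \<in> R - {c, b}"
      using B M(1) by (auto simp: partition_on_def)
  qed (use M(1) in \<open>auto simp: partition_on_def\<close>)
  moreover have "disjoint (M - {{c, b}})"
    using M(1) by (auto simp: partition_on_def disjoint_def)
  ultimately show ?thesis
    using M by (simp add: k_partitions_def partition_on_def)
qed

lemma bij_betw_insert_doubleton:
  assumes "c \<in> R" "b \<in> R" "b \<noteq> c"
  shows "bij_betw (insert {c, b}) {M \<in> matchings (R - {c, b}). E (insert {c, b} M)}
           {M \<in> matchings R. E M \<and> {c, b} \<in> M}"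
proof (rule bij_betw_byWitness[where f' = "\<lambda>M. M - {{c, b}}"])
  have notin: "{c, b} \<notin> M" if "M \<in> matchings (R - {c, b})" for M
    using that by (auto simp: k_partitions_def partition_on_def)
  thus "\<forall>M\<in>{M \<in> matchings (R - {c, b}). E (insert {c, b} M)}.
          insert {c, b} M - {{c, b}} = M"
    by simp
  show "\<forall>M\<in>{M \<in> matchings R. E M \<and> {c, b} \<in> M}. insert {c, b} (M - {{c, b}}) = M"
    by blast
  show "insert {c, b} ` {M \<in> matchings (R - {c, b}). E (insert {c, b} M)}
          \<subseteq> {M \<in> matchings R. E M \<and> {c, b} \<in> M}"
    using insert_doubleton_partition[of _ R c b] assms by auto
  show "(\<lambda>M. M - {{c, b}}) ` {M \<in> matchings R. E M \<and> {c, b} \<in> M}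
          \<subseteq> {M \<in> matchings (R - {c, b}). E (insert {c, b} M)}"
    using remove_doubleton_partition[of _ R c b] by (auto simp: insert_absorb)
qed

text \<open>Matchings are sorted by the partner \<open>b\<close> of a fixed element
  \<open>c\<close>; deleting the block \<open>{c, b}\<close> identifies each class with matchings of
  the rest.\<close>

lemma card_matchings_step:
  assumes "finite R" "c \<in> R"
  shows "card {M \<in> matchings R. E M} =
         (\<Sum>b\<in>R - {c}. card {M \<in> matchings (R - {c, b}). E (insert {c, b} M)})"
proof -
  have eq: "{M \<in> matchings R. E M} =
        (\<Union>b\<in>R - {c}. {M \<in> matchings R. E M \<and> {c, b} \<in> M})"
    using assms(2) by (auto elim: doubleton_block)
  have "card {M \<in> matchings R. E M} =
        (\<Sum>b\<in>R - {c}. card {M \<in> matchings R. E M \<and> {c, b} \<in> M})"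
    unfolding eq
  proof (rule card_UN_disjoint)
    show "\<forall>i\<in>R - {c}. \<forall>j\<in>R - {c}. i \<noteq> j \<longrightarrow>
        {M \<in> matchings R. E M \<and> {c, i} \<in> M} \<inter>
        {M \<in> matchings R. E M \<and> {c, j} \<in> M} = {}"
    proof (intro ballI impI)
      fix i j assume "i \<in> R - {c}" "j \<in> R - {c}" "i \<noteq> j"
      hence "{c, i} \<noteq> {c, j}" by (auto simp: doubleton_eq_iff)
      thus "{M \<in> matchings R. E M \<and> {c, i} \<in> M} \<inter>
        {M \<in> matchings R. E M \<and> {c, j} \<in> M} = {}"
        using block_unique[of _ R "{c, i}" "{c, j}" c] by blast
    qed
  qed (use assms(1) in \<open>auto simp: k_partitions_finite\<close>)
  also have "\<dots> = (\<Sum>b\<in>R - {c}. card {M \<in> matchings (R - {c, b}). E (insert {c, b} M)})"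
  proof (rule sum.cong)
    fix b assume "b \<in> R - {c}"
    hence "bij_betw (insert {c, b}) {M \<in> matchings (R - {c, b}). E (insert {c, b} M)}
           {M \<in> matchings R. E M \<and> {c, b} \<in> M}"
      using assms(2) by (intro bij_betw_insert_doubleton) auto
    thus "card {M \<in> matchings R. E M \<and> {c, b} \<in> M} =
        card {M \<in> matchings (R - {c, b}). E (insert {c, b} M)}"
      using bij_betw_same_card by fastforce
  qed simp
  finally show ?thesis .
qed

lemma card_Diff_doubleton:
  assumes "finite R" "c \<in> R" "b \<in> R - {c}"
  shows "card (R - {c, b}) = card R - 2"
  using assms by (subst card_Diff_subset) auto

text \<open>Since the count depends on the size alone, the partner of a fixed element is uniformly
  distributed.\<close>

lemma card_matchings_eq:
  fixes R R' :: "'a set"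
  assumes "finite R" "finite R'" "card R = card R'"
  shows "card (matchings R) = card (matchings R')"
  using assms
proof (induction "card R" arbitrary: R R' rule: less_induct)
  case less
  show ?case
  proof (cases "R = {}")
    case True
    thus ?thesis using less.prems by simp
  next
    case False
    then obtain c c' where c: "c \<in> R" "c' \<in> R'"
      using less.prems by (metis all_not_in_conv card_eq_0_iff)
    have card: "card (R - {c}) = card (R' - {c'})"
      using c less.prems by simp
    show ?thesis
    \<comment> \<open>For a singleton the recursion is an empty sum; otherwise all its summands
      agree by induction.\<close>
    proof (cases "R - {c} = {}")
      case True
      hence "R' - {c'} = {}"
        using card less.prems by (metis card_eq_0_iff finite_Diff)
      hence "card (matchings R') = 0"
        using card_matchings_step[of R' c' "\<lambda>_. True", OF less.prems(2) c(2)]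
        by (simp only: sum.empty simp_thms Collect_mem_eq)
      moreover have "card (matchings R) = 0"
        using card_matchings_step[of R c "\<lambda>_. True", OF less.prems(1) c(1)]
        by (simp only: True sum.empty simp_thms Collect_mem_eq)
      ultimately show ?thesis by simp
    next
      case False
      then obtain b0 where b0: "b0 \<in> R - {c}" by blast
      have "card (R - {c, b0}) < card R"
        using card_Diff_doubleton[OF less.prems(1) c(1) b0] c less.prems(1)
        by (metis card_gt_0_iff diff_less empty_iff zero_less_numeral)
      have eq: "card (matchings (R - {c, b})) = card (matchings (R - {c, b0}))"
        if "b \<in> R - {c}" for b
        using that b0 c less.prems \<open>card (R - {c, b0}) < card R\<close>
        by (intro less.hyps) (simp_all add: card_Diff_doubleton)
      have eq': "card (matchings (R' - {c', b})) = card (matchings (R - {c, b0}))"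
        if "b \<in> R' - {c'}" for b
        using that b0 c less.prems \<open>card (R - {c, b0}) < card R\<close>
        by (intro less.hyps[symmetric]) (simp_all add: card_Diff_doubleton)
      show ?thesis
        using card_matchings_step[of R c "\<lambda>_. True"] card_matchings_step[of R' c' "\<lambda>_. True"]
          c less.prems eq eq' by simp
    qed
  qed
qed

text \<open>Principle of deferred decisions: the partner of \<open>c\<close> is uniform, and given
  the partner, the rest is again a uniform perfect matching. All later estimates reveal the matching
  in this way.\<close>

lemma matching_prob_step:
  assumes "finite R" "even (card R)" "c \<in> R"
  shows "matching_prob R E =
    (\<Sum>b\<in>R - {c}. matching_prob (R - {c, b}) (\<lambda>M. E (insert {c, b} M))) / real (card R - 1)"
proof -
  have "card R \<noteq> 0" "card R \<noteq> 1" using assms by auto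
  hence "card R \<ge> 2" by linarith
  hence "card (R - {c}) \<noteq> 0"
    using assms by simp
  then obtain b0 where b0: "b0 \<in> R - {c}"
    by (metis card.empty ex_in_conv)
  define m where "m = card (matchings (R - {c, b0}))"
  have m: "card (matchings (R - {c, b})) = m" if "b \<in> R - {c}" for b
    unfolding m_def using that b0 assms
    by (intro card_matchings_eq) (simp_all add: card_Diff_doubleton)
  have tot: "card (matchings R) = card (R - {c}) * m"
    using card_matchings_step[of R c "\<lambda>_. True"] assms m by simp
  have "matching_prob R E =
      (\<Sum>b\<in>R - {c}. real (card {M \<in> matchings (R - {c, b}). E (insert {c, b} M)}) / real m)
        / real (card R - 1)"
    unfolding matching_prob_def tot card_matchings_step[OF assms(1,3)]
    using assms(3) by (simp add: sum_divide_distrib[symmetric] mult.commute)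
  also have "(\<Sum>b\<in>R - {c}. real (card {M \<in> matchings (R - {c, b}). E (insert {c, b} M)}) / real m)
     = (\<Sum>b\<in>R - {c}. matching_prob (R - {c, b}) (\<lambda>M. E (insert {c, b} M)))"
    by (intro sum.cong) (simp_all add: matching_prob_def m)
  finally show ?thesis .
qed

text \<open>The prescribed blocks are revealed one by one. Each induction step lowers both
  \<open>card R\<close> and \<open>k\<close> by 2, so \<open>card R - k\<close> stays fixed and
  serves as a common lower bound for the denominators \<open>card R - 1\<close>.\<close>

lemma matching_prob_edges_le:
  assumes "finite R" "even (card R)" "set (map fst es @ map snd es) \<subseteq> R"
    "distinct (map fst es @ map snd es)" "2 * length es \<le> k" "k < card R"
  shows "matching_prob R (\<lambda>M. \<forall>(a, b)\<in>set es. {a, b} \<in> M) \<le> (1 / real (card R - k)) ^ length es"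
  using assms
proof (induction es arbitrary: R k)
  case Nil
  thus ?case by (simp add: matching_prob_le_1)
next
  case (Cons e es)
  obtain a b where e: "e = (a, b)" by (cases e)
  have ab: "a \<in> R" "b \<in> R - {a}"
    using Cons.prems e by auto
  let ?R = "R - {a, b}"
  have card: "card ?R = card R - 2"
    using ab Cons.prems by (intro card_Diff_doubleton) auto
  have zero: "matching_prob (R - {a, b'}) (\<lambda>M. \<forall>(x, y)\<in>set (e # es). {x, y} \<in> insert {a, b'} M) = 0"
    if "b' \<in> R - {a} - {b}" for b'
  proof (rule matching_prob_eq_0)
    fix M assume "M \<in> matchings (R - {a, b'})"
    hence "{a, b} \<notin> M"
      by (auto simp: k_partitions_def partition_on_def)
    moreover have "{a, b} \<noteq> {a, b'}"
      using that by (auto simp: doubleton_eq_iff)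
    ultimately show "\<not> (\<forall>(x, y)\<in>set (e # es). {x, y} \<in> insert {a, b'} M)"
      by (auto simp: e)
  qed
  have "matching_prob R (\<lambda>M. \<forall>(x, y)\<in>set (e # es). {x, y} \<in> M) =
     (\<Sum>b'\<in>R - {a}. matching_prob (R - {a, b'})
         (\<lambda>M. \<forall>(x, y)\<in>set (e # es). {x, y} \<in> insert {a, b'} M)) / real (card R - 1)"
    using Cons.prems ab by (intro matching_prob_step) auto
  also have "(\<Sum>b'\<in>R - {a}. matching_prob (R - {a, b'})
         (\<lambda>M. \<forall>(x, y)\<in>set (e # es). {x, y} \<in> insert {a, b'} M)) =
      matching_prob ?R (\<lambda>M. \<forall>(x, y)\<in>set (e # es). {x, y} \<in> insert {a, b} M)"
    using Cons.prems(1) ab(2) zero by (subst sum.remove[of _ b]) auto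
  also have "\<dots> \<le> matching_prob ?R (\<lambda>M. \<forall>(x, y)\<in>set es. {x, y} \<in> M)"
  proof (rule matching_prob_mono)
    fix M assume M: "\<forall>(x, y)\<in>set (e # es). {x, y} \<in> insert {a, b} M"
    show "\<forall>(x, y)\<in>set es. {x, y} \<in> M"
    proof clarify
      fix x y assume xy: "(x, y) \<in> set es"
      hence "x \<in> fst ` set es" "y \<in> snd ` set es" by force+
      hence "x \<noteq> a" "y \<noteq> a" using Cons.prems e by auto
      hence "{x, y} \<noteq> {a, b}" by (auto simp: doubleton_eq_iff)
      thus "{x, y} \<in> M" using M xy by auto
    qed
  qed (use Cons.prems in simp)
  also have "\<dots> \<le> (1 / real (card ?R - (k - 2))) ^ length es"
    using Cons.prems card e by (intro Cons.IH) auto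
  also have "card ?R - (k - 2) = card R - k"
    using card Cons.prems by simp
  also have "(1 / real (card R - k)) ^ length es / real (card R - 1)
      \<le> (1 / real (card R - k)) ^ length es * (1 / real (card R - k))"
    using Cons.prems by (auto intro!: mult_left_mono simp: divide_simps)
  finally show ?case
    by (simp add: mult.commute divide_right_mono)
qed


section \<open>Unsatisfiability above the threshold\<close>

text \<open>Under \<open>\<tau>\<close> the literal of the clone \<open>c\<close> is true iff \<open>\<tau> (fst c) \<noteq> s c\<close>.\<close>

definition satisfies :: "('v \<times> 'i \<Rightarrow> bool) \<Rightarrow> ('v \<Rightarrow> bool) \<Rightarrow> ('v \<times> 'i) set set \<Rightarrow> bool" where
  "satisfies s \<tau> M \<longleftrightarrow> (\<forall>B\<in>M. \<exists>c\<in>B. \<tau> (fst c) \<noteq> s c)"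

text \<open>\<open>R\<close> holds the clones that are still unmatched, and \<open>A\<close> those
  among them that are known to be false. This pair is the whole state of an exploration;
  \<open>A = {}\<close> gives satisfiability.\<close>

definition sat_prob :: "('v \<times> 'i \<Rightarrow> bool) \<Rightarrow> ('v \<times> 'i) set \<Rightarrow> ('v \<times> 'i) set \<Rightarrow> real" where
  "sat_prob s R A =
     matching_prob R (\<lambda>M. \<exists>\<tau>. (\<forall>c\<in>A. \<tau> (fst c) = s c) \<and> satisfies s \<tau> M)"

definition opposite_clones ::
    "('v \<times> 'i \<Rightarrow> bool) \<Rightarrow> ('v \<times> 'i) set \<Rightarrow> 'v \<times> 'i \<Rightarrow> ('v \<times> 'i) set" where
  "opposite_clones s R b = {c \<in> R. fst c = fst b \<and> s c \<noteq> s b}"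

lemma sat_prob_le_1: "finite R \<Longrightarrow> sat_prob s R A \<le> 1"
  by (simp add: sat_prob_def matching_prob_le_1)

text \<open>If \<open>c\<close> is false, its partner \<open>b\<close> is true, so every clone opposite to \<open>b\<close> is false;
  this is absurd if \<open>b\<close> itself was assumed to be false.\<close>

lemma sat_prob_step:
  assumes "finite R" "even (card R)" "A \<subseteq> R" "c \<in> A"
    and opp: "\<And>b. b \<in> R - {c} \<Longrightarrow> b \<notin> A \<Longrightarrow> G b \<subseteq> opposite_clones s R b"
  shows "sat_prob s R A \<le>
    (\<Sum>b\<in>R - {c}. if b \<in> A then 0 else sat_prob s (R - {c, b}) (A - {c} \<union> G b)) / real (card R - 1)"
proof -
  have "sat_prob s R A = (\<Sum>b\<in>R - {c}. matching_prob (R - {c, b})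
      (\<lambda>M. \<exists>\<tau>. (\<forall>c\<in>A. \<tau> (fst c) = s c) \<and> satisfies s \<tau> (insert {c, b} M))) / real (card R - 1)"
    unfolding sat_prob_def using assms by (intro matching_prob_step) auto
  also have "\<dots> \<le> (\<Sum>b\<in>R - {c}. if b \<in> A then 0
      else sat_prob s (R - {c, b}) (A - {c} \<union> G b)) / real (card R - 1)"
  proof (intro divide_right_mono sum_mono)
    fix b assume b: "b \<in> R - {c}"
    show "matching_prob (R - {c, b})
        (\<lambda>M. \<exists>\<tau>. (\<forall>c\<in>A. \<tau> (fst c) = s c) \<and> satisfies s \<tau> (insert {c, b} M)) \<le>
      (if b \<in> A then 0 else sat_prob s (R - {c, b}) (A - {c} \<union> G b))"
    proof (cases "b \<in> A")
      case True
      thus ?thesis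
        using assms(4) by (subst matching_prob_eq_0) (auto simp: satisfies_def)
    next
      case False
      have key: "\<tau> (fst c') = s c'"
        if "\<forall>c\<in>A. \<tau> (fst c) = s c" "satisfies s \<tau> (insert {c, b} M)"
          "c' \<in> A - {c} \<union> G b" for \<tau> M c'
      proof -
        have "\<tau> (fst b) \<noteq> s b"
          using that(1,2) assms(4) by (auto simp: satisfies_def)
        thus ?thesis
          using that(1,3) opp[OF b False] by (auto simp: opposite_clones_def)
      qed
      have "matching_prob (R - {c, b})
          (\<lambda>M. \<exists>\<tau>. (\<forall>c\<in>A. \<tau> (fst c) = s c) \<and> satisfies s \<tau> (insert {c, b} M)) \<le>
          sat_prob s (R - {c, b}) (A - {c} \<union> G b)"
        unfolding sat_prob_def
      proof (rule matching_prob_mono)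
        fix M assume "\<exists>\<tau>. (\<forall>c\<in>A. \<tau> (fst c) = s c) \<and> satisfies s \<tau> (insert {c, b} M)"
        then obtain \<tau> where \<tau>: "\<forall>c\<in>A. \<tau> (fst c) = s c" "satisfies s \<tau> (insert {c, b} M)"
          by blast
        hence "\<forall>c'\<in>A - {c} \<union> G b. \<tau> (fst c') = s c'"
          using key by blast
        moreover have "satisfies s \<tau> M"
          using \<tau>(2) by (simp add: satisfies_def)
        ultimately show "\<exists>\<tau>. (\<forall>c\<in>A - {c} \<union> G b. \<tau> (fst c) = s c) \<and> satisfies s \<tau> M"
          by blast
      qed (use assms(1) in simp)
      thus ?thesis
        using False by simp
    qed
  qed simp
  finally show ?thesis .
qed

text \<open>Birthday paradox: the partner of a false clone must lie outside \<open>A\<close>. With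
  \<open>j\<close> other false clones left this has probability
  \<open>1 - j / (card R - 1) \<le> exp (- j / N)\<close>, and the sum of \<open>j\<close> over
  \<open>j < card A\<close> is \<open>card A * (card A - 1) / 2\<close>. The bound \<open>N\<close>
  stays fixed while \<open>R\<close> shrinks.\<close>

lemma sat_prob_le_birthday:
  assumes "finite R" "even (card R)" "A \<subseteq> R" "card R \<le> N" "0 < N"
  shows "sat_prob s R A \<le> exp (- (real (card A) * (real (card A) - 1) / (2 * real N)))"
  using assms
proof (induction "card A" arbitrary: R A)
  case 0
  thus ?case by (simp add: sat_prob_le_1)
next
  case (Suc a)
  have "finite A" using Suc.prems finite_subset by blast
  obtain c where c: "c \<in> A" using Suc.hyps(2) \<open>finite A\<close> by (metis Suc_neq_Zero card.empty ex_in_conv)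
  have cR: "card R \<ge> 2"
    using c Suc.prems by (metis One_nat_def Suc_1 Suc_leI card_gt_0_iff dvd_imp_le equals0D subsetD)
  have "card A \<le> card R" using Suc.prems card_mono by blast
  let ?e = "exp (- (real a * (real a - 1) / (2 * real N)))"
  \<comment> \<open>The choice \<open>G = {}\<close> discards all newly implied clones, so only
    collisions inside \<open>A\<close> count.\<close>
  have "sat_prob s R A \<le> (\<Sum>b\<in>R - {c}. if b \<in> A then 0 else
      sat_prob s (R - {c, b}) (A - {c} \<union> {})) / real (card R - 1)"
    by (rule sat_prob_step) (use Suc.prems c in auto)
  also have "\<dots> \<le> (\<Sum>b\<in>R - {c}. if b \<in> A then 0 else ?e) / real (card R - 1)"
  proof (intro divide_right_mono sum_mono)
    fix b assume b: "b \<in> R - {c}"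
    show "(if b \<in> A then 0 else sat_prob s (R - {c, b}) (A - {c} \<union> {})) \<le> (if b \<in> A then 0 else ?e)"
    proof (cases "b \<in> A")
      case False
      have card: "card (R - {c, b}) = card R - 2"
        using b c Suc.prems by (intro card_Diff_doubleton) auto
      have a: "a = card (A - {c})"
        using Suc.hyps(2) c \<open>finite A\<close> by simp
      have "sat_prob s (R - {c, b}) (A - {c}) \<le> exp (- (real (card (A - {c})) * (real (card (A - {c})) - 1) / (2 * real N)))"
        by (rule Suc.hyps(1)[OF a]) (use card False Suc.prems in auto)
      thus ?thesis using False a by simp
    qed simp
  qed simp
  also have "(\<Sum>b\<in>R - {c}. if b \<in> A then 0 else ?e) = (\<Sum>b\<in>R - A. ?e)"
    using Suc.prems(1) c by (intro sum.mono_neutral_cong_right) auto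
  also have "\<dots> = (real (card R) - real (Suc a)) * ?e"
    using Suc.prems Suc.hyps(2) \<open>finite A\<close> \<open>card A \<le> card R\<close>
    by (simp add: card_Diff_subset of_nat_diff)
  also have "(real (card R) - real (Suc a)) * ?e / real (card R - 1) =
      (1 - real a / (real (card R) - 1)) * ?e"
    using cR by (simp add: of_nat_diff field_simps)
  also have "\<dots> \<le> exp (- (real a / real N)) * ?e"
  proof (rule mult_right_mono)
    have "1 - real a / (real (card R) - 1) \<le> exp (- (real a / (real (card R) - 1)))"
      using exp_ge_add_one_self[of "- (real a / (real (card R) - 1))"] by simp
    also have "\<dots> \<le> exp (- (real a / real N))"
      using cR Suc.prems by (simp add: frac_le)
    finally show "1 - real a / (real (card R) - 1) \<le> exp (- (real a / real N))" .
  qed simp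
  also have "\<dots> = exp (- (real (card A) * (real (card A) - 1) / (2 * real N)))"
    using Suc.prems(5) by (simp add: Suc.hyps(2)[symmetric] exp_add[symmetric] field_simps)
  finally show ?case .
qed

lemma sat_prob_le_birthday_mono:
  assumes "finite R" "even (card R)" "A \<subseteq> R" "card R \<le> N" "0 < N" "a \<le> card A"
  shows "sat_prob s R A \<le> exp (- (real a * (real a - 1) / (2 * real N)))"
proof -
  have "real a * (real a - 1) \<le> real (card A) * (real (card A) - 1)"
    using assms(6) by (cases "a = 0"; cases "card A = 0") (auto intro!: mult_mono)
  hence "exp (- (real (card A) * (real (card A) - 1) / (2 * real N))) \<le>
      exp (- (real a * (real a - 1) / (2 * real N)))"
    using assms(5) by (simp add: divide_right_mono)
  thus ?thesis
    using sat_prob_le_birthday[OF assms(1-5), of s] by linarith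
qed

section \<open>Exploration with positive drift\<close>

lemma card_opposite_clones_le:
  assumes "finite R" "card {c \<in> R. fst c = fst b} \<le> K"
  shows "card (opposite_clones s R b) \<le> K"
proof -
  have "card (opposite_clones s R b) \<le> card {c \<in> R. fst c = fst b}"
    using assms(1) by (intro card_mono) (auto simp: opposite_clones_def)
  thus ?thesis using assms(2) by simp
qed

text \<open>Divided by \<open>card R\<close>, this is the mean number of new false clones produced
  by a uniformly chosen partner, when only partners with variable in \<open>U\<close> are
  counted.\<close>

abbreviation (input) branching ::
    "('v \<times> 'i \<Rightarrow> bool) \<Rightarrow> ('v \<times> 'i) set \<Rightarrow> 'v set \<Rightarrow> real" where
  "branching s R U \<equiv> \<Sum>b\<in>{b \<in> R. fst b \<in> U}. real (card (opposite_clones s R b))"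

text \<open>Controls the exponential moment of one exploration step. In the range
  \<open>-1 < y < 0\<close> it comes from \<open>(1 + y + y^2) * (1 - y) = 1 - y^3 \<ge> 1\<close>
  and \<open>exp (- y) \<ge> 1 - y\<close>.\<close>

lemma exp_le_quadratic:
  fixes y :: real
  assumes "y \<le> 1"
  shows "exp y \<le> 1 + y + y\<^sup>2"
proof (cases "y \<ge> 0")
  case True
  thus ?thesis using exp_bound[of y] assms by simp
next
  case False
  show ?thesis
  proof (cases "y \<le> -1")
    case True
    have "exp y \<le> 1" using False by simp
    moreover have "y + y\<^sup>2 \<ge> 0"
      using True mult_nonpos_nonpos[of y "1 + y"] by (simp add: power2_eq_square algebra_simps)
    ultimately show ?thesis by linarith
  next
    case F2: False
    have "1 - y \<le> exp (- y)" using exp_ge_add_one_self[of "-y"] by simp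
    hence "exp y * (1 - y) \<le> exp y * exp (- y)" by (intro mult_left_mono) auto
    hence "exp y * (1 - y) \<le> 1" by (simp add: exp_minus)
    moreover have "1 \<le> (1 + y + y\<^sup>2) * (1 - y)"
      using False by (simp add: algebra_simps power2_eq_square mult_nonneg_nonpos2)
    ultimately have "exp y * (1 - y) \<le> (1 + y + y\<^sup>2) * (1 - y)" by linarith
    thus ?thesis using False by (simp add: mult_le_cancel_right)
  qed
qed

text \<open>Reveal the partners of the clones in \<open>A\<close> one by one.  The drift condition makes
  \<open>exp (- \<kappa> * card A)\<close> a supermartingale that loses a factor \<open>exp (- \<mu>)\<close> in each step.  The three
  terms bound the probability that \<open>A\<close> dies out, that it stays below \<open>a0\<close> for \<open>t\<close> steps, and that
  it reaches size \<open>a0\<close> without producing a contradiction.  A step uses up one variable of \<open>U\<close> and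
  hence at most \<open>K\<^sup>2\<close> of the drift.\<close>

lemma sat_prob_explore:
  fixes \<delta> \<kappa> \<mu> :: real and K a0 t :: nat
  assumes \<delta>: "0 < \<delta>" "\<delta> \<le> 1" and K: "1 \<le> K"
    and \<kappa>: "\<kappa> = \<delta> / (2 * real K ^ 2)" and \<mu>: "\<mu> = \<delta>\<^sup>2 / (4 * real K ^ 2)"
    and "finite R" "even (card R)" "A \<subseteq> R" "U \<inter> fst ` A = {}" "card R \<le> N" "0 < N"
    and "\<And>v. v \<in> U \<Longrightarrow> card {c \<in> R. fst c = v} \<le> K"
    and "(1 + \<delta>) * real N + real K ^ 2 * real t \<le>
           branching s R U"
  shows "sat_prob s R A \<le> exp (- (\<kappa> * real (card A))) +
           exp (\<kappa> * (real a0 - real (card A)) - \<mu> * real t) +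
           exp (- (real a0 * (real a0 - 1) / (2 * real N)))"
  using assms(6-)
proof (induction t arbitrary: R A U)
  case (0 R A U)
  note birthday = sat_prob_le_birthday_mono[OF 0(1,2,3,5,6), of a0 s]
  show ?case
  proof (cases "a0 \<le> card A")
    case True
    thus ?thesis
      using birthday by (smt (verit) exp_ge_zero)
  next
    case False
    \<comment> \<open>With no steps left and fewer than \<open>a0\<close> false clones, the second
      term alone makes the bound trivial.\<close>
    hence "exp (\<kappa> * (real a0 - real (card A)) - \<mu> * real 0) \<ge> 1"
      using \<delta> K by (simp add: \<kappa>)
    thus ?thesis
      using sat_prob_le_1[OF 0(1), of s A] by (smt (verit) exp_ge_zero)
  qed
next
  case (Suc t R A U)
  note birthday = sat_prob_le_birthday_mono[OF Suc.prems(1,2,3,5,6), of a0 s]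
  have finA: "finite A" using Suc.prems finite_subset by blast
  have \<kappa>pos: "\<kappa> > 0" using \<delta> K by (simp add: \<kappa>)
  have \<kappa>K: "\<kappa> \<le> 1"
  proof -
    have "real K ^ 2 \<ge> 1" using K by simp
    hence "\<delta> \<le> 1 * (2 * real K ^ 2)" using \<delta> by linarith
    thus ?thesis using K by (simp add: \<kappa> divide_le_eq)
  qed
  have \<mu>pos: "\<mu> > 0" using \<delta> K by (simp add: \<mu>)
  let ?\<eta> = "exp (- (real a0 * (real a0 - 1) / (2 * real N)))"
  show ?case
  proof (cases "a0 \<le> card A")
    case True
    thus ?thesis
      using birthday by (smt (verit) exp_ge_zero)
  next
    case less: False
    show ?thesis
    proof (cases "A = {}")
      case True
      hence "exp (- (\<kappa> * real (card A))) = 1" by simp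
      thus ?thesis
        using sat_prob_le_1[OF Suc.prems(1), of s A] by (smt (verit) exp_ge_zero)
    next
      case False
      then obtain c where c: "c \<in> A" by blast
      have UA: "fst z \<notin> U" if "z \<in> A" for z using that Suc.prems(4) by blast
      have cU: "fst c \<notin> U" and cR: "c \<in> R" using c Suc.prems by auto
      have "card R \<noteq> 0" "card R \<noteq> 1"
        using cR Suc.prems(1,2) by auto
      hence R2: "card R \<ge> 2" by linarith
      \<comment> \<open>Successors through variables outside \<open>U\<close> are dropped: such a
        variable may have large degree or may already own clones in \<open>A\<close>. This keeps the
        new clones disjoint from \<open>A\<close> and at most \<open>K\<close> in number.\<close>
      define G where "G = (\<lambda>b. if fst b \<in> U then opposite_clones s R b else {})"
      define a where "a = card A"
      \<comment> \<open>Replacing \<open>c\<close> by the clones in \<open>G b\<close> multiplies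
        both exponentials by the same factor, so they are averaged together; the birthday term does
        not change.\<close>
      define H where "H = exp (- (\<kappa> * real a)) + exp (\<kappa> * (real a0 - real a) - \<mu> * real t)"
      have cardopp: "card (opposite_clones s R b) \<le> K" if "fst b \<in> U" for b
        using Suc.prems(1) Suc.prems(7)[OF that] by (rule card_opposite_clones_le)
      have GK: "card (G b) \<le> K" for b
        using cardopp by (simp add: G_def)
      have branch: "sat_prob s (R - {c, b}) (A - {c} \<union> G b) \<le> H * exp (\<kappa> * (1 - real (card (G b)))) + ?\<eta>"
        if b: "b \<in> R - {c}" "b \<notin> A" for b
      proof -
        let ?R = "R - {c, b}" and ?A = "A - {c} \<union> G b" and ?U = "U - {fst b}"
        have cardR: "card ?R = card R - 2"
          using b cR Suc.prems by (intro card_Diff_doubleton) auto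
        have GA: "G b \<inter> A = {}"
          by (auto simp: G_def opposite_clones_def dest: UA)
        have finG: "finite (G b)"
          using Suc.prems(1) by (auto simp: G_def opposite_clones_def)
        have cardA: "card ?A = a - 1 + card (G b)"
          using GA finG finA c by (subst card_Un_disjoint) (auto simp: a_def)
        have a1: "a \<ge> 1" using c finA by (auto simp: a_def Suc_le_eq card_gt_0_iff)
        \<comment> \<open>The variables of \<open>c\<close> and \<open>b\<close> both lie outside
          \<open>?U\<close>, so removing these two clones leaves the successors counted by the new
          drift intact.\<close>
        have opp_eq: "opposite_clones s ?R b' = opposite_clones s R b'" if "fst b' \<in> ?U" for b'
          using that cU by (auto simp: opposite_clones_def)
        have sub: "{b' \<in> R. fst b' \<in> U} \<subseteq> {b' \<in> ?R. fst b' \<in> ?U} \<union> {b' \<in> R. fst b' = fst b \<and> fst b \<in> U}"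
          using cU by auto
        have "branching s R U \<le>
            (\<Sum>b'\<in>{b' \<in> ?R. fst b' \<in> ?U} \<union> {b' \<in> R. fst b' = fst b \<and> fst b \<in> U}. real (card (opposite_clones s R b')))"
          using Suc.prems(1) sub by (intro sum_mono2) auto
        also have "\<dots> \<le> (\<Sum>b'\<in>{b' \<in> ?R. fst b' \<in> ?U}. real (card (opposite_clones s R b'))) +
            (\<Sum>b'\<in>{b' \<in> R. fst b' = fst b \<and> fst b \<in> U}. real (card (opposite_clones s R b')))"
          using Suc.prems(1) by (subst sum.union_disjoint) auto
        also have "(\<Sum>b'\<in>{b' \<in> R. fst b' = fst b \<and> fst b \<in> U}. real (card (opposite_clones s R b')))
            \<le> (\<Sum>b'\<in>{b' \<in> R. fst b' = fst b \<and> fst b \<in> U}. real K)"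
          using cardopp by (intro sum_mono) (auto simp del: of_nat_sum)
        also have "\<dots> \<le> real K * real K"
          using Suc.prems(7)[of "fst b"] by (cases "fst b \<in> U") (auto intro!: mult_right_mono)
        also have "(\<Sum>b'\<in>{b' \<in> ?R. fst b' \<in> ?U}. real (card (opposite_clones s R b'))) =
            branching s ?R ?U"
          by (intro sum.cong) (auto simp: opp_eq)
        finally have drift: "(1 + \<delta>) * real N + real K ^ 2 * real t \<le>
            branching s ?R ?U"
          using Suc.prems(8) by (simp add: algebra_simps power2_eq_square)
        have "sat_prob s ?R ?A \<le> exp (- (\<kappa> * real (card ?A))) +
           exp (\<kappa> * (real a0 - real (card ?A)) - \<mu> * real t) + ?\<eta>"
        proof (rule Suc.IH[of ?R ?A ?U])
          show "?A \<subseteq> ?R"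
            using Suc.prems(3) b c cU by (auto simp: G_def opposite_clones_def split: if_splits)
          show "?U \<inter> fst ` ?A = {}"
            by (auto simp: G_def opposite_clones_def dest: UA)
          show "card {c' \<in> ?R. fst c' = v} \<le> K" if "v \<in> ?U" for v
          proof -
            have "card {c' \<in> ?R. fst c' = v} \<le> card {c' \<in> R. fst c' = v}"
              using Suc.prems(1) by (intro card_mono) auto
            thus ?thesis using Suc.prems(7)[of v] that by simp
          qed
        qed (use Suc.prems cardR drift R2 in auto)
        also have "exp (- (\<kappa> * real (card ?A))) = exp (- (\<kappa> * real a)) * exp (\<kappa> * (1 - real (card (G b))))"
          using a1 by (simp add: cardA of_nat_diff exp_add[symmetric] algebra_simps)
        also have "exp (\<kappa> * (real a0 - real (card ?A)) - \<mu> * real t) =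
           exp (\<kappa> * (real a0 - real a) - \<mu> * real t) * exp (\<kappa> * (1 - real (card (G b))))"
          using a1 by (simp add: cardA of_nat_diff exp_add[symmetric] algebra_simps)
        finally show ?thesis by (simp add: H_def algebra_simps)
      qed
      have Hpos: "H \<ge> 0" by (simp add: H_def)
      let ?n = "real (card R - 1)"
      have npos: "?n > 0" using R2 by simp
      have cardRc: "real (card (R - {c})) = ?n"
        using cR by simp
      have exp_bound: "exp (\<kappa> * (1 - real (card (G b)))) \<le>
          1 + \<kappa> * (1 - real (card (G b))) + \<kappa>\<^sup>2 * real K ^ 2" for b
      proof -
        have "\<kappa> * (1 - real (card (G b))) \<le> \<kappa> * 1"
          using \<kappa>pos by (intro mult_left_mono) auto
        hence "exp (\<kappa> * (1 - real (card (G b)))) \<le>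
          1 + \<kappa> * (1 - real (card (G b))) + (\<kappa> * (1 - real (card (G b))))\<^sup>2"
          using \<kappa>K by (intro exp_le_quadratic) simp
        also have "(1 - real (card (G b)))\<^sup>2 \<le> real K ^ 2"
          using GK[of b] K by (intro abs_le_square_iff[THEN iffD1]) (auto simp: abs_if)
        hence "(\<kappa> * (1 - real (card (G b))))\<^sup>2 \<le> \<kappa>\<^sup>2 * real K ^ 2"
          by (simp add: power_mult_distrib mult_left_mono)
        finally show ?thesis by simp
      qed
      have sumG: "(\<Sum>b\<in>R - {c}. real (card (G b))) =
          branching s R U"
        using Suc.prems(1) cU by (intro sum.mono_neutral_cong_right) (auto simp: G_def)
      have "(1 + \<delta>) * ?n \<le> (1 + \<delta>) * real N"
        using \<delta> Suc.prems(5) by (intro mult_left_mono) auto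
      also have "\<dots> \<le> (1 + \<delta>) * real N + real K ^ 2 * real (Suc t)" by simp
      also have "\<dots> \<le> (\<Sum>b\<in>R - {c}. real (card (G b)))"
        using Suc.prems(8) sumG by simp
      finally have sumG_ge: "(1 + \<delta>) * ?n \<le> (\<Sum>b\<in>R - {c}. real (card (G b)))" .
      \<comment> \<open>A step consumes one clone and gains at least \<open>1 + \<delta>\<close> on
        average, so the first-order term saves \<open>\<kappa> * \<delta>\<close>, against a
        second-order loss of at most \<open>\<kappa>^2 * K^2\<close>.\<close>
      have "(\<Sum>b\<in>R - {c}. exp (\<kappa> * (1 - real (card (G b))))) \<le>
          (\<Sum>b\<in>R - {c}. (1 + \<kappa> + \<kappa>\<^sup>2 * real K ^ 2) - \<kappa> * real (card (G b)))"
        using exp_bound by (intro sum_mono) (simp add: algebra_simps)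
      also have "\<dots> = ?n * (1 + \<kappa> + \<kappa>\<^sup>2 * real K ^ 2) - \<kappa> * (\<Sum>b\<in>R - {c}. real (card (G b)))"
        by (simp only: sum_subtractf sum_distrib_left[symmetric] sum_constant cardRc)
      also have "\<dots> \<le> ?n * (1 + \<kappa> + \<kappa>\<^sup>2 * real K ^ 2) - \<kappa> * ((1 + \<delta>) * ?n)"
        using sumG_ge \<kappa>pos by simp
      also have "\<dots> = ?n * (1 - (\<kappa> * \<delta> - \<kappa>\<^sup>2 * real K ^ 2))"
        by (simp add: algebra_simps)
      \<comment> \<open>The given \<kappa> maximises the left-hand side, and \<mu> is the
        maximum.\<close>
      also have "\<kappa> * \<delta> - \<kappa>\<^sup>2 * real K ^ 2 = \<mu>"
        using K by (simp add: \<kappa> \<mu> field_simps power2_eq_square)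
      also have "?n * (1 - \<mu>) \<le> ?n * exp (- \<mu>)"
        using exp_ge_add_one_self[of "- \<mu>"] npos by (intro mult_left_mono) auto
      finally have avg: "(\<Sum>b\<in>R - {c}. exp (\<kappa> * (1 - real (card (G b))))) \<le> ?n * exp (- \<mu>)" .
      have "sat_prob s R A \<le> (\<Sum>b\<in>R - {c}. if b \<in> A then 0
           else sat_prob s (R - {c, b}) (A - {c} \<union> G b)) / ?n"
        by (rule sat_prob_step) (use Suc.prems c in \<open>auto simp: G_def\<close>)
      also have "\<dots> \<le> (\<Sum>b\<in>R - {c}. H * exp (\<kappa> * (1 - real (card (G b)))) + ?\<eta>) / ?n"
        using branch Hpos by (intro divide_right_mono sum_mono) auto
      also have "\<dots> = H * (\<Sum>b\<in>R - {c}. exp (\<kappa> * (1 - real (card (G b))))) / ?n + ?\<eta>"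
        using npos by (simp add: sum.distrib sum_distrib_left[symmetric] cardRc add_divide_distrib del: of_nat_diff card_Diff_insert)
      also have "\<dots> \<le> H * (?n * exp (- \<mu>)) / ?n + ?\<eta>"
        using avg Hpos npos by (intro add_right_mono divide_right_mono mult_left_mono) auto
      also have "\<dots> = exp (- (\<kappa> * real a)) * exp (- \<mu>) + exp (\<kappa> * (real a0 - real a) - \<mu> * real (Suc t)) + ?\<eta>"
      proof -
        have "H * (?n * exp (- \<mu>)) / ?n = H * exp (- \<mu>)" using npos by simp
        thus ?thesis by (simp add: H_def distrib_right exp_add[symmetric] algebra_simps)
      qed
      also have "exp (- (\<kappa> * real a)) * exp (- \<mu>) \<le> exp (- (\<kappa> * real a)) * 1"
        using \<mu>pos by (intro mult_left_mono) auto
      finally show ?thesis by (simp add: a_def)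
    qed
  qed
qed

section \<open>Refuting both values of one variable\<close>

lemma sat_prob_split:
  assumes "finite R"
  shows "sat_prob s R {} \<le> sat_prob s R {c \<in> R. fst c = x \<and> s c} + sat_prob s R {c \<in> R. fst c = x \<and> \<not> s c}"
proof -
  let ?P = "\<lambda>A M. \<exists>\<tau>. (\<forall>c\<in>A. \<tau> (fst c) = s c) \<and> satisfies s \<tau> M"
  have "sat_prob s R {} \<le> matching_prob R (\<lambda>M. ?P {c \<in> R. fst c = x \<and> s c} M \<or> ?P {c \<in> R. fst c = x \<and> \<not> s c} M)"
    unfolding sat_prob_def
  proof (rule matching_prob_mono)
    fix M assume "\<exists>\<tau>. (\<forall>c\<in>{}. \<tau> (fst c) = s c) \<and> satisfies s \<tau> M"
    then obtain \<tau> where \<tau>: "satisfies s \<tau> M" by blast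
    show "?P {c \<in> R. fst c = x \<and> s c} M \<or> ?P {c \<in> R. fst c = x \<and> \<not> s c} M"
    proof (cases "\<tau> x")
      case True
      hence "?P {c \<in> R. fst c = x \<and> s c} M" using \<tau> by (intro exI[of _ \<tau>]) auto
      thus ?thesis ..
    next
      case False
      hence "?P {c \<in> R. fst c = x \<and> \<not> s c} M" using \<tau> by (intro exI[of _ \<tau>]) auto
      thus ?thesis ..
    qed
  qed fact
  also have "\<dots> \<le> sat_prob s R {c \<in> R. fst c = x \<and> s c} + sat_prob s R {c \<in> R. fst c = x \<and> \<not> s c}"
    unfolding sat_prob_def by (rule matching_prob_disj) fact
  finally show ?thesis .
qed

text \<open>Either value of \<open>x\<close> makes at least \<open>a\<close> of its clones false at
  once, so the birthday bound applies directly; the factor 2 counts the two values.\<close>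

lemma sat_prob_hub:
  assumes "finite R" "even (card R)" "R \<noteq> {}"
    and "a \<le> card {c \<in> R. fst c = x \<and> s c}" "a \<le> card {c \<in> R. fst c = x \<and> \<not> s c}"
  shows "sat_prob s R {} \<le> 2 * exp (- (real a * (real a - 1) / (2 * real (card R))))"
proof -
  have N: "card R > 0" using assms by (simp add: card_gt_0_iff)
  have "sat_prob s R A \<le> exp (- (real a * (real a - 1) / (2 * real (card R))))"
    if "A \<subseteq> R" "a \<le> card A" for A
    using assms N that by (intro sat_prob_le_birthday_mono) auto
  from this[of "{c \<in> R. fst c = x \<and> s c}"] this[of "{c \<in> R. fst c = x \<and> \<not> s c}"]
  show ?thesis
    using sat_prob_split[OF assms(1), of s x] assms by fastforce
qed

text \<open>\<open>D\<close> and \<open>N0\<close> depend only on \<delta>, \<open>K\<close> and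
  \<epsilon>, so the bound serves all good degree sequences at once. Starting from \<open>D\<close>
  false clones makes early extinction unlikely. Half of the surplus \<open>2 * \<delta>\<close> pays
  for removing \<open>x\<close> from \<open>U\<close> and for the drift lost during the
  exploration.\<close>

lemma sat_prob_supercritical:
  fixes \<delta> \<epsilon> :: real and K :: nat
  assumes \<delta>: "0 < \<delta>" "\<delta> \<le> 1" and K: "1 \<le> K" and \<epsilon>: "\<epsilon> > 0"
  obtains D N0 :: nat where
    "\<And>(s :: 'v \<times> 'i \<Rightarrow> bool) R U x. finite R \<Longrightarrow> even (card R) \<Longrightarrow> N0 \<le> card R \<Longrightarrow>
       (\<And>v. v \<in> U \<Longrightarrow> card {c \<in> R. fst c = v} \<le> K) \<Longrightarrow>
       (1 + 2 * \<delta>) * real (card R) \<le>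
         branching s R U \<Longrightarrow>
       D \<le> card {c \<in> R. fst c = x \<and> s c} \<Longrightarrow> D \<le> card {c \<in> R. fst c = x \<and> \<not> s c} \<Longrightarrow>
       sat_prob s R {} \<le> \<epsilon>"
proof -
  define \<kappa> where "\<kappa> = \<delta> / (2 * real K ^ 2)"
  define \<mu> where "\<mu> = \<delta>\<^sup>2 / (4 * real K ^ 2)"
  have pos: "\<kappa> > 0" "\<mu> > 0" using \<delta> K by (auto simp: \<kappa>_def \<mu>_def)
  have "((\<lambda>D. exp (- (\<kappa> * real D))) \<longlongrightarrow> 0) sequentially"
    using pos by real_asymp
  \<comment> \<open>Two values of \<open>x\<close> and three error terms for each: every term is to
    stay below \<open>\<epsilon> / 6\<close>.\<close>
  hence "eventually (\<lambda>D. exp (- (\<kappa> * real D)) < \<epsilon> / 6) sequentially"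
    using \<epsilon> by (intro order_tendstoD(2)[of _ 0]) auto
  then obtain D :: nat where D: "exp (- (\<kappa> * real D)) < \<epsilon> / 6"
    by (auto simp: eventually_sequentially)
  \<comment> \<open>Target size of the set of false clones. An exponent above 1/2 makes a collision
    almost certain; one below 1 keeps the drift lost in the exploration of smaller order than
    \<open>N\<close>.\<close>
  define f where "f = (\<lambda>N::nat. nat \<lceil>real N powr (3/5)\<rceil>)"
  have f: "real N powr (3/5) \<le> real (f N)" "real (f N) \<le> real N powr (3/5) + 1" for N
    by (auto simp: f_def)
  \<comment> \<open>Number of steps, chosen so that
    \<open>\<mu> * t \<ge> 2 * \<kappa> * a0\<close>; the second error term is then at most
    \<open>exp (- \<kappa> * a0)\<close>.\<close>
  define g where "g = (\<lambda>N::nat. nat \<lceil>4 * real (f N) / \<delta>\<rceil>)"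
  have g: "4 * real (f N) / \<delta> \<le> real (g N)" "real (g N) \<le> 4 * real (f N) / \<delta> + 1" for N
    using \<delta> by (auto simp: g_def) 
  have K2: "real K ^ 2 > 0" using K by simp
  have "eventually (\<lambda>N. real K ^ 2 * (4 * (real N powr (3/5) + 1) / \<delta> + 2) \<le> \<delta> * real N) sequentially"
    using K2 \<delta>(1) by real_asymp
  moreover have "((\<lambda>N. exp (- (\<kappa> * real N powr (3/5)))) \<longlongrightarrow> 0) sequentially"
    using pos by real_asymp
  hence "eventually (\<lambda>N. exp (- (\<kappa> * real N powr (3/5))) < \<epsilon> / 6) sequentially"
    using \<epsilon> by (intro order_tendstoD(2)[of _ 0]) auto
  moreover have "((\<lambda>N. exp (- (real N powr (3/5) * (real N powr (3/5) - 1) / (2 * real N)))) \<longlongrightarrow> 0) sequentially"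
    by real_asymp
  hence "eventually (\<lambda>N. exp (- (real N powr (3/5) * (real N powr (3/5) - 1) / (2 * real N))) < \<epsilon> / 6) sequentially"
    using \<epsilon> by (intro order_tendstoD(2)[of _ 0]) auto
  ultimately have "eventually (\<lambda>N. 0 < N \<and> real K ^ 2 * (4 * (real N powr (3/5) + 1) / \<delta> + 2) \<le> \<delta> * real N \<and>
      exp (- (\<kappa> * real N powr (3/5))) < \<epsilon> / 6 \<and>
      exp (- (real N powr (3/5) * (real N powr (3/5) - 1) / (2 * real N))) < \<epsilon> / 6) sequentially"
    using eventually_gt_at_top[of 0] by eventually_elim auto
  then obtain N0 where N0: "\<And>N. N \<ge> N0 \<Longrightarrow> 0 < N \<and>
      real K ^ 2 * (4 * (real N powr (3/5) + 1) / \<delta> + 2) \<le> \<delta> * real N \<and>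
      exp (- (\<kappa> * real N powr (3/5))) < \<epsilon> / 6 \<and>
      exp (- (real N powr (3/5) * (real N powr (3/5) - 1) / (2 * real N))) < \<epsilon> / 6"
    by (auto simp: eventually_sequentially)
  show ?thesis
  proof (rule that[of N0 D])
    fix s :: "'v \<times> 'i \<Rightarrow> bool" and R U x
    assume R: "finite R" "even (card R)" "N0 \<le> card R"
      and U: "\<And>v. v \<in> U \<Longrightarrow> card {c \<in> R. fst c = v} \<le> K"
      and drift: "(1 + 2 * \<delta>) * real (card R) \<le>
         branching s R U"
      and x: "D \<le> card {c \<in> R. fst c = x \<and> s c}" "D \<le> card {c \<in> R. fst c = x \<and> \<not> s c}"
    define N where "N = card R"
    define a0 where "a0 = f N"
    define t where "t = g N"
    note N = N0[of N, folded a0_def]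
    have Npos: "N > 0" using N0[of N] R(3) by (simp add: N_def)
    have a0: "real N powr (3/5) \<le> real a0" "real a0 \<le> real N powr (3/5) + 1"
      using f[of N] by (auto simp: a0_def)
    have t: "4 * real a0 / \<delta> \<le> real t" "real t \<le> 4 * real a0 / \<delta> + 1"
      using g[of N] by (auto simp: a0_def t_def)
    have opp_le: "real (card (opposite_clones s R b)) \<le> real K" if "fst b \<in> U" for b
      using card_opposite_clones_le[OF R(1) U[OF that]] by simp
    \<comment> \<open>The starting clones belong to \<open>x\<close>, so \<open>x\<close> has to
      leave \<open>U\<close>; if it was there, this costs at most \<open>K^2\<close>.\<close>
    have "branching s R U =
       (\<Sum>b\<in>{b \<in> R. fst b \<in> U - {x}} \<union> {b \<in> R. fst b = x \<and> x \<in> U}. real (card (opposite_clones s R b)))"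
      by (rule sum.cong) auto
    also have "\<dots> = branching s R (U - {x}) +
       (\<Sum>b\<in>{b \<in> R. fst b = x \<and> x \<in> U}. real (card (opposite_clones s R b)))"
      using R(1) by (subst sum.union_disjoint) auto
    also have "(\<Sum>b\<in>{b \<in> R. fst b = x \<and> x \<in> U}. real (card (opposite_clones s R b))) \<le>
       (\<Sum>b\<in>{b \<in> R. fst b = x \<and> x \<in> U}. real K)"
      using opp_le by (intro sum_mono) auto
    also have "\<dots> \<le> real K * real K"
      using U[of x] by (cases "x \<in> U") (auto intro!: mult_right_mono)
    finally have drift': "(1 + 2 * \<delta>) * real N - real K ^ 2 \<le>
        branching s R (U - {x})"
      using drift by (simp add: N_def power2_eq_square)
    have "real K ^ 2 * (real t + 1) \<le> real K ^ 2 * (4 * (real N powr (3/5) + 1) / \<delta> + 2)"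
    proof (rule mult_left_mono)
      have "4 * real a0 / \<delta> \<le> 4 * (real N powr (3/5) + 1) / \<delta>"
        using a0 \<delta> by (intro divide_right_mono) auto
      thus "real t + 1 \<le> 4 * (real N powr (3/5) + 1) / \<delta> + 2" using t by linarith
    qed simp
    also have "\<dots> \<le> \<delta> * real N" using N R(3) by (simp add: N_def)
    finally have drift'': "(1 + \<delta>) * real N + real K ^ 2 * real t \<le>
        branching s R (U - {x})"
      using drift' by (simp add: algebra_simps)
    have main: "sat_prob s R A \<le> \<epsilon> / 2"
      if A: "A \<subseteq> R" "fst ` A \<subseteq> {x}" "D \<le> card A" for A
    proof -
      have "sat_prob s R A \<le> exp (- (\<kappa> * real (card A))) +
           exp (\<kappa> * (real a0 - real (card A)) - \<mu> * real t) +
           exp (- (real a0 * (real a0 - 1) / (2 * real N)))"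
        by (rule sat_prob_explore[OF \<delta> K \<kappa>_def \<mu>_def R(1,2) A(1), where U = "U - {x}"])
           (use A U drift'' Npos in \<open>auto simp: N_def\<close>)
      also have "exp (- (\<kappa> * real (card A))) \<le> exp (- (\<kappa> * real D))"
        using A pos by simp
      also have "exp (\<kappa> * (real a0 - real (card A)) - \<mu> * real t) \<le> exp (- (\<kappa> * real N powr (3/5)))"
      proof -
        have "\<mu> * (4 * real a0 / \<delta>) \<le> \<mu> * real t"
          using t pos by (intro mult_left_mono) auto
        also have "\<mu> * (4 * real a0 / \<delta>) = 2 * \<kappa> * real a0"
          using \<delta> K by (simp add: \<mu>_def \<kappa>_def field_simps power2_eq_square)
        finally have "\<kappa> * (real a0 - real (card A)) - \<mu> * real t \<le> - (\<kappa> * real a0)"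
          using pos by (simp add: algebra_simps add_nonneg_nonneg) (smt (verit) mult_nonneg_nonneg of_nat_0_le_iff)
        also have "\<dots> \<le> - (\<kappa> * real N powr (3/5))"
          using a0 pos by simp
        finally show ?thesis by simp
      qed
      also have "exp (- (real a0 * (real a0 - 1) / (2 * real N))) \<le>
          exp (- (real N powr (3/5) * (real N powr (3/5) - 1) / (2 * real N)))"
      proof -
        have "real N powr (3/5) \<ge> 1" using Npos by (simp add: ge_one_powr_ge_zero)
        hence "real N powr (3/5) * (real N powr (3/5) - 1) \<le> real a0 * (real a0 - 1)"
          using a0 by (intro mult_mono) auto
        thus ?thesis using Npos by (simp add: divide_right_mono)
      qed
      finally show ?thesis using N R(3) D by (simp add: N_def)
    qed
    show "sat_prob s R {} \<le> \<epsilon>"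
      using sat_prob_split[OF R(1), of s x] main[of "{c \<in> R. fst c = x \<and> s c}"]
        main[of "{c \<in> R. fst c = x \<and> \<not> s c}"] x by fastforce
  qed
qed


section \<open>Bicycles\<close>

text \<open>The literal \<open>(v, b)\<close> is true under \<open>\<tau>\<close> iff \<open>\<tau> v = b\<close>.\<close>

definition clone_lit :: "('v \<times> 'i \<Rightarrow> bool) \<Rightarrow> 'v \<times> 'i \<Rightarrow> 'v \<times> bool" where
  "clone_lit s c = (fst c, \<not> s c)"

definition neg_lit :: "'v \<times> bool \<Rightarrow> 'v \<times> bool" where
  "neg_lit l = (fst l, \<not> snd l)"

text \<open>The implication digraph of a 2-CNF. A block is unordered, so each clause contributes an
  edge together with its contrapositive.\<close>

definition implications :: "('v \<times> 'i \<Rightarrow> bool) \<Rightarrow> ('v \<times> 'i) set set \<Rightarrow> (('v \<times> bool) \<times> ('v \<times> bool)) set" where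
  "implications s M = {(l, l'). \<exists>c c'. {c, c'} \<in> M \<and> c \<noteq> c' \<and> clone_lit s c = neg_lit l \<and> clone_lit s c' = l'}"

lemma implicationsI:
  "{c, c'} \<in> M \<Longrightarrow> c \<noteq> c' \<Longrightarrow> clone_lit s c = neg_lit l \<Longrightarrow> clone_lit s c' = l' \<Longrightarrow>
     (l, l') \<in> implications s M"
  unfolding implications_def by blast

lemma implicationsE:
  assumes "(l, l') \<in> implications s M"
  obtains c c' where "{c, c'} \<in> M" "c \<noteq> c'" "clone_lit s c = neg_lit l" "clone_lit s c' = l'"
  using assms unfolding implications_def by blast

lemma neg_lit_neg_lit [simp]: "neg_lit (neg_lit l) = l"
  by (simp add: neg_lit_def)

lemma fst_clone_lit [simp]: "fst (clone_lit s c) = fst c"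
  by (simp add: clone_lit_def)

lemma fst_neg_lit [simp]: "fst (neg_lit l) = fst l"
  by (simp add: neg_lit_def)

lemma neg_lit_neq [simp]: "neg_lit l \<noteq> l" "l \<noteq> neg_lit l"
  by (cases l; simp add: neg_lit_def)+

lemma eq_or_neg_lit: "fst l = fst l' \<Longrightarrow> l = l' \<or> l = neg_lit l'"
  by (cases l; cases l') (auto simp: neg_lit_def)

lemma implications_contrapos:
  assumes "(l, l') \<in> implications s M"
  shows "(neg_lit l', neg_lit l) \<in> implications s M"
proof -
  obtain c c' where c: "{c, c'} \<in> M" "c \<noteq> c'" "clone_lit s c = neg_lit l" "clone_lit s c' = l'"
    using assms by (rule implicationsE)
  show ?thesis
    using c by (intro implicationsI[of c' c]) (auto simp: insert_commute)
qed

lemma implications_rtrancl_contrapos: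
  assumes "(l, l') \<in> (implications s M)\<^sup>*"
  shows "(neg_lit l', neg_lit l) \<in> (implications s M)\<^sup>*"
  using assms
  by (induction rule: rtrancl_induct)
     (auto intro: implications_contrapos converse_rtrancl_into_rtrancl)

text \<open>A maximal set of literals that is consistent and closed under implication must decide
  every variable: an undecided literal could be added with all its consequences unless it implies
  its own negation, and if this holds for both signs there is a contradictory cycle. A set that
  decides every variable is a satisfying assignment.\<close>

lemma unsat_imp_contradictory_cycle:
  assumes M: "M \<in> matchings R" and "finite R" and unsat: "\<nexists>\<tau>. satisfies s \<tau> M"
  obtains l where "(l, neg_lit l) \<in> (implications s M)\<^sup>*" "(neg_lit l, l) \<in> (implications s M)\<^sup>*"
proof (rule ccontr)
  assume "\<not> thesis"
  hence no: "\<not> ((l, neg_lit l) \<in> (implications s M)\<^sup>* \<and> (neg_lit l, l) \<in> (implications s M)\<^sup>*)" for l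
    using that by blast
  let ?I = "implications s M"
  define L where "L = fst ` R \<times> (UNIV :: bool set)"
  have "finite L" using assms(2) by (simp add: L_def)
  have UM: "\<Union>M = R" using M by (auto simp: k_partitions_def partition_on_def)
  have L: "l' \<in> L" if ll: "(l, l') \<in> ?I" for l l'
  proof -
    obtain c c' where c: "{c, c'} \<in> M" "clone_lit s c' = l'"
      using ll by (rule implicationsE)
    hence "c' \<in> R" using UM by blast
    thus ?thesis using c(2) by (auto simp: L_def clone_lit_def)
  qed
  have Lr: "l' \<in> L" if "(l, l') \<in> ?I\<^sup>*" "l \<in> L" for l l'
    using that by (induction rule: rtrancl_induct) (auto intro: L)
  define good where "good T \<longleftrightarrow> T \<subseteq> L \<and> ?I `` T \<subseteq> T \<and> (\<forall>l\<in>T. neg_lit l \<notin> T)" for T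
  have "\<exists>T. good T \<and> (\<forall>T'. good T' \<and> T \<subseteq> T' \<longrightarrow> T' = T)"
  proof -
    have fin: "finite {T. good T}"
      by (rule finite_subset[of _ "Pow L"]) (auto simp: good_def \<open>finite L\<close>)
    have "{} \<in> {T. good T}" by (simp add: good_def)
    from finite_has_maximal2[OF fin this] show ?thesis by auto
  qed
  then obtain T where T: "good T" and max: "\<And>T'. good T' \<Longrightarrow> T \<subseteq> T' \<Longrightarrow> T' = T"
    by blast
  have closed: "l' \<in> T" if "(l, l') \<in> ?I\<^sup>*" "l \<in> T" for l l'
    using that T by (induction rule: rtrancl_induct) (auto simp: good_def)
  have ext: "(l, neg_lit l) \<in> ?I\<^sup>*" if l: "l \<in> L" "l \<notin> T" "neg_lit l \<notin> T" for l
  proof (rule ccontr)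
    assume notin: "(l, neg_lit l) \<notin> ?I\<^sup>*"
    define T' where "T' = T \<union> ?I\<^sup>* `` {l}"
    have "good T'"
      unfolding good_def
    proof (intro conjI ballI)
      show "T' \<subseteq> L" using T l(1) Lr by (auto simp: T'_def good_def)
      show "?I `` T' \<subseteq> T'" using T by (auto simp: T'_def good_def intro: rtrancl_into_rtrancl)
      fix k assume k: "k \<in> T'"
      show "neg_lit k \<notin> T'"
      proof
        assume k': "neg_lit k \<in> T'"
        \<comment> \<open>A clash between \<open>T\<close> and a consequence of \<open>l\<close>
          would by contraposition put \<open>neg_lit l\<close> into \<open>T\<close>; a clash
          between two consequences would make \<open>l\<close> imply
          \<open>neg_lit l\<close>.\<close>
        have a: False if "p \<in> T" "(l, neg_lit p) \<in> ?I\<^sup>*" for p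
          using implications_rtrancl_contrapos[OF that(2)] closed that(1) l(3) by simp
        have b: "(l, neg_lit l) \<in> ?I\<^sup>*" if "(l, k) \<in> ?I\<^sup>*" "(l, neg_lit k) \<in> ?I\<^sup>*"
          using implications_rtrancl_contrapos[OF that(2)] that(1) by simp
        show False
          using k k' a[of k] a[of "neg_lit k"] b notin T by (auto simp: T'_def good_def)
      qed
    qed
    hence "T' = T" by (intro max) (auto simp: T'_def)
    moreover have "l \<in> T'" by (auto simp: T'_def)
    ultimately show False using l(2) by simp
  qed
  have total: "l \<in> T \<or> neg_lit l \<in> T" if "l \<in> L" for l
  proof (rule ccontr)
    assume "\<not> (l \<in> T \<or> neg_lit l \<in> T)"
    moreover have "neg_lit l \<in> L" using that by (force simp: L_def neg_lit_def)
    ultimately show False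
      using ext[of l] ext[of "neg_lit l"] that no[of l] by auto
  qed
  have "satisfies s (\<lambda>v. (v, True) \<in> T) M"
    unfolding satisfies_def
  proof
    fix B assume B: "B \<in> M"
    then obtain c c' where cc: "B = {c, c'}" "c \<noteq> c'"
      using M by (auto simp: k_partitions_def card_2_iff)
    have val: "((fst c, True) \<in> T) = (\<not> s c)" if "clone_lit s c \<in> T" for c
      using that T by (cases "s c") (auto simp: good_def clone_lit_def neg_lit_def)
    show "\<exists>c\<in>B. ((fst c, True) \<in> T) \<noteq> s c"
    proof (cases "clone_lit s c \<in> T")
      case True
      thus ?thesis using val cc by auto
    next
      case False
      have "clone_lit s c \<in> L" using B cc UM by (force simp: L_def clone_lit_def)
      hence "neg_lit (clone_lit s c) \<in> T" using False total by blast
      moreover have "(neg_lit (clone_lit s c), clone_lit s c') \<in> ?I"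
        using B cc by (intro implicationsI[of c c']) auto
      ultimately have "clone_lit s c' \<in> T" using closed by blast
      thus ?thesis using val cc by auto
    qed
  qed
  thus False using unsat by blast
qed

text \<open>The walk towards \<open>z\<close> is followed until it meets a variable for the second
  time, which happens at \<open>z\<close> at the latest. The meeting literal \<open>y\<close> may
  have either sign.\<close>

lemma path_extension:
  assumes "(last ws, z) \<in> I\<^sup>+" "distinct (map fst ws)" "ws \<noteq> []"
    "successively (\<lambda>x y. (x, y) \<in> I) ws" "fst z \<in> fst ` set ws"
  obtains us y where "distinct (map fst (ws @ us))" "successively (\<lambda>x y. (x, y) \<in> I) (ws @ us @ [y])"
    "fst y \<in> fst ` set (ws @ us)"
proof -
  have "\<exists>us y. distinct (map fst (ws @ us)) \<and> successively (\<lambda>x y. (x, y) \<in> I) (ws @ us @ [y]) \<and>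
          fst y \<in> fst ` set (ws @ us)"
    if "x = last ws" "(x, z) \<in> I\<^sup>+" "distinct (map fst ws)" "ws \<noteq> []"
      "successively (\<lambda>x y. (x, y) \<in> I) ws" "fst z \<in> fst ` set ws" for x ws
    using that(2,1,3-)
  proof (induction arbitrary: ws rule: converse_trancl_induct)
    case (base y)
    thus ?case
      by (intro exI[of _ "[]"] exI[of _ z]) (auto simp: successively_append_iff)
  next
    case (step x y)
    show ?case
    proof (cases "fst y \<in> fst ` set ws")
      case True
      thus ?thesis using step.prems step.hyps
        by (intro exI[of _ "[]"] exI[of _ y]) (auto simp: successively_append_iff)
    next
      case False
      have "\<exists>us y'. distinct (map fst ((ws @ [y]) @ us)) \<and>
          successively (\<lambda>x y. (x, y) \<in> I) ((ws @ [y]) @ us @ [y']) \<and> fst y' \<in> fst ` set ((ws @ [y]) @ us)"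
        using False step.prems step.hyps by (intro step.IH) (auto simp: successively_append_iff)
      then obtain us y' where "distinct (map fst ((ws @ [y]) @ us))"
          "successively (\<lambda>x y. (x, y) \<in> I) ((ws @ [y]) @ us @ [y'])" "fst y' \<in> fst ` set ((ws @ [y]) @ us)"
        by blast
      thus ?thesis by (intro exI[of _ "y # us"] exI[of _ y']) simp
    qed
  qed
  from this[OF refl assms] show ?thesis using that by blast
qed

text \<open>Among all contradictory cycles take one with the shortest path from a literal \<open>z\<close> to its
  negation; minimality makes the variables on this path distinct.  Then follow a path back to
  \<open>z\<close> until the first repeated variable.\<close>

lemma unsat_imp_literal_bicycle:
  assumes M: "M \<in> matchings R" and "finite R" and unsat: "\<nexists>\<tau>. satisfies s \<tau> M"
  obtains z ws y where "ws \<noteq> []" "distinct (map fst ws)"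
    "successively (\<lambda>x y. (x, y) \<in> implications s M) (z # ws @ [y])"
    "neg_lit z \<in> set ws" "fst y \<in> fst ` set ws"
proof -
  let ?I = "implications s M"
  \<comment> \<open>Only the length of the way from \<open>z\<close> to its negation is minimised;
    the way back may be arbitrarily long.\<close>
  define P where "P n z \<longleftrightarrow> (z, neg_lit z) \<in> ?I ^^ n \<and> (neg_lit z, z) \<in> ?I\<^sup>*" for n z
  have "\<exists>n z. P n z"
    using unsat_imp_contradictory_cycle[OF assms] by (metis P_def rtrancl_imp_relpow)
  then obtain m where "\<exists>z. P m z" and least: "\<And>n z. n < m \<Longrightarrow> \<not> P n z"
    using exists_least_iff[of "\<lambda>n. \<exists>z. P n z"] by blast
  then obtain z where z: "P m z" by blast
  then obtain f where f: "f 0 = z" "f m = neg_lit z" "\<And>i. i < m \<Longrightarrow> (f i, f (Suc i)) \<in> ?I"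
    unfolding P_def relpow_fun_conv by blast
  have ret: "(neg_lit z, z) \<in> ?I\<^sup>*" using z by (simp add: P_def)
  have m: "m > 0" using f by (cases m) auto
  have sub: "(f i, f j) \<in> ?I ^^ (j - i)" if "i \<le> j" "j \<le> m" for i j
    unfolding relpow_fun_conv using that f(3) by (intro exI[of _ "\<lambda>k. f (i + k)"]) auto
  have dist: "fst (f i) \<noteq> fst (f j)" if ij: "1 \<le> i" "i < j" "j \<le> m" for i j
  proof
    assume "fst (f i) = fst (f j)"
    \<comment> \<open>A repeated literal could be cut out of the path. If \<open>f j\<close> is the
      negation of \<open>f i\<close>, then \<open>f i\<close> has a shorter path to its negation,
      and the return leads through \<open>neg_lit z\<close> and \<open>z\<close>.\<close>
    then consider "f i = f j" | "f j = neg_lit (f i)"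
      using eq_or_neg_lit by metis
    thus False
    proof cases
      case 1
      have "(z, f i) \<in> ?I ^^ i" using sub[of 0 i] ij f(1) by simp
      moreover have "(f i, neg_lit z) \<in> ?I ^^ (m - j)" using sub[of j m] ij f(2) 1 by simp
      ultimately have "(z, neg_lit z) \<in> ?I ^^ (i + (m - j))"
        unfolding relpow_add by (rule relcompI)
      moreover have "i + (m - j) < m" using ij by linarith
      ultimately show False using least ret unfolding P_def by blast
    next
      case 2
      have "(f i, neg_lit (f i)) \<in> ?I ^^ (j - i)" using sub[of i j] ij 2 by simp
      moreover have "(f j, f i) \<in> ?I\<^sup>*"
      proof -
        have "(f j, neg_lit z) \<in> ?I\<^sup>*" using sub[of j m] ij f(2)
          by (auto intro: relpow_imp_rtrancl)
        moreover have "(z, f i) \<in> ?I\<^sup>*" using sub[of 0 i] ij f(1)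
          by (auto intro: relpow_imp_rtrancl)
        ultimately show ?thesis using ret by (blast intro: rtrancl_trans)
      qed
      moreover have "j - i < m" using ij by linarith
      ultimately show False using least 2 unfolding P_def by metis
    qed
  qed
  \<comment> \<open>The start \<open>f 0 = z\<close> is left out because it shares its variable with
    the last literal \<open>f m\<close>.\<close>
  define ws where "ws = map f [1..<Suc m]"
  have ws: "ws \<noteq> []" "last ws = neg_lit z"
    using m f(2) by (auto simp: ws_def last_map)
  have "distinct (map fst ws)"
    unfolding ws_def map_map distinct_map
  proof (intro conjI inj_onI)
    fix i j assume "i \<in> set [1..<Suc m]" "j \<in> set [1..<Suc m]" "(fst \<circ> f) i = (fst \<circ> f) j"
    thus "i = j" using dist[of i j] dist[of j i] by (cases i j rule: linorder_cases) auto
  qed simp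
  moreover have suc: "successively (\<lambda>x y. (x, y) \<in> ?I) (z # ws)"
  proof -
    have "z # ws = map f [0..<Suc m]"
      using f(1) by (simp add: ws_def upt_conv_Cons del: upt_Suc)
    thus ?thesis
      using f(3) by (auto simp: successively_conv_nth simp del: upt_Suc)
  qed
  moreover have "(last ws, z) \<in> ?I\<^sup>+"
    using ret ws(2) by (metis neg_lit_neq(1) rtranclD)
  moreover have "fst z \<in> fst ` set ws"
    using ws(1,2) by (metis fst_neg_lit imageI last_in_set)
  ultimately obtain us y where us: "distinct (map fst (ws @ us))"
    "successively (\<lambda>x y. (x, y) \<in> ?I) (ws @ us @ [y])" "fst y \<in> fst ` set (ws @ us)"
    using ws(1) by (elim path_extension[of ws z ?I]) (auto simp: successively_Cons)
  have "successively (\<lambda>x y. (x, y) \<in> ?I) (z # (ws @ us) @ [y])"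
    using us(2) suc ws(1) by (cases ws) (auto simp: successively_Cons)
  thus ?thesis
    using us ws by (intro that[of "ws @ us" z y]) (auto intro: last_in_set simp flip: ws(2))
qed

text \<open>The ways to pass through a variable: enter at one clone and leave at an opposite one.
  The pairs are ordered, so a variable with \<open>p\<close> positive and \<open>q\<close> negative
  clones contributes \<open>2 * p * q\<close>.\<close>

definition opposite_pairs :: "('v \<times> 'i \<Rightarrow> bool) \<Rightarrow> ('v \<times> 'i) set \<Rightarrow> (('v \<times> 'i) \<times> ('v \<times> 'i)) set" where
  "opposite_pairs s R = {(c, c'). c \<in> R \<and> c' \<in> R \<and> fst c = fst c' \<and> s c \<noteq> s c'}"

text \<open>Lifts the path of literals to clones. The delicate point is that its implications come
  from different blocks, so that all clones are distinct; the bound for prescribed blocks requires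
  this.\<close>

lemma unsat_imp_bicycle:
  assumes M: "M \<in> matchings R" and "finite R" and unsat: "\<nexists>\<tau>. satisfies s \<tau> M"
  obtains c0 ps c' where "ps \<noteq> []" "set ps \<subseteq> opposite_pairs s R" "c0 \<in> R" "c' \<in> R"
    "fst c0 \<in> (fst \<circ> fst) ` set ps" "fst c' \<in> (fst \<circ> fst) ` set ps"
    "distinct ((c0 # map snd ps) @ (map fst ps @ [c']))"
    "\<forall>(a, b)\<in>set (zip (c0 # map snd ps) (map fst ps @ [c'])). {a, b} \<in> M"
proof -
  obtain z ws y where ws: "ws \<noteq> []" "distinct (map fst ws)"
    "successively (\<lambda>x y. (x, y) \<in> implications s M) (z # ws @ [y])"
    "neg_lit z \<in> set ws" "fst y \<in> fst ` set ws"
    using unsat_imp_literal_bicycle[OF assms] by metis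
  define k where "k = length ws"
  define zs where "zs = z # ws @ [y]"
  have k: "k > 0" using ws(1) by (simp add: k_def)
  have zs: "zs ! 0 = z" "\<And>i. i < k \<Longrightarrow> zs ! Suc i = ws ! i" "zs ! Suc k = y"
    by (auto simp: zs_def k_def nth_append)
  have "\<forall>i\<in>{..k}. \<exists>c c'. {c, c'} \<in> M \<and> c \<noteq> c' \<and> clone_lit s c = neg_lit (zs ! i) \<and> clone_lit s c' = zs ! Suc i"
  proof
    fix i assume "i \<in> {..k}"
    hence "(zs ! i, zs ! Suc i) \<in> implications s M"
      using ws(3) unfolding zs_def[symmetric] successively_conv_nth by (auto simp: zs_def k_def)
    thus "\<exists>c c'. {c, c'} \<in> M \<and> c \<noteq> c' \<and> clone_lit s c = neg_lit (zs ! i) \<and> clone_lit s c' = zs ! Suc i"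
      by (elim implicationsE) blast
  qed
  then obtain e f where ef: "\<And>i. i \<le> k \<Longrightarrow> {e i, f i} \<in> M" "\<And>i. i \<le> k \<Longrightarrow> e i \<noteq> f i"
    "\<And>i. i \<le> k \<Longrightarrow> clone_lit s (e i) = neg_lit (zs ! i)"
    "\<And>i. i \<le> k \<Longrightarrow> clone_lit s (f i) = zs ! Suc i"
    unfolding bchoice_iff by (metis atMost_iff)
  have UM: "\<Union>M = R" using M by (auto simp: k_partitions_def partition_on_def)
  have efR: "e i \<in> R" "f i \<in> R" if "i \<le> k" for i
    using ef(1)[OF that] UM by auto
  have inj: "i = j" if "i < k" "j < k" "fst (ws ! i) = fst (ws ! j)" for i j
    using ws(2) that nth_eq_iff_index_eq[of "map fst ws" i j] by (simp add: k_def)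
  have edges_neq: "{e i, f i} \<noteq> {e j, f j}" if ij: "i < j" "j \<le> k" for i j
  proof
    assume "{e i, f i} = {e j, f j}"
    \<comment> \<open>If two implications use one block in the same direction, equal heads
      contradict distinct variables, unless \<open>j = k\<close>, where the head \<open>y\<close>
      may be a repetition; then the tails are compared, and \<open>i = 0\<close> is excluded by
      \<open>neg_lit z \<in> set ws\<close>. In opposite directions the head of one would be the
      negation of the tail of the other, so a literal of \<open>ws\<close> would be its own
      negation.\<close>
    then consider "e i = e j" "f i = f j" | "e i = f j" "f i = e j"
      by (auto simp: doubleton_eq_iff)
    thus False
    proof cases
      case 1
      show False
      proof (cases "j = k")
        case False
        hence "ws ! i = ws ! j"
          using 1 ef(4)[of i] ef(4)[of j] zs(2) ij by simp
        thus False using inj[of i j] ij False by simp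
      next
        case True
        have "neg_lit (zs ! i) = neg_lit (zs ! k)"
          using 1 ef(3)[of i] ef(3)[of j] ij True by simp
        hence eq: "zs ! i = ws ! (k - 1)"
          using zs(2)[of "k - 1"] k by (metis Suc_diff_1 diff_less neg_lit_neg_lit zero_less_one)
        show False
        proof (cases i)
          case 0
          obtain n where n: "n < k" "ws ! n = neg_lit z"
            using ws(4) by (auto simp: in_set_conv_nth k_def)
          have "n = k - 1"
            using inj[of n "k - 1"] n eq 0 zs(1) k by (metis diff_less fst_neg_lit zero_less_one)
          thus False using n eq 0 zs(1) by simp
        next
          case (Suc i')
          thus False using inj[of i' "k - 1"] eq zs(2)[of i'] ij True by simp
        qed
      qed
    next
      case 2
      have "ws ! i = neg_lit (ws ! (j - 1))"
        using 2 ef(4)[of i] ef(3)[of j] zs(2)[of i] zs(2)[of "j - 1"] ij by simp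
      moreover from this have "i = j - 1" using inj[of i "j - 1"] ij by simp
      ultimately show False by (metis neg_lit_neq(2))
    qed
  qed
  have same: "i = j" if "i \<le> k" "j \<le> k" "x \<in> {e i, f i}" "x \<in> {e j, f j}" for i j x
    using block_unique[OF M ef(1)[OF that(1)] ef(1)[OF that(2)] that(3,4)]
      edges_neq[of i j] edges_neq[of j i] that(1,2) by (cases i j rule: linorder_cases) auto
  \<comment> \<open>The clones at which the path enters and leaves the variable of
    \<open>ws ! i\<close>.\<close>
  define ps where "ps = map (\<lambda>i. (f i, e (Suc i))) [0..<k]"
  have l1: "e 0 # map snd ps = map e [0..<Suc k]"
    unfolding upt_conv_Cons[OF zero_less_Suc] by (simp add: ps_def map_Suc_upt[symmetric] del: upt_Suc)
  have l2: "map fst ps @ [f k] = map f [0..<Suc k]"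
    by (simp add: ps_def o_def)
  have psfst: "(fst \<circ> fst) ` set ps = fst ` set ws"
  proof -
    have "(fst \<circ> fst) ` set ps = (\<lambda>i. fst (f i)) ` {..<k}"
      by (auto simp: ps_def image_image)
    also have "\<dots> = (\<lambda>i. fst (ws ! i)) ` {..<k}"
    proof (rule image_cong)
      fix i assume "i \<in> {..<k}"
      thus "fst (f i) = fst (ws ! i)" using arg_cong[OF ef(4)[of i], of fst] zs(2)[of i] by simp
    qed simp
    also have "\<dots> = fst ` set ws"
      by (force simp: k_def in_set_conv_nth)
    finally show ?thesis .
  qed
  show ?thesis
  proof (rule that[of ps "e 0" "f k"])
    show "ps \<noteq> []" using k by (simp add: ps_def)
    show "set ps \<subseteq> opposite_pairs s R"
    proof
      fix p assume "p \<in> set ps"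
      then obtain i where i: "i < k" "p = (f i, e (Suc i))" by (auto simp: ps_def)
      have "clone_lit s (e (Suc i)) = neg_lit (clone_lit s (f i))"
        using ef(3)[of "Suc i"] ef(4)[of i] i by simp
      thus "p \<in> opposite_pairs s R"
        using i efR[of i] efR[of "Suc i"] by (auto simp: opposite_pairs_def clone_lit_def neg_lit_def)
    qed
    show "e 0 \<in> R" "f k \<in> R" using efR by auto
    have "fst (e 0) = fst (neg_lit z)" using arg_cong[OF ef(3)[of 0], of fst] zs(1) by simp
    thus "fst (e 0) \<in> (fst \<circ> fst) ` set ps" unfolding psfst using ws(4) by blast
    have "fst (f k) = fst y" using arg_cong[OF ef(4)[of k], of fst] zs(3) by simp
    thus "fst (f k) \<in> (fst \<circ> fst) ` set ps" unfolding psfst using ws(5) by simp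
    show "distinct ((e 0 # map snd ps) @ (map fst ps @ [f k]))"
      unfolding l1 l2 distinct_append distinct_map
    proof (intro conjI inj_onI)
      fix i j assume ij: "i \<in> set [0..<Suc k]" "j \<in> set [0..<Suc k]"
      show "i = j" if "e i = e j" using same[of i j "e i"] ij that by auto
      show "i = j" if "f i = f j" using same[of i j "f i"] ij that by auto
    next
      show "set (map e [0..<Suc k]) \<inter> set (map f [0..<Suc k]) = {}"
      proof -
        have "e i \<noteq> f j" if "i \<le> k" "j \<le> k" for i j
          using same[of i j "e i"] ef(2)[of i] that by auto
        hence "e ` {..k} \<inter> f ` {..k} = {}" by blast
        thus ?thesis by (simp add: atLeast0LessThan lessThan_Suc_atMost del: upt_Suc)
      qed
    qed auto
    show "\<forall>(a, b)\<in>set (zip (e 0 # map snd ps) (map fst ps @ [f k])). {a, b} \<in> M"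
      unfolding l1 l2 using ef(1) by (auto simp: set_zip simp del: upt_Suc)
  qed
qed


section \<open>Satisfiability below the threshold\<close>

text \<open>For \<open>ps = [(a\<^sub>1, b\<^sub>1), \<dots>, (a\<^sub>k, b\<^sub>k)]\<close> the clauses of the bicycle are
  \<open>{c0, a\<^sub>1}, {b\<^sub>1, a\<^sub>2}, \<dots>, {b\<^sub>k, c'}\<close>, where \<open>a\<^sub>i\<close> and \<open>b\<^sub>i\<close> are clones of one variable with
  opposite signs: the truth of \<open>a\<^sub>i\<close> makes \<open>b\<^sub>i\<close> false, which forces \<open>a\<^sub>i\<^sub>+\<^sub>1\<close>.\<close>

definition bicycles ::
    "('v \<times> 'i \<Rightarrow> bool) \<Rightarrow> ('v \<times> 'i) set \<Rightarrow> nat \<Rightarrow>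
     ((('v \<times> 'i) \<times> ('v \<times> 'i)) list \<times> ('v \<times> 'i) \<times> ('v \<times> 'i)) set" where
  "bicycles s R k = {(ps, c0, c'). length ps = k \<and> set ps \<subseteq> opposite_pairs s R \<and> c0 \<in> R \<and> c' \<in> R \<and>
     fst c0 \<in> (fst \<circ> fst) ` set ps \<and> fst c' \<in> (fst \<circ> fst) ` set ps \<and>
     distinct ((c0 # map snd ps) @ (map fst ps @ [c']))}"

text \<open>Prefixes of bicycles that are too long to be counted as a whole. Their ends are free, so
  only the \<open>k - 1\<close> inner clauses are prescribed.\<close>

definition long_paths ::
    "('v \<times> 'i \<Rightarrow> bool) \<Rightarrow> ('v \<times> 'i) set \<Rightarrow> nat \<Rightarrow> (('v \<times> 'i) \<times> ('v \<times> 'i)) list set" where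
  "long_paths s R k =
     {ps. length ps = k \<and> set ps \<subseteq> opposite_pairs s R \<and> distinct (map snd ps @ map fst ps)}"

lemma finite_opposite_pairs [simp]: "finite R \<Longrightarrow> finite (opposite_pairs s R)"
  by (rule finite_subset[of _ "R \<times> R"]) (auto simp: opposite_pairs_def)

lemma finite_lists_opposite_pairs:
  "finite R \<Longrightarrow> finite {ps. set ps \<subseteq> opposite_pairs s R \<and> length ps = k}"
  by (simp add: finite_lists_length_eq)

lemma card_lists_opposite_pairs:
  "finite R \<Longrightarrow> card {ps. set ps \<subseteq> opposite_pairs s R \<and> length ps = k} = card (opposite_pairs s R) ^ k"
  by (simp add: card_lists_length_eq)

text \<open>The count drops distinctness: the pairs are arbitrary, and each end clone is one of the
  at most \<open>k * \<Delta>\<close> clones of variables on the path.\<close>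

lemma
  assumes "finite R" and \<Delta>: "\<And>v. card {c \<in> R. fst c = v} \<le> \<Delta>"
  shows finite_bicycles: "finite (bicycles s R k)"
    and card_bicycles_le: "card (bicycles s R k) \<le> card (opposite_pairs s R) ^ k * (k * \<Delta>)\<^sup>2"
proof -
  define N where "N ps = {c \<in> R. fst c \<in> (fst \<circ> fst) ` set ps}" for ps :: "(('a \<times> 'b) \<times> ('a \<times> 'b)) list"
  define L where "L = {ps. set ps \<subseteq> opposite_pairs s R \<and> length ps = k}"
  have sub: "bicycles s R k \<subseteq> (SIGMA ps:L. N ps \<times> N ps)"
    by (auto simp: bicycles_def L_def N_def)
  have finL: "finite L" unfolding L_def by (rule finite_lists_opposite_pairs) fact
  have finN: "finite (N ps)" for ps using assms(1) by (simp add: N_def)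
  have fin: "finite (SIGMA ps:L. N ps \<times> N ps)"
    using finL finN by (intro finite_SigmaI) auto
  show "finite (bicycles s R k)" using sub fin finite_subset by blast
  have cardN: "card (N ps) \<le> k * \<Delta>" if "ps \<in> L" for ps
  proof -
    have "N ps = (\<Union>v\<in>(fst \<circ> fst) ` set ps. {c \<in> R. fst c = v})"
      by (auto simp: N_def)
    also have "card \<dots> \<le> (\<Sum>v\<in>(fst \<circ> fst) ` set ps. card {c \<in> R. fst c = v})"
      by (intro card_UN_le) simp
    also have "\<dots> \<le> (\<Sum>v\<in>(fst \<circ> fst) ` set ps. \<Delta>)"
      using \<Delta> by (intro sum_mono) auto
    also have "\<dots> = card ((fst \<circ> fst) ` set ps) * \<Delta>" by simp
    also have "card ((fst \<circ> fst) ` set ps) \<le> k"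
      using card_image_le[of "set ps" "fst \<circ> fst"] card_length[of ps] that by (simp add: L_def)
    finally show ?thesis by simp
  qed
  have "card (bicycles s R k) \<le> card (SIGMA ps:L. N ps \<times> N ps)"
    using sub fin by (rule card_mono[rotated])
  also have "\<dots> = (\<Sum>ps\<in>L. (card (N ps))\<^sup>2)"
    using finL finN by (subst card_SigmaI) (auto simp: card_cartesian_product power2_eq_square)
  also have "\<dots> \<le> (\<Sum>ps\<in>L. (k * \<Delta>)\<^sup>2)"
    using cardN by (intro sum_mono power_mono) auto
  also have "\<dots> = card (opposite_pairs s R) ^ k * (k * \<Delta>)\<^sup>2"
    using card_lists_opposite_pairs[OF assms(1), of s k] by (simp add: L_def)
  finally show "card (bicycles s R k) \<le> card (opposite_pairs s R) ^ k * (k * \<Delta>)\<^sup>2" .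
qed

lemma opposite_pairs_subset:
  assumes "set ps \<subseteq> opposite_pairs s R"
  shows "fst ` set ps \<subseteq> R" "snd ` set ps \<subseteq> R"
  using assms by (auto simp: opposite_pairs_def)

text \<open>First moment method, cut off at length \<open>L\<close> so that the bound
  \<open>r\<close> for a single clause stays close to \<open>1 / card R\<close>. A bicycle through
  \<open>k\<close> variables has \<open>k + 1\<close> clauses, and the extra factor \<open>r\<close>
  must beat the \<Delta>-dependent choice of its ends. A long path has one clause fewer than
  variables, which is harmless once \<open>(Q * r) ^ L\<close> is tiny.\<close>

lemma matching_prob_unsat_le:
  fixes R :: "('v \<times> 'i) set" and s :: "'v \<times> 'i \<Rightarrow> bool"
  assumes R: "finite R" "even (card R)" and L: "L \<ge> 1" "2 * (L + 1) < card R"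
    and \<Delta>: "\<And>v. card {c \<in> R. fst c = v} \<le> \<Delta>"
  defines "Q \<equiv> real (card (opposite_pairs s R))" and "r \<equiv> 1 / real (card R - 2 * (L + 1))"
  shows "matching_prob R (\<lambda>M. \<nexists>\<tau>. satisfies s \<tau> M) \<le>
           (\<Sum>k = 1..L. Q ^ k * (real k * real \<Delta>)\<^sup>2 * r ^ (k + 1)) + Q ^ L * r ^ (L - 1)"
proof -
  define E where "E = (\<lambda>(ps, c0, c') M.
    \<forall>(a, b)\<in>set (zip (c0 # map snd ps) (map fst ps @ [c'])). {a, b} \<in> (M :: ('v \<times> 'i) set set))"
  define F where "F = (\<lambda>ps M.
    \<forall>(a, b)\<in>set (zip (map snd (butlast ps)) (map fst (tl ps))). {a, b} \<in> (M :: ('v \<times> 'i) set set))"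
  have r0: "r \<ge> 0" by (simp add: r_def)
  have "matching_prob R (\<lambda>M. \<nexists>\<tau>. satisfies s \<tau> M) \<le>
      matching_prob R (\<lambda>M. (\<exists>k\<in>{1..L}. \<exists>x\<in>bicycles s R k. E x M) \<or> (\<exists>ps\<in>long_paths s R L. F ps M))"
  proof (rule matching_prob_mono[OF R(1)])
    fix M assume M: "M \<in> matchings R" "\<nexists>\<tau>. satisfies s \<tau> M"
    obtain c0 ps c' where b: "ps \<noteq> []" "set ps \<subseteq> opposite_pairs s R" "c0 \<in> R" "c' \<in> R"
      "fst c0 \<in> (fst \<circ> fst) ` set ps" "fst c' \<in> (fst \<circ> fst) ` set ps"
      "distinct ((c0 # map snd ps) @ (map fst ps @ [c']))"
      "\<forall>(a, b)\<in>set (zip (c0 # map snd ps) (map fst ps @ [c'])). {a, b} \<in> M"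
      using unsat_imp_bicycle[OF M(1) R(1) M(2)] by metis
    show "(\<exists>k\<in>{1..L}. \<exists>x\<in>bicycles s R k. E x M) \<or> (\<exists>ps\<in>long_paths s R L. F ps M)"
    proof (cases "length ps \<le> L")
      case True
      have "(ps, c0, c') \<in> bicycles s R (length ps)"
        using b by (auto simp: bicycles_def)
      moreover have "E (ps, c0, c') M" using b(8) by (simp add: E_def)
      moreover have "length ps \<in> {1..L}" using True b(1) by (cases ps) auto
      ultimately show ?thesis by blast
    next
      case False
      define qs where "qs = take L ps"
      have len: "length qs = L" using False by (simp add: qs_def)
      have sub: "set qs \<subseteq> set ps" by (simp add: qs_def set_take_subset)
      have "distinct (map snd ps @ map fst ps)" using b(7) by auto
      hence "distinct (map snd qs)" "distinct (map fst qs)" "set (map snd ps) \<inter> set (map fst ps) = {}"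
        by (auto simp: qs_def take_map[symmetric])
      hence "distinct (map snd qs @ map fst qs)"
        using sub by auto
      hence "qs \<in> long_paths s R L"
        using len sub b(2) by (auto simp: long_paths_def)
      moreover have "F qs M"
        unfolding F_def
      proof clarify
        fix x1 x2 y1 y2
        assume "((x1, x2), (y1, y2)) \<in> set (zip (map snd (butlast qs)) (map fst (tl qs)))"
        then obtain i where i: "i < L - 1" "(x1, x2) = snd (qs ! i)" "(y1, y2) = fst (qs ! Suc i)"
          using len by (auto simp: in_set_zip nth_butlast nth_tl)
        have "(snd (ps ! i), fst (ps ! Suc i)) \<in> set (zip (c0 # map snd ps) (map fst ps @ [c']))"
          unfolding in_set_zip using i False by (intro exI[of _ "Suc i"]) (auto simp: nth_append)
        hence "{snd (ps ! i), fst (ps ! Suc i)} \<in> M" using b(8) by blast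
        thus "{(x1, x2), (y1, y2)} \<in> M" using i by (simp add: qs_def)
      qed
      ultimately show ?thesis by blast
    qed
  qed
  also have "\<dots> \<le> matching_prob R (\<lambda>M. \<exists>k\<in>{1..L}. \<exists>x\<in>bicycles s R k. E x M) +
      matching_prob R (\<lambda>M. \<exists>ps\<in>long_paths s R L. F ps M)"
    by (rule matching_prob_disj[OF R(1)])
  also have "matching_prob R (\<lambda>M. \<exists>k\<in>{1..L}. \<exists>x\<in>bicycles s R k. E x M) \<le>
      (\<Sum>k = 1..L. Q ^ k * (real k * real \<Delta>)\<^sup>2 * r ^ (k + 1))"
  proof -
    have "matching_prob R (\<lambda>M. \<exists>k\<in>{1..L}. \<exists>x\<in>bicycles s R k. E x M) \<le>
        (\<Sum>k = 1..L. matching_prob R (\<lambda>M. \<exists>x\<in>bicycles s R k. E x M))"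
      by (rule matching_prob_Bex[OF R(1)]) simp
    also have "\<dots> \<le> (\<Sum>k = 1..L. \<Sum>x\<in>bicycles s R k. matching_prob R (E x))"
      using finite_bicycles[OF R(1) \<Delta>] by (intro sum_mono matching_prob_Bex[OF R(1)]) auto
    also have "\<dots> \<le> (\<Sum>k = 1..L. \<Sum>x\<in>bicycles s R k. r ^ (k + 1))"
    proof (intro sum_mono)
      fix k x assume k: "k \<in> {1..L}" and x: "x \<in> bicycles s R k"
      obtain ps c0 c' where x_eq: "x = (ps, c0, c')" by (cases x) auto
      define es where "es = zip (c0 # map snd ps) (map fst ps @ [c'])"
      have mfst: "map fst es = c0 # map snd ps" and msnd: "map snd es = map fst ps @ [c']"
        by (simp_all add: es_def)
      have "matching_prob R (\<lambda>M. \<forall>(a, b)\<in>set es. {a, b} \<in> M) \<le> (1 / real (card R - 2 * (L + 1))) ^ length es"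
      proof (rule matching_prob_edges_le)
        show "set (map fst es @ map snd es) \<subseteq> R"
          unfolding mfst msnd using x opposite_pairs_subset[of ps s R] by (auto simp: x_eq bicycles_def)
        show "distinct (map fst es @ map snd es)"
          unfolding mfst msnd using x by (auto simp: x_eq bicycles_def)
      qed (use R L k x in \<open>auto simp: es_def x_eq bicycles_def\<close>)
      moreover have "length es = k + 1" using x by (simp add: es_def x_eq bicycles_def)
      ultimately show "matching_prob R (E x) \<le> r ^ (k + 1)"
        by (simp add: E_def x_eq es_def r_def)
    qed
    also have "\<dots> = (\<Sum>k = 1..L. real (card (bicycles s R k)) * r ^ (k + 1))" by simp
    also have "\<dots> \<le> (\<Sum>k = 1..L. Q ^ k * (real k * real \<Delta>)\<^sup>2 * r ^ (k + 1))"
    proof (intro sum_mono mult_right_mono)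
      fix k
      have "real (card (bicycles s R k)) \<le> real (card (opposite_pairs s R) ^ k * (k * \<Delta>)\<^sup>2)"
        using card_bicycles_le[OF R(1) \<Delta>] of_nat_le_iff by blast
      thus "real (card (bicycles s R k)) \<le> Q ^ k * (real k * real \<Delta>)\<^sup>2"
        by (simp add: Q_def)
    qed (use r0 in simp)
    finally show ?thesis .
  qed
  also have "matching_prob R (\<lambda>M. \<exists>ps\<in>long_paths s R L. F ps M) \<le> Q ^ L * r ^ (L - 1)"
  proof -
    have sub: "long_paths s R L \<subseteq> {ps. set ps \<subseteq> opposite_pairs s R \<and> length ps = L}"
      by (auto simp: long_paths_def)
    have fin: "finite (long_paths s R L)"
      using sub finite_lists_opposite_pairs[OF R(1)] finite_subset by blast
    have "matching_prob R (\<lambda>M. \<exists>ps\<in>long_paths s R L. F ps M) \<le>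
        (\<Sum>ps\<in>long_paths s R L. matching_prob R (F ps))"
      by (rule matching_prob_Bex[OF R(1) fin])
    also have "\<dots> \<le> (\<Sum>ps\<in>long_paths s R L. r ^ (L - 1))"
    proof (rule sum_mono)
      fix ps assume ps: "ps \<in> long_paths s R L"
      define es where "es = zip (map snd (butlast ps)) (map fst (tl ps))"
      have mfst: "map fst es = map snd (butlast ps)" and msnd: "map snd es = map fst (tl ps)"
        by (simp_all add: es_def)
      have sub: "set (butlast ps) \<subseteq> set ps" "set (tl ps) \<subseteq> set ps"
        by (auto dest: in_set_butlastD) (cases ps; simp)
      have img: "snd ` set (butlast ps) \<subseteq> snd ` set ps" "fst ` set (tl ps) \<subseteq> fst ` set ps"
        using sub by blast+
      have "matching_prob R (\<lambda>M. \<forall>(a, b)\<in>set es. {a, b} \<in> M) \<le> (1 / real (card R - 2 * (L + 1))) ^ length es"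
      proof (rule matching_prob_edges_le)
        show "set (map fst es @ map snd es) \<subseteq> R"
        proof -
          have "set ps \<subseteq> opposite_pairs s R" using ps by (simp add: long_paths_def)
          note o = opposite_pairs_subset[OF this]
          show ?thesis
            unfolding mfst msnd set_append set_map Un_subset_iff
            using order_trans[OF img(1) o(2)] order_trans[OF img(2) o(1)] by (rule conjI)
        qed
        have "distinct (butlast (map snd ps))" "distinct (tl (map fst ps))"
          using ps by (auto simp: long_paths_def distinct_butlast distinct_tl)
        moreover have "snd ` set ps \<inter> fst ` set ps = {}"
          using ps by (simp add: long_paths_def)
        hence "snd ` set (butlast ps) \<inter> fst ` set (tl ps) = {}"
          using Int_mono[OF img] by (simp only: subset_empty)
        ultimately show "distinct (map fst es @ map snd es)"
          unfolding mfst msnd distinct_append set_map by (simp add: map_butlast map_tl)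
      qed (use R L ps in \<open>auto simp: es_def long_paths_def\<close>)
      moreover have "length es = L - 1" using ps by (simp add: es_def long_paths_def)
      ultimately show "matching_prob R (F ps) \<le> r ^ (L - 1)"
        by (simp add: F_def es_def r_def)
    qed
    also have "\<dots> = real (card (long_paths s R L)) * r ^ (L - 1)" by simp
    also have "card (long_paths s R L) \<le> card (opposite_pairs s R) ^ L"
      using card_mono[OF finite_lists_opposite_pairs[OF R(1)] sub]
      by (simp add: card_lists_opposite_pairs[OF R(1)])
    hence "real (card (long_paths s R L)) \<le> Q ^ L"
      unfolding Q_def by (metis of_nat_le_iff of_nat_power)
    finally show ?thesis using r0 by (simp add: mult_right_mono)
  qed
  finally show ?thesis by simp
qed

text \<open>Each variable on a bicycle contributes a factor \<open>Q * r \<le> \<rho> < 1\<close>,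
  and the two ends contribute \<open>\<Delta>^2 * r\<close>, which is of order \<eta>; the factor
  \<open>k^2\<close> is absorbed by the geometric series.\<close>

lemma matching_prob_unsat_subcritical:
  fixes \<delta> \<epsilon> :: real
  assumes \<delta>: "0 < \<delta>" "\<delta> < 1" and \<epsilon>: "\<epsilon> > 0"
  obtains \<eta> :: real and N0 :: nat where "\<eta> > 0"
    "\<And>(s :: 'v \<times> 'i \<Rightarrow> bool) R \<Delta>. finite R \<Longrightarrow> even (card R) \<Longrightarrow> N0 \<le> card R \<Longrightarrow>
       real (card (opposite_pairs s R)) \<le> (1 - \<delta>) * real (card R) \<Longrightarrow>
       (\<And>v. card {c \<in> R. fst c = v} \<le> \<Delta>) \<Longrightarrow> (real \<Delta>)\<^sup>2 \<le> \<eta> * real (card R) \<Longrightarrow>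
       matching_prob R (\<lambda>M. \<nexists>\<tau>. satisfies s \<tau> M) \<le> \<epsilon>"
proof -
  \<comment> \<open>The denominator allows for \<open>card R - 2 * (L + 1)\<close> being smaller
    than \<open>card R\<close>; half of \<delta> is reserved for this.\<close>
  define \<rho> where "\<rho> = (1 - \<delta>) / (1 - \<delta> / 2)"
  have \<rho>: "0 < \<rho>" "\<rho> < 1" using \<delta> by (auto simp: \<rho>_def field_simps)
  have summable: "summable (\<lambda>k. (real k)\<^sup>2 * \<rho> ^ k)"
  proof (rule summable_comparison_test_ev)
    have "eventually (\<lambda>k. norm ((real k)\<^sup>2 * \<rho> ^ k) \<le> (sqrt \<rho>) ^ k) sequentially"
    proof -
      have "eventually (\<lambda>k. (real k)\<^sup>2 * \<rho> powr real k \<le> \<rho> powr (real k / 2)) sequentially"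
        using \<rho> by real_asymp
      thus ?thesis
      proof eventually_elim
        case (elim k)
        have "\<rho> powr (real k / 2) = (\<rho> powr (1/2)) powr real k" by (simp add: powr_powr)
        also have "\<dots> = sqrt \<rho> ^ k" using \<rho> by (simp add: powr_half_sqrt powr_realpow)
        finally show ?case using elim \<rho> by (simp add: powr_realpow)
      qed
    qed
    thus "\<forall>\<^sub>F k in sequentially. norm ((real k)\<^sup>2 * \<rho> ^ k) \<le> (sqrt \<rho>) ^ k" .
    show "summable (\<lambda>k. sqrt \<rho> ^ k)" using \<rho> by (intro summable_geometric) auto
  qed
  define C where "C = (\<Sum>k. (real k)\<^sup>2 * \<rho> ^ k)"
  have C0: "C \<ge> 0" unfolding C_def using \<rho> by (intro suminf_nonneg summable) auto
  \<comment> \<open>The bicycles contribute at most \<open>2 * \<eta> * C\<close>, which becomes at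
    most \<open>\<epsilon> / 2\<close>.\<close>
  define \<eta> where "\<eta> = \<epsilon> / (4 * (C + 1))"
  have \<eta>: "\<eta> > 0" using \<epsilon> C0 by (simp add: \<eta>_def)
  have "((\<lambda>N. real N * \<rho> powr (sqrt (real N) - 1)) \<longlongrightarrow> 0) sequentially"
    using \<rho> by real_asymp
  hence "eventually (\<lambda>N. real N * \<rho> powr (sqrt (real N) - 1) < \<epsilon> / 2) sequentially"
    using \<epsilon> by (intro order_tendstoD(2)[of _ 0]) auto
  moreover have "eventually (\<lambda>N. 2 * (sqrt (real N) + 1) \<le> \<delta> / 2 * real N) sequentially"
    using \<delta> by real_asymp
  ultimately have "eventually (\<lambda>N. 0 < N \<and> real N * \<rho> powr (sqrt (real N) - 1) < \<epsilon> / 2 \<and>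
       2 * (sqrt (real N) + 1) \<le> \<delta> / 2 * real N) sequentially"
    using eventually_gt_at_top[of 0] by eventually_elim auto
  then obtain N0 where N0: "\<And>N. N \<ge> N0 \<Longrightarrow> 0 < N \<and> real N * \<rho> powr (sqrt (real N) - 1) < \<epsilon> / 2 \<and>
       2 * (sqrt (real N) + 1) \<le> \<delta> / 2 * real N"
    by (auto simp: eventually_sequentially)
  show ?thesis
  proof (rule that[OF \<eta>, of N0])
    fix s :: "'v \<times> 'i \<Rightarrow> bool" and R \<Delta>
    assume R: "finite R" "even (card R)" "N0 \<le> card R"
      and Q: "real (card (opposite_pairs s R)) \<le> (1 - \<delta>) * real (card R)"
      and \<Delta>: "\<And>v. card {c \<in> R. fst c = v} \<le> \<Delta>" and \<Delta>\<eta>: "(real \<Delta>)\<^sup>2 \<le> \<eta> * real (card R)"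
    define N where "N = card R"
    have N: "0 < N" "real N * \<rho> powr (sqrt (real N) - 1) < \<epsilon> / 2"
       "2 * (sqrt (real N) + 1) \<le> \<delta> / 2 * real N"
      using N0[of N] R(3) by (auto simp: N_def)
    \<comment> \<open>The square root is one choice that grows faster than the logarithm of
      \<open>N\<close>, so that \<open>N * \<rho> ^ L\<close> vanishes, and slower than
      \<open>N\<close>, so that \<open>r\<close> is hardly affected.\<close>
    define L where "L = nat \<lfloor>sqrt (real N)\<rfloor>"
    have sq1: "sqrt (real N) \<ge> 1" using N(1) by simp
    have L1: "L \<ge> 1" using sq1 by (simp add: L_def le_nat_iff)
    have Lr: "real L \<le> sqrt (real N)" "sqrt (real N) - 1 \<le> real L"
      using sq1 by (auto simp: L_def)
    define q where "q = real (card (opposite_pairs s R))"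
    define r where "r = 1 / real (N - 2 * (L + 1))"
    have "real (2 * (L + 1)) \<le> \<delta> / 2 * real N" using Lr N(3) by simp
    moreover have "\<delta> / 2 * real N < real N" using \<delta> N(1) by simp
    ultimately have lt: "2 * (L + 1) < N" and ge: "(1 - \<delta> / 2) * real N \<le> real (N - 2 * (L + 1))"
      by (simp_all add: of_nat_diff algebra_simps)
    have d0: "(1 - \<delta> / 2) * real N > 0" using \<delta> N(1) by simp
    have r0: "r > 0" using lt by (simp add: r_def)
    have rle: "r \<le> 1 / ((1 - \<delta> / 2) * real N)"
      unfolding r_def using ge d0 by (intro divide_left_mono) auto
    have q0: "q \<ge> 0" by (simp add: q_def)
    have "q * r \<le> ((1 - \<delta>) * real N) * (1 / ((1 - \<delta> / 2) * real N))"
      using Q rle q0 r0 \<delta> by (intro mult_mono) (auto simp: q_def N_def)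
    also have "\<dots> = \<rho>" using N(1) by (simp add: \<rho>_def)
    finally have qr: "q * r \<le> \<rho>" .
    have qr0: "q * r \<ge> 0" using q0 r0 by simp
    have "matching_prob R (\<lambda>M. \<nexists>\<tau>. satisfies s \<tau> M) \<le>
           (\<Sum>k = 1..L. q ^ k * (real k * real \<Delta>)\<^sup>2 * r ^ (k + 1)) + q ^ L * r ^ (L - 1)"
      unfolding q_def r_def N_def
      by (rule matching_prob_unsat_le) (use R L1 lt \<Delta> in \<open>auto simp: N_def\<close>)
    also have "(\<Sum>k = 1..L. q ^ k * (real k * real \<Delta>)\<^sup>2 * r ^ (k + 1)) \<le>
        (\<Sum>k = 1..L. 2 * \<eta> * ((real k)\<^sup>2 * \<rho> ^ k))"
    proof (rule sum_mono)
      fix k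
      have "(real \<Delta>)\<^sup>2 * r \<le> (\<eta> * real N) * (1 / ((1 - \<delta> / 2) * real N))"
        using \<Delta>\<eta> rle r0 \<eta> by (intro mult_mono) (auto simp: N_def)
      also have "\<dots> = \<eta> * (1 / (1 - \<delta> / 2))" using N(1) by simp
      also have "\<dots> \<le> \<eta> * 2" using \<delta> \<eta> by (intro mult_left_mono) (auto simp: field_simps)
      finally have 1: "(real \<Delta>)\<^sup>2 * r \<le> 2 * \<eta>" by simp
      have "q ^ k * (real k * real \<Delta>)\<^sup>2 * r ^ (k + 1) = ((real \<Delta>)\<^sup>2 * r) * ((real k)\<^sup>2 * (q * r) ^ k)"
        by (simp add: power_mult_distrib algebra_simps)
      also have "\<dots> \<le> (2 * \<eta>) * ((real k)\<^sup>2 * \<rho> ^ k)"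
        using qr qr0 \<eta> by (intro mult_mono[OF 1] mult_left_mono power_mono) auto
      finally show "q ^ k * (real k * real \<Delta>)\<^sup>2 * r ^ (k + 1) \<le> 2 * \<eta> * ((real k)\<^sup>2 * \<rho> ^ k)" .
    qed
    also have "\<dots> = 2 * \<eta> * (\<Sum>k = 1..L. (real k)\<^sup>2 * \<rho> ^ k)"
      by (simp add: sum_distrib_left)
    also have "(\<Sum>k = 1..L. (real k)\<^sup>2 * \<rho> ^ k) \<le> C"
      unfolding C_def using \<rho> by (intro sum_le_suminf summable) auto
    also have "2 * \<eta> * C \<le> \<epsilon> / 2"
      using C0 \<epsilon> by (simp add: \<eta>_def field_simps)
    also have "q ^ L * r ^ (L - 1) = (q * r) ^ L * (1 / r)"
      using L1 r0 by (cases L) (auto simp: power_mult_distrib)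
    also have "\<dots> \<le> \<rho> ^ L * real N"
      using qr qr0 \<rho> r0 by (intro mult_mono power_mono) (auto simp: r_def)
    also have "\<rho> ^ L \<le> \<rho> powr (sqrt (real N) - 1)"
      using \<rho> Lr(2) by (subst powr_realpow[symmetric]) (auto intro!: powr_mono')
    finally show "matching_prob R (\<lambda>M. \<nexists>\<tau>. satisfies s \<tau> M) \<le> \<epsilon>"
      using N(1,2) \<eta> by (simp add: mult.commute)
  qed
qed


section \<open>Sampling the degrees and the signs first\<close>

abbreviation (input) Pr :: "'a pmf \<Rightarrow> 'a set \<Rightarrow> real" where
  "Pr p \<equiv> measure_pmf.prob p"

abbreviation (input) Exp :: "'a pmf \<Rightarrow> ('a \<Rightarrow> real) \<Rightarrow> real" where
  "Exp p \<equiv> measure_pmf.expectation p"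

definition coin_flips :: "'a set \<Rightarrow> ('a \<Rightarrow> bool) pmf" where
  "coin_flips A = Pi_pmf A False (\<lambda>_. bernoulli_pmf (1/2))"

text \<open>Bundling a degree with the signs of its clones makes the data of different variables
  independent and identically distributed.\<close>

definition signed_degree :: "nat pmf \<Rightarrow> (nat \<times> (nat \<Rightarrow> bool)) pmf" where
  "signed_degree \<xi> = bind_pmf \<xi> (\<lambda>d. map_pmf (Pair d) (coin_flips {..<d}))"

definition signed_degrees :: "nat \<Rightarrow> nat pmf \<Rightarrow> (nat \<Rightarrow> nat \<times> (nat \<Rightarrow> bool)) pmf" where
  "signed_degrees n \<xi> = Pi_pmf {..<n} (0, \<lambda>_. False) (\<lambda>_. signed_degree \<xi>)"

definition clone_sign :: "(nat \<Rightarrow> nat \<times> (nat \<Rightarrow> bool)) \<Rightarrow> nat \<times> nat \<Rightarrow> bool" where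
  "clone_sign f c = snd (f (fst c)) (snd c)"

lemma finite_clones [simp]: "finite (clones n d)"
  by (simp add: clones_def)

lemma card_clones: "card (clones n d) = (\<Sum>i<n. d i)"
  by (simp add: clones_def)

lemma coin_flips_clones:
  "coin_flips (clones n d) = map_pmf case_prod (Pi_pmf {..<n} (\<lambda>_. False) (\<lambda>i. coin_flips {..<d i}))"
proof (rule pmf_eqI)
  fix g :: "nat \<times> nat \<Rightarrow> bool"
  let ?P = "Pi_pmf {..<n} (\<lambda>_. False) (\<lambda>i. coin_flips {..<d i})"
  have inj: "inj (case_prod :: (nat \<Rightarrow> nat \<Rightarrow> bool) \<Rightarrow> _)"
    by (metis curry_case_prod injI)
  have "pmf (map_pmf case_prod ?P) g = pmf (map_pmf case_prod ?P) (case_prod (curry g))"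
    by simp
  also have "\<dots> = pmf ?P (curry g)"
    by (rule pmf_map_inj') (rule inj)
  also have "\<dots> = pmf (coin_flips (clones n d)) g"
  proof (cases "\<forall>c. c \<notin> clones n d \<longrightarrow> g c = False")
    case True
    have 1: "\<forall>i. i \<notin> {..<n} \<longrightarrow> curry g i = (\<lambda>_. False)"
      using True by (auto simp: clones_def curry_def)
    have 2: "\<forall>j. j \<notin> {..<d i} \<longrightarrow> curry g i j = False" if "i < n" for i
      using True that by (auto simp: clones_def curry_def)
    have "pmf ?P (curry g) = (\<Prod>i<n. pmf (coin_flips {..<d i}) (curry g i))"
      using 1 by (subst pmf_Pi') auto
    also have "\<dots> = (\<Prod>i<n. \<Prod>j<d i. pmf (bernoulli_pmf (1/2)) (g (i, j)))"
    proof (rule prod.cong)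
      fix i assume "i \<in> {..<n}"
      thus "pmf (coin_flips {..<d i}) (curry g i) = (\<Prod>j<d i. pmf (bernoulli_pmf (1/2)) (g (i, j)))"
        unfolding coin_flips_def using 2[of i] by (subst pmf_Pi') (auto simp: curry_def)
    qed simp
    also have "\<dots> = (\<Prod>c\<in>clones n d. pmf (bernoulli_pmf (1/2)) (g c))"
      unfolding clones_def by (subst prod.Sigma) auto
    also have "\<dots> = pmf (coin_flips (clones n d)) g"
      unfolding coin_flips_def using True by (subst pmf_Pi') auto
    finally show ?thesis .
  next
    case False
    then obtain i j where ij: "(i, j) \<notin> clones n d" "g (i, j)" by auto
    have "pmf (coin_flips (clones n d)) g = 0"
      unfolding coin_flips_def using False by (intro pmf_Pi_outside) auto
    moreover have "pmf ?P (curry g) = 0"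
    proof (cases "i < n")
      case True
      hence "pmf (coin_flips {..<d i}) (curry g i) = 0"
        unfolding coin_flips_def using ij by (intro pmf_Pi_outside) (auto simp: clones_def curry_def)
      thus ?thesis using True by (subst pmf_Pi) auto
    next
      case False
      have "curry g i \<noteq> (\<lambda>_. False)" using ij(2) by (auto simp: curry_def fun_eq_iff)
      thus ?thesis using False by (intro pmf_Pi_outside) auto
    qed
    ultimately show ?thesis by simp
  qed
  finally show "pmf (coin_flips (clones n d)) g = pmf (map_pmf case_prod ?P) g" by simp
qed

text \<open>Drawing all degrees and then all signs is the same as drawing degree and signs variable
  by variable.\<close>

lemma degrees_and_signs_eq:
  "bind_pmf (iid_degrees n \<xi>) (\<lambda>d. map_pmf (Pair d) (coin_flips (clones n d))) =
   map_pmf (\<lambda>f. (fst \<circ> f, clone_sign f)) (signed_degrees n \<xi>)"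
proof -
  have "signed_degrees n \<xi> =
      bind_pmf (iid_degrees n \<xi>) (\<lambda>d. Pi_pmf {..<n} (0, \<lambda>_. False) (\<lambda>i. map_pmf (Pair (d i)) (coin_flips {..<d i})))"
    unfolding signed_degrees_def signed_degree_def iid_degrees_def
    by (subst Pi_pmf_bind[where d' = 0]) auto
  also have "\<dots> = bind_pmf (iid_degrees n \<xi>)
      (\<lambda>d. map_pmf (\<lambda>g i. (d i, g i)) (Pi_pmf {..<n} (\<lambda>_. False) (\<lambda>i. coin_flips {..<d i})))"
  proof (rule bind_pmf_cong[OF refl])
    fix d assume "d \<in> set_pmf (iid_degrees n \<xi>)"
    hence d: "d i = 0" if "i \<ge> n" for i
      using that by (auto simp: iid_degrees_def set_Pi_pmf PiE_dflt_def)
    have "Pi_pmf {..<n} (0, \<lambda>_. False) (\<lambda>i. map_pmf (Pair (d i)) (coin_flips {..<d i})) =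
       bind_pmf (Pi_pmf {..<n} (\<lambda>_. False) (\<lambda>i. coin_flips {..<d i}))
         (\<lambda>g. return_pmf (\<lambda>i. if i \<in> {..<n} then (d i, g i) else (0, \<lambda>_. False)))"
      unfolding map_pmf_def by (subst Pi_pmf_bind[where d' = "\<lambda>_. False"]) auto
    also have "\<dots> = bind_pmf (Pi_pmf {..<n} (\<lambda>_. False) (\<lambda>i. coin_flips {..<d i}))
         (\<lambda>g. return_pmf (\<lambda>i. (d i, g i)))"
    proof (rule bind_pmf_cong[OF refl])
      fix g assume "g \<in> set_pmf (Pi_pmf {..<n} (\<lambda>_. False) (\<lambda>i. coin_flips {..<d i}))"
      hence "g i = (\<lambda>_. False)" if "i \<ge> n" for i
        using that set_Pi_pmf_subset[of "{..<n}"] by fastforce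
      thus "return_pmf (\<lambda>i. if i \<in> {..<n} then (d i, g i) else (0, \<lambda>_. False)) =
          return_pmf (\<lambda>i. (d i, g i))"
        using d by (auto simp: fun_eq_iff)
    qed
    finally show "Pi_pmf {..<n} (0, \<lambda>_. False) (\<lambda>i. map_pmf (Pair (d i)) (coin_flips {..<d i})) =
       map_pmf (\<lambda>g i. (d i, g i)) (Pi_pmf {..<n} (\<lambda>_. False) (\<lambda>i. coin_flips {..<d i}))"
      by (simp add: map_pmf_def)
  qed
  finally show ?thesis
    by (simp add: coin_flips_clones map_bind_pmf pmf.map_comp o_def clone_sign_def[abs_def] case_prod_unfold)
qed

lemma nn_integral_cond_pmf_le:
  assumes "Pr p E > 0"
  shows "(\<integral>\<^sup>+x. g x \<partial>cond_pmf p E) \<le> (\<integral>\<^sup>+x. g x * indicator E x \<partial>p) / ennreal (Pr p E)"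
proof -
  have ne: "set_pmf p \<inter> E \<noteq> {}"
    using assms by (metis measure_pmf_zero_iff less_irrefl)
  have "(\<integral>\<^sup>+x. g x \<partial>cond_pmf p E) = (\<integral>\<^sup>+x. ennreal (pmf (cond_pmf p E) x) * g x \<partial>count_space UNIV)"
    by (rule nn_integral_measure_pmf)
  also have "\<dots> = (\<integral>\<^sup>+x. ennreal (pmf p x) * (g x * indicator E x) / ennreal (Pr p E) \<partial>count_space UNIV)"
    using assms by (intro nn_integral_cong)
      (auto simp: pmf_cond[OF ne] divide_ennreal[symmetric] ennreal_times_divide mult_ac indicator_def ennreal_divide_times)
  also have "\<dots> = (\<integral>\<^sup>+x. ennreal (pmf p x) * (g x * indicator E x) \<partial>count_space UNIV) / ennreal (Pr p E)"
    by (rule nn_integral_divide) simp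
  also have "\<dots> = (\<integral>\<^sup>+x. g x * indicator E x \<partial>p) / ennreal (Pr p E)"
    by (simp add: nn_integral_measure_pmf[of p])
  finally show ?thesis by simp
qed

text \<open>Conditioning on an even degree sum destroys independence. Bounding the conditional law
  by the unconditional one divided by the probability of the event restores it; on the exceptional
  set \<open>B\<close> the matching probability is simply bounded by 1.\<close>

lemma config_model_prob_le:
  fixes X :: "nat cnf set"
  assumes adm: "admissible 2 n \<xi>" and \<epsilon>: "\<epsilon> \<ge> 0"
    and bound: "\<And>f. f \<in> set_pmf (signed_degrees n \<xi>) \<Longrightarrow> f \<notin> B \<Longrightarrow> even (\<Sum>i<n. fst (f i)) \<Longrightarrow>
      matching_prob (clones n (fst \<circ> f)) (\<lambda>M. cnf_of M (clone_sign f) \<in> X) \<le> \<epsilon>"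
  shows "Pr (config_model 2 n \<xi>) X \<le>
     (\<epsilon> + Pr (signed_degrees n \<xi>) B) /
       Pr (iid_degrees n \<xi>) (divisible_degrees 2 n)"
proof -
  let ?E = "divisible_degrees 2 n"
  let ?c = "Pr (iid_degrees n \<xi>) ?E"
  have c: "?c > 0" using adm by (simp add: admissible_def)
  have ne: "set_pmf (iid_degrees n \<xi>) \<inter> ?E \<noteq> {}"
    using c by (metis measure_pmf_zero_iff less_irrefl)
  define \<phi> where "\<phi> d s = matching_prob (clones n d) (\<lambda>M. cnf_of M s \<in> X)" for d s
  have inner: "emeasure (measure_pmf (pmf_of_set (matchings (clones n d)))) {M. cnf_of M s \<in> X} = ennreal (\<phi> d s)"
    if "d \<in> ?E" for d s
  proof -
    have "matchings (clones n d) \<noteq> {}"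
      using that by (intro k_partitions_nonempty) (auto simp: card_clones divisible_degrees_def)
    hence "Pr (pmf_of_set (matchings (clones n d))) {M. cnf_of M s \<in> X} = \<phi> d s"
      unfolding \<phi>_def matching_prob_def
      by (subst measure_pmf_of_set) (auto simp: k_partitions_finite Int_def)
    thus ?thesis by (simp add: measure_pmf.emeasure_eq_measure)
  qed
  \<comment> \<open>Given the degrees, signs and matching are independent, so the signs may be drawn
    first.\<close>
  have "config_model 2 n \<xi> = bind_pmf (cond_pmf (iid_degrees n \<xi>) ?E) (\<lambda>d.
      bind_pmf (coin_flips (clones n d)) (\<lambda>s.
      map_pmf (\<lambda>P. cnf_of P s) (pmf_of_set (matchings (clones n d)))))"
    unfolding config_model_def coin_flips_def map_pmf_def
    by (intro bind_pmf_cong refl) (rule bind_commute_pmf)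
  hence "emeasure (config_model 2 n \<xi>) X = (\<integral>\<^sup>+d. \<integral>\<^sup>+s. emeasure
      (measure_pmf (pmf_of_set (matchings (clones n d)))) {M. cnf_of M s \<in> X}
      \<partial>coin_flips (clones n d) \<partial>cond_pmf (iid_degrees n \<xi>) ?E)"
    by (simp add: vimage_def)
  also have "\<dots> = (\<integral>\<^sup>+d. \<integral>\<^sup>+s. ennreal (\<phi> d s) \<partial>coin_flips (clones n d) \<partial>cond_pmf (iid_degrees n \<xi>) ?E)"
    by (intro nn_integral_cong_AE AE_pmfI) (simp add: inner set_cond_pmf[OF ne])
  also have "\<dots> \<le> (\<integral>\<^sup>+d. (\<integral>\<^sup>+s. ennreal (\<phi> d s) \<partial>coin_flips (clones n d)) * indicator ?E d \<partial>iid_degrees n \<xi>) / ennreal ?c"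
    by (rule nn_integral_cond_pmf_le) (rule c)
  also have "(\<integral>\<^sup>+d. (\<integral>\<^sup>+s. ennreal (\<phi> d s) \<partial>coin_flips (clones n d)) * indicator ?E d \<partial>iid_degrees n \<xi>) =
      (\<integral>\<^sup>+x. ennreal (\<phi> (fst x) (snd x)) * indicator ?E (fst x)
         \<partial>bind_pmf (iid_degrees n \<xi>) (\<lambda>d. map_pmf (Pair d) (coin_flips (clones n d))))"
    by (simp add: nn_integral_multc)
  also have "\<dots> = (\<integral>\<^sup>+f. ennreal (\<phi> (fst \<circ> f) (clone_sign f)) * indicator ?E (fst \<circ> f) \<partial>signed_degrees n \<xi>)"
    by (subst degrees_and_signs_eq) simp
  also have "\<dots> \<le> (\<integral>\<^sup>+f. ennreal \<epsilon> + indicator B f \<partial>signed_degrees n \<xi>)"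
  proof (intro nn_integral_mono_AE AE_pmfI)
    fix f assume f: "f \<in> set_pmf (signed_degrees n \<xi>)"
    show "ennreal (\<phi> (fst \<circ> f) (clone_sign f)) * indicator ?E (fst \<circ> f) \<le> ennreal \<epsilon> + indicator B f"
    proof (cases "fst \<circ> f \<in> ?E")
      case True
      show ?thesis
      proof (cases "f \<in> B")
        case True
        have "\<phi> (fst \<circ> f) (clone_sign f) \<le> 1" by (simp add: \<phi>_def matching_prob_le_1)
        hence "ennreal (\<phi> (fst \<circ> f) (clone_sign f)) \<le> 1" by (simp add: ennreal_le_1)
        also have "\<dots> \<le> ennreal \<epsilon> + indicator B f" using True by simp
        finally show ?thesis using \<open>fst \<circ> f \<in> ?E\<close> by simp
      next
        case False
        thus ?thesis using bound[OF f False] \<open>fst \<circ> f \<in> ?E\<close>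
          by (simp add: \<phi>_def divisible_degrees_def ennreal_leI)
      qed
    qed simp
  qed
  also have "\<dots> = ennreal (\<epsilon> + Pr (signed_degrees n \<xi>) B)"
    using \<epsilon> by (simp add: nn_integral_add measure_pmf.emeasure_eq_measure ennreal_plus)
  also have "\<dots> / ennreal ?c = ennreal ((\<epsilon> + Pr (signed_degrees n \<xi>) B) / ?c)"
    using c \<epsilon> by (intro divide_ennreal) auto
  finally have "ennreal (Pr (config_model 2 n \<xi>) X) \<le> ennreal ((\<epsilon> + Pr (signed_degrees n \<xi>) B) / ?c)"
    by (simp add: measure_pmf.emeasure_eq_measure divide_right_mono_ennreal)
  thus ?thesis using \<epsilon> c by (subst (asm) ennreal_le_iff) auto
qed


section \<open>Parity of the degree sum\<close>

text \<open>Both sides are the expectation of \<open>(-1)^S\<close> for the degree sum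
  \<open>S\<close>, which factorises over the variables.\<close>

lemma prob_even_degree_sum:
  "2 * Pr (iid_degrees n \<xi>) (divisible_degrees 2 n) - 1 =
     (1 - 2 * Pr \<xi> {x. odd x}) ^ n"
proof (induction n)
  case 0
  show ?case by (simp add: iid_degrees_def divisible_degrees_def)
next
  case (Suc n)
  define e where "e = Pr (iid_degrees n \<xi>) (divisible_degrees 2 n)"
  define p where "p = Pr \<xi> {x. odd x}"
  have e: "0 \<le> e" "e \<le> 1" and p: "0 \<le> p" "p \<le> 1" by (auto simp: e_def p_def)
  have "iid_degrees (Suc n) \<xi> = bind_pmf \<xi> (\<lambda>y. map_pmf (\<lambda>f. f(n := y)) (iid_degrees n \<xi>))"
    unfolding iid_degrees_def lessThan_Suc map_pmf_def by (subst Pi_pmf_insert') auto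
  hence "emeasure (iid_degrees (Suc n) \<xi>) (divisible_degrees 2 (Suc n)) =
     (\<integral>\<^sup>+y. emeasure (iid_degrees n \<xi>) {f. f(n := y) \<in> divisible_degrees 2 (Suc n)} \<partial>\<xi>)"
    by (simp add: vimage_def)
  also have "\<dots> = (\<integral>\<^sup>+y. ennreal (1 - e) * indicator {x. odd x} y + ennreal e * indicator {x. even x} y \<partial>\<xi>)"
  proof (rule nn_integral_cong)
    fix y :: nat
    have eq: "{f. f(n := y) \<in> divisible_degrees 2 (Suc n)} =
        (if even y then divisible_degrees 2 n else - divisible_degrees 2 n)"
      by (auto simp: divisible_degrees_def)
    have "Pr (iid_degrees n \<xi>) (- divisible_degrees 2 n) = 1 - e"
      unfolding e_def using measure_pmf.prob_compl[of "divisible_degrees 2 n" "iid_degrees n \<xi>"]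
      by (simp add: Compl_eq_Diff_UNIV)
    thus "emeasure (iid_degrees n \<xi>) {f. f(n := y) \<in> divisible_degrees 2 (Suc n)} =
        ennreal (1 - e) * indicator {x. odd x} y + ennreal e * indicator {x. even x} y"
      unfolding eq by (simp add: measure_pmf.emeasure_eq_measure e_def)
  qed
  also have "\<dots> = ennreal (1 - e) * emeasure \<xi> {x. odd x} + ennreal e * emeasure \<xi> {x. even x}"
    by (simp add: nn_integral_add nn_integral_cmult)
  also have "Pr \<xi> {x. even x} = 1 - p"
    unfolding p_def using measure_pmf.prob_compl[of "{x. odd x}" \<xi>]
    by (simp add: Compl_eq_Diff_UNIV[symmetric] Collect_neg_eq[symmetric])
  hence "ennreal (1 - e) * emeasure \<xi> {x. odd x} + ennreal e * emeasure \<xi> {x. even x} =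
      ennreal ((1 - e) * p + e * (1 - p))"
    using e p by (simp add: measure_pmf.emeasure_eq_measure p_def[symmetric] ennreal_mult ennreal_plus)
  finally have "ennreal (Pr (iid_degrees (Suc n) \<xi>) (divisible_degrees 2 (Suc n))) =
      ennreal ((1 - e) * p + e * (1 - p))"
    by (simp only: measure_pmf.emeasure_eq_measure)
  moreover have "(1 - e) * p + e * (1 - p) \<ge> 0"
    using e p by (intro add_nonneg_nonneg mult_nonneg_nonneg) auto
  ultimately have E: "Pr (iid_degrees (Suc n) \<xi>) (divisible_degrees 2 (Suc n)) =
      (1 - e) * p + e * (1 - p)"
    by (subst (asm) ennreal_inj) auto
  have IH: "2 * e - 1 = (1 - 2 * p) ^ n"
    using Suc.IH by (simp add: e_def p_def)
  show ?case
    unfolding E power_Suc p_def[symmetric] IH[symmetric] by (simp add: algebra_simps)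
qed

text \<open>For even \<open>n\<close>, or if odd degrees have probability
  \<open>p \<le> 1 / 2\<close>, an even sum has probability at least 1/2. For odd \<open>n\<close>
  and \<open>p > 1 / 2\<close> the worst case is \<open>n = 1\<close>, with value
  \<open>1 - p\<close>; and \<open>p = 1\<close> leaves only even \<open>n\<close>
  admissible.\<close>

lemma prob_even_degree_sum_bounded_below:
  obtains c :: real where "c > 0"
    "\<And>n. admissible 2 n \<xi> \<Longrightarrow> c \<le> Pr (iid_degrees n \<xi>) (divisible_degrees 2 n)"
proof -
  define p where "p = Pr \<xi> {x. odd x}"
  define e where "e n = Pr (iid_degrees n \<xi>) (divisible_degrees 2 n)" for n
  have p: "0 \<le> p" "p \<le> 1" by (auto simp: p_def)
  have en: "2 * e n - 1 = (1 - 2 * p) ^ n" for n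
    using prob_even_degree_sum[of n \<xi>] by (simp add: e_def p_def)
  define c where "c = (if p = 1 then 1 / 2 else min (1 / 2) (1 - p))"
  show ?thesis
  proof (rule that[of c])
    show "c > 0" using p by (auto simp: c_def)
    fix n assume "admissible 2 n \<xi>"
    hence pos: "e n > 0" by (simp add: admissible_def e_def)
    have "c \<le> e n"
    proof (cases "even n \<or> p \<le> 1 / 2")
      case True
      hence "(1 - 2 * p) ^ n \<ge> 0" by (auto simp: zero_le_power_eq)
      hence "e n \<ge> 1 / 2" using en[of n] by simp
      thus ?thesis by (auto simp: c_def)
    next
      case False
      hence n: "odd n" "n \<ge> 1" "p > 1 / 2" by (auto simp: Suc_le_eq intro: gr0I)
      have "(2 * p - 1) ^ n \<le> (2 * p - 1) ^ 1" using n p by (intro power_decreasing) auto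
      moreover have "(1 - 2 * p) ^ n = - ((2 * p - 1) ^ n)"
        using n(1) by (metis minus_diff_eq power_minus_odd)
      ultimately have "e n \<ge> 1 - p" using en[of n] by simp
      moreover have "p \<noteq> 1" using pos en[of n] n(1) by auto
      ultimately show ?thesis by (simp add: c_def)
    qed
    thus "c \<le> Pr (iid_degrees n \<xi>) (divisible_degrees 2 n)" by (simp add: e_def)
  qed
qed

text \<open>The interface between regimes and model: a regime names the bad signed degrees, shows
  that they are unlikely for independent variables, and bounds the matching probability for all
  others.\<close>

definition negligible_exception ::
    "nat pmf \<Rightarrow> nat cnf set \<Rightarrow> real \<Rightarrow> (nat \<Rightarrow> (nat \<Rightarrow> nat \<times> (nat \<Rightarrow> bool)) set) \<Rightarrow> bool" where
  "negligible_exception \<xi> X \<epsilon> B \<longleftrightarrow>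
     (\<lambda>n. Pr (signed_degrees n \<xi>) (B n)) \<longlonglongrightarrow> 0 \<and>
     (\<forall>\<^sub>F n in sequentially. \<forall>f\<in>set_pmf (signed_degrees n \<xi>) - B n. even (\<Sum>i<n. fst (f i)) \<longrightarrow>
        matching_prob (clones n (fst \<circ> f)) (\<lambda>M. cnf_of M (clone_sign f) \<in> X) \<le> \<epsilon>)"

lemma negligible_exceptionI:
  assumes "(\<lambda>n. Pr (signed_degrees n \<xi>) (B n)) \<longlonglongrightarrow> 0"
    and "eventually P sequentially"
    and "\<And>n f. P n \<Longrightarrow> f \<in> set_pmf (signed_degrees n \<xi>) \<Longrightarrow> f \<notin> B n \<Longrightarrow> even (\<Sum>i<n. fst (f i)) \<Longrightarrow>
      matching_prob (clones n (fst \<circ> f)) (\<lambda>M. cnf_of M (clone_sign f) \<in> X) \<le> \<epsilon>"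
  shows "negligible_exception \<xi> X \<epsilon> B"
  unfolding negligible_exception_def using assms(1,3) by (auto intro: eventually_mono[OF assms(2)])

lemma config_model_prob_tendsto_0:
  fixes X :: "nat cnf set"
  assumes "\<And>\<epsilon>. \<epsilon> > 0 \<Longrightarrow> \<exists>B. negligible_exception \<xi> X \<epsilon> B"
  shows "((\<lambda>n. Pr (config_model 2 n \<xi>) X) \<longlongrightarrow> 0) (admissible_sequentially 2 \<xi>)"
proof -
  obtain c where c: "c > 0"
    "\<And>n. admissible 2 n \<xi> \<Longrightarrow> c \<le> Pr (iid_degrees n \<xi>) (divisible_degrees 2 n)"
    using prob_even_degree_sum_bounded_below[of \<xi>] by blast
  show ?thesis
  proof (rule order_tendstoI)
    fix a :: real assume "a < 0"
    thus "\<forall>\<^sub>F n in admissible_sequentially 2 \<xi>. a < Pr (config_model 2 n \<xi>) X"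
      by (intro always_eventually allI) (rule less_le_trans, auto)
  next
    fix a :: real assume a: "0 < a"
    \<comment> \<open>Chosen so that the final bound \<open>2 * \<epsilon> / c\<close> equals
      \<open>a / 2\<close>.\<close>
    define \<epsilon> where "\<epsilon> = a * c / 4"
    have \<epsilon>: "\<epsilon> > 0" using a c by (simp add: \<epsilon>_def)
    obtain B where B: "(\<lambda>n. Pr (signed_degrees n \<xi>) (B n)) \<longlonglongrightarrow> 0"
      "\<forall>\<^sub>F n in sequentially. \<forall>f\<in>set_pmf (signed_degrees n \<xi>) - B n. even (\<Sum>i<n. fst (f i)) \<longrightarrow>
        matching_prob (clones n (fst \<circ> f)) (\<lambda>M. cnf_of M (clone_sign f) \<in> X) \<le> \<epsilon>"
      using assms[OF \<epsilon>] unfolding negligible_exception_def by blast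
    have "\<forall>\<^sub>F n in sequentially. Pr (signed_degrees n \<xi>) (B n) < \<epsilon>"
      using B(1) \<epsilon> by (rule order_tendstoD)
    with B(2) have "\<forall>\<^sub>F n in sequentially. admissible 2 n \<xi> \<longrightarrow> Pr (config_model 2 n \<xi>) X < a"
    proof eventually_elim
      case (elim n)
      show ?case
      proof
        assume adm: "admissible 2 n \<xi>"
        let ?c = "Pr (iid_degrees n \<xi>) (divisible_degrees 2 n)"
        have "Pr (config_model 2 n \<xi>) X \<le>
            (\<epsilon> + Pr (signed_degrees n \<xi>) (B n)) / ?c"
          using adm \<epsilon> elim(1) by (intro config_model_prob_le) auto
        also have "\<dots> \<le> (2 * \<epsilon>) / c"
          using c(1) c(2)[OF adm] elim(2) \<epsilon> by (intro frac_le) auto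
        also have "\<dots> < a" using a c(1) by (simp add: \<epsilon>_def)
        finally show "Pr (config_model 2 n \<xi>) X < a" .
      qed
    qed
    thus "\<forall>\<^sub>F n in admissible_sequentially 2 \<xi>. Pr (config_model 2 n \<xi>) X < a"
      by (simp add: admissible_sequentially_def eventually_inf_principal)
  qed
qed

lemma prob_Un_tendsto_0:
  assumes "((\<lambda>n. Pr (p n) (A n)) \<longlongrightarrow> 0) F" "((\<lambda>n. Pr (p n) (B n)) \<longlongrightarrow> 0) F"
  shows "((\<lambda>n. Pr (p n) (A n \<union> B n)) \<longlongrightarrow> 0) F"
  by (rule tendsto_sandwich[OF _ _ tendsto_const tendsto_add_zero[OF assms]])
     (intro always_eventually allI measure_nonneg measure_Un_le; simp)+

section \<open>Sums of independent identically distributed variables\<close>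

lemma prob_Pi_pmf_Bex_le:
  "Pr (Pi_pmf {..<n} dflt (\<lambda>_. \<zeta>)) {f. \<exists>i<n. f i \<in> H} \<le> real n * Pr \<zeta> H"
proof -
  let ?P = "Pi_pmf {..<n} dflt (\<lambda>_. \<zeta>)"
  have "{f. \<exists>i<n. f i \<in> H} = (\<Union>i<n. {f. f i \<in> H})" by auto
  hence "Pr ?P {f. \<exists>i<n. f i \<in> H} \<le> (\<Sum>i<n. Pr ?P {f. f i \<in> H})"
    using measure_pmf.finite_measure_subadditive_finite[of "{..<n}" "\<lambda>i. {f. f i \<in> H}" ?P] by simp
  also have "\<dots> = (\<Sum>i<n. Pr \<zeta> H)"
  proof (rule sum.cong)
    fix i assume "i \<in> {..<n}"
    hence "\<zeta> = map_pmf (\<lambda>f. f i) ?P" by (subst Pi_pmf_component) auto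
    hence "Pr \<zeta> H = Pr (map_pmf (\<lambda>f. f i) ?P) H" by simp
    thus "Pr ?P {f. f i \<in> H} = Pr \<zeta> H" by (simp add: vimage_def)
  qed simp
  finally show ?thesis by simp
qed

lemma prob_Pi_pmf_none:
  "Pr (Pi_pmf {..<n} dflt (\<lambda>_. \<zeta>)) {f. \<forall>i<n. f i \<notin> G} = (1 - Pr \<zeta> G) ^ n"
proof -
  have "{f. \<forall>i<n. f i \<notin> G} = Pi {..<n} (\<lambda>_. - G)" by (auto simp: Pi_def)
  moreover have "Pr \<zeta> (- G) = 1 - Pr \<zeta> G"
    using measure_pmf.prob_compl[of G \<zeta>] by (simp add: Compl_eq_Diff_UNIV)
  ultimately show ?thesis by (simp add: measure_Pi_pmf_Pi)
qed

lemma
  fixes Z :: "'a \<Rightarrow> real" and \<zeta> :: "'a pmf" and n :: nat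
  assumes "integrable \<zeta> Z" "i < n"
  shows integrable_Pi_pmf_component: "integrable (Pi_pmf {..<n} dflt (\<lambda>_. \<zeta>)) (\<lambda>f. Z (f i))"
    and expectation_Pi_pmf_component:
      "Exp (Pi_pmf {..<n} dflt (\<lambda>_. \<zeta>)) (\<lambda>f. Z (f i)) = Exp \<zeta> Z"
proof -
  let ?P = "Pi_pmf {..<n} dflt (\<lambda>_. \<zeta>)"
  have eq: "map_pmf (\<lambda>f. f i) ?P = \<zeta>" using assms(2) by (subst Pi_pmf_component) auto
  have "integrable (map_pmf (\<lambda>f. f i) ?P) Z" using assms(1) eq by simp
  thus "integrable ?P (\<lambda>f. Z (f i))" by (simp add: integrable_map_pmf_eq)
  have "Exp (map_pmf (\<lambda>f. f i) ?P) Z = Exp \<zeta> Z" using eq by simp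
  thus "Exp ?P (\<lambda>f. Z (f i)) = Exp \<zeta> Z" by simp
qed

lemma prob_Pi_pmf_sum_ge_le:
  fixes Z :: "'a \<Rightarrow> real" and \<zeta> :: "'a pmf"
  assumes "integrable \<zeta> Z" "\<And>x. Z x \<ge> 0" "a > 0"
  shows "Pr (Pi_pmf {..<n} dflt (\<lambda>_. \<zeta>)) {f. (\<Sum>i<n. Z (f i)) \<ge> a} \<le>
           real n * Exp \<zeta> Z / a"
proof -
  let ?P = "Pi_pmf {..<n} dflt (\<lambda>_. \<zeta>)"
  have "Pr ?P {f \<in> space ?P. (\<Sum>i<n. Z (f i)) \<ge> a} \<le>
     Exp ?P (\<lambda>f. \<Sum>i<n. Z (f i)) / a"
    by (rule integral_Markov_inequality_measure[where A = "{}"])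
       (use assms integrable_Pi_pmf_component[OF assms(1)] in \<open>auto intro!: Bochner_Integration.integrable_sum AE_pmfI sum_nonneg\<close>)
  also have "Exp ?P (\<lambda>f. \<Sum>i<n. Z (f i)) = (\<Sum>i<n. Exp ?P (\<lambda>f. Z (f i)))"
    using integrable_Pi_pmf_component[OF assms(1)] by (intro Bochner_Integration.integral_sum) auto
  also have "\<dots> = (\<Sum>i<n. Exp \<zeta> Z)"
    by (intro sum.cong) (auto simp: expectation_Pi_pmf_component[OF assms(1)])
  finally show ?thesis by simp
qed

lemma prob_Pi_pmf_bounded_sum_ge_le:
  fixes Y :: "'a \<Rightarrow> real" and \<zeta> :: "'a pmf"
  assumes "\<And>x. \<bar>Y x\<bar> \<le> K" "K > 0" "n > 0" "t \<ge> 0"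
  shows "Pr (Pi_pmf {..<n} dflt (\<lambda>_. \<zeta>))
           {f. (\<Sum>i<n. Y (f i)) \<ge> real n * Exp \<zeta> Y + t} \<le>
         exp (- 2 * t\<^sup>2 / (real n * (2 * K)\<^sup>2))"
proof -
  let ?P = "Pi_pmf {..<n} dflt (\<lambda>_. \<zeta>)"
  have int: "integrable \<zeta> Y"
    using assms(1) by (intro measure_pmf.integrable_const_bound[where B = K]) auto
  interpret Hoeffding_ineq "measure_pmf ?P" "{..<n}" "\<lambda>i f. Y (f i)" "\<lambda>_. - K" "\<lambda>_. K"
    "\<Sum>i<n. Exp ?P (\<lambda>f. Y (f i))"
  proof unfold_locales
    have "prob_space.indep_vars (measure_pmf ?P) (\<lambda>_. count_space UNIV) (\<lambda>x f. f x) {..<n}"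
      by (rule indep_vars_Pi_pmf) simp
    thus "prob_space.indep_vars (measure_pmf ?P) (\<lambda>_. borel) (\<lambda>i f. Y (f i)) {..<n}"
      by (rule prob_space.indep_vars_compose2[OF measure_pmf.prob_space_axioms]) auto
    show "AE f in measure_pmf ?P. Y (f i) \<in> {- K..K}" for i
      using assms(1) by (intro AE_pmfI) (auto simp: abs_le_iff minus_le_iff)
  qed auto
  have "Pr ?P {f \<in> space ?P. (\<Sum>i<n. Y (f i)) \<ge> (\<Sum>i<n. Exp ?P (\<lambda>f. Y (f i))) + t}
     \<le> exp (- 2 * t\<^sup>2 / (\<Sum>i<n. (K - - K)\<^sup>2))"
    using assms by (intro Hoeffding_ineq_ge) auto
  moreover have "(\<Sum>i<n. Exp ?P (\<lambda>f. Y (f i))) = (\<Sum>i<n. Exp \<zeta> Y)"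
    by (intro sum.cong) (auto simp: expectation_Pi_pmf_component[OF int])
  ultimately show ?thesis by simp
qed

text \<open>One-sided weak law of large numbers under a first moment only. Each threshold condition
  compares two sums, so it becomes the sign of one sum. Truncation splits it into a bounded part,
  for Hoeffding, and a remainder of small mean, for Markov.\<close>

lemma prob_Pi_pmf_sum_nonneg_tendsto_0:
  fixes X :: "'a \<Rightarrow> real" and \<zeta> :: "'a pmf"
  assumes int: "integrable (measure_pmf \<zeta>) X" and neg: "Exp \<zeta> X < 0"
  shows "(\<lambda>n. Pr (Pi_pmf {..<n} dflt (\<lambda>_. \<zeta>)) {f. (\<Sum>i<n. X (f i)) \<ge> 0}) \<longlonglongrightarrow> 0"
proof (rule order_tendstoI)
  fix a :: real assume "a < 0"
  thus "\<forall>\<^sub>F n in sequentially. a < Pr (Pi_pmf {..<n} dflt (\<lambda>_. \<zeta>)) {f. (\<Sum>i<n. X (f i)) \<ge> 0}"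
    by (intro always_eventually allI) (rule less_le_trans, auto)
next
  fix e :: real assume e: "0 < e"
  define m where "m = - Exp \<zeta> X"
  have m: "m > 0" using neg by (simp add: m_def)
  define Z where "Z K x = (if \<bar>X x\<bar> > real K then \<bar>X x\<bar> else 0)" for K x
  define Y where "Y K x = (if \<bar>X x\<bar> > real K then 0 else X x)" for K x
  have intZ: "integrable \<zeta> (Z K)" for K
    by (rule Bochner_Integration.integrable_bound[OF int]) (auto simp: Z_def)
  have intY: "integrable \<zeta> (Y K)" for K
    by (rule Bochner_Integration.integrable_bound[OF int]) (auto simp: Y_def)
  have "(\<lambda>K. Exp \<zeta> (Z K)) \<longlonglongrightarrow> Exp \<zeta> (\<lambda>_. 0)"
  proof (rule integral_dominated_convergence[where w = "\<lambda>x. \<bar>X x\<bar>"])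
    show "AE x in measure_pmf \<zeta>. (\<lambda>K. Z K x) \<longlonglongrightarrow> 0"
    proof (intro AE_pmfI)
      fix x
      obtain K0 where "\<bar>X x\<bar> \<le> real K0" using real_arch_simple by blast
      hence "\<forall>\<^sub>F K in sequentially. Z K x = 0"
        by (intro eventually_sequentiallyI[of K0]) (auto simp: Z_def)
      thus "(\<lambda>K. Z K x) \<longlonglongrightarrow> 0" by (rule tendsto_eventually)
    qed
  qed (use int in \<open>auto simp: Z_def\<close>)
  hence "(\<lambda>K. Exp \<zeta> (Z K)) \<longlonglongrightarrow> 0" by simp
  moreover have "0 < min (m / 4) (e * m / 8)" using m e by simp
  ultimately have "\<forall>\<^sub>F K in sequentially. Exp \<zeta> (Z K) < min (m / 4) (e * m / 8)"
    by (rule order_tendstoD)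
  hence "\<forall>\<^sub>F K in sequentially. K > 0 \<and> Exp \<zeta> (Z K) < min (m / 4) (e * m / 8)"
    using eventually_gt_at_top[of "0 :: nat"] by eventually_elim auto
  then obtain K where K: "K > 0" "Exp \<zeta> (Z K) < min (m / 4) (e * m / 8)"
    by (auto simp: eventually_sequentially)
  have "Exp \<zeta> (Y K) \<le> Exp \<zeta> (\<lambda>x. X x + Z K x)"
    by (intro integral_mono Bochner_Integration.integrable_add int intZ intY) (auto simp: Y_def Z_def)
  also have "\<dots> = - m + Exp \<zeta> (Z K)"
    using int intZ by (simp add: m_def)
  finally have EY: "Exp \<zeta> (Y K) \<le> - (3 / 4) * m" using K(2) by simp
  have "((\<lambda>n. exp (- 2 * (real n * m / 4)\<^sup>2 / (real n * (2 * real K)\<^sup>2))) \<longlongrightarrow> 0) sequentially"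
    using m K(1) by real_asymp
  hence "\<forall>\<^sub>F n in sequentially. exp (- 2 * (real n * m / 4)\<^sup>2 / (real n * (2 * real K)\<^sup>2)) < e / 2"
    using e by (intro order_tendstoD(2)[of _ 0]) auto
  thus "\<forall>\<^sub>F n in sequentially. Pr (Pi_pmf {..<n} dflt (\<lambda>_. \<zeta>)) {f. (\<Sum>i<n. X (f i)) \<ge> 0} < e"
    using eventually_gt_at_top[of "0 :: nat"]
  proof eventually_elim
    case (elim n)
    let ?P = "Pi_pmf {..<n} dflt (\<lambda>_. \<zeta>)"
    \<comment> \<open>The truncated mean is at most \<open>- 3 / 4 * m\<close>, so off both events
      the sum is below \<open>n * m * (- 3 / 4 + 1 / 4 + 1 / 2) = 0\<close>.\<close>
    let ?A = "{f. (\<Sum>i<n. Y K (f i)) \<ge> real n * Exp \<zeta> (Y K) + real n * m / 4}"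
    let ?B = "{f. (\<Sum>i<n. Z K (f i)) \<ge> real n * m / 2}"
    have sub: "{f. (\<Sum>i<n. X (f i)) \<ge> 0} \<subseteq> ?A \<union> ?B"
    proof
      fix f assume "f \<in> {f. (\<Sum>i<n. X (f i)) \<ge> 0}"
      hence "0 \<le> (\<Sum>i<n. X (f i))" by simp
      also have "\<dots> \<le> (\<Sum>i<n. Y K (f i) + Z K (f i))"
        by (intro sum_mono) (auto simp: Y_def Z_def)
      also have "\<dots> = (\<Sum>i<n. Y K (f i)) + (\<Sum>i<n. Z K (f i))" by (simp add: sum.distrib)
      finally have "0 \<le> (\<Sum>i<n. Y K (f i)) + (\<Sum>i<n. Z K (f i))" .
      moreover have "real n * Exp \<zeta> (Y K) \<le> real n * (- (3 / 4) * m)"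
        using EY by (intro mult_left_mono) auto
      ultimately show "f \<in> ?A \<union> ?B" by auto
    qed
    have "Pr ?P {f. (\<Sum>i<n. X (f i)) \<ge> 0} \<le> Pr ?P (?A \<union> ?B)"
      using sub by (intro measure_pmf.finite_measure_mono) auto
    also have "\<dots> \<le> Pr ?P ?A + Pr ?P ?B"
      by (intro measure_Un_le) auto
    also have "Pr ?P ?A \<le> exp (- 2 * (real n * m / 4)\<^sup>2 / (real n * (2 * real K)\<^sup>2))"
      using K(1) elim m by (intro prob_Pi_pmf_bounded_sum_ge_le) (auto simp: Y_def)
    also have "Pr ?P ?B \<le> real n * Exp \<zeta> (Z K) / (real n * m / 2)"
      using elim m by (intro prob_Pi_pmf_sum_ge_le intZ) (auto simp: Z_def)
    also have "\<dots> = Exp \<zeta> (Z K) * 2 / m"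
      using elim by simp
    also have "\<dots> < e / 2" using K(2) m mult_pos_pos[OF e m] by (simp add: field_simps)
    finally show ?case using elim by simp
  qed
qed


section \<open>Signed degrees and power laws\<close>

definition pos_count :: "nat \<times> (nat \<Rightarrow> bool) \<Rightarrow> nat" where
  "pos_count y = card {j \<in> {..<fst y}. \<not> snd y j}"

definition neg_count :: "nat \<times> (nat \<Rightarrow> bool) \<Rightarrow> nat" where
  "neg_count y = card {j \<in> {..<fst y}. snd y j}"

definition opposite_count :: "nat \<times> (nat \<Rightarrow> bool) \<Rightarrow> nat" where
  "opposite_count y = 2 * pos_count y * neg_count y"

lemma pos_count_plus_neg_count: "pos_count y + neg_count y = fst y"
proof -
  have "{..<fst y} = {j \<in> {..<fst y}. \<not> snd y j} \<union> {j \<in> {..<fst y}. snd y j}" by auto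
  hence "card {..<fst y} = card {j \<in> {..<fst y}. \<not> snd y j} + card {j \<in> {..<fst y}. snd y j}"
    by (metis (no_types, lifting) card_Un_disjoint disjoint_iff finite_Un finite_lessThan mem_Collect_eq)
  thus ?thesis by (simp add: pos_count_def neg_count_def)
qed

lemma opposite_count_le: "2 * opposite_count y \<le> (fst y)\<^sup>2"
proof -
  have "4 * (int (pos_count y) * int (neg_count y)) \<le> (int (pos_count y) + int (neg_count y))\<^sup>2"
    using zero_le_power2[of "int (pos_count y) - int (neg_count y)"]
    by (simp add: power2_eq_square algebra_simps)
  hence "int (2 * opposite_count y) \<le> int ((fst y)\<^sup>2)"
    unfolding opposite_count_def pos_count_plus_neg_count[symmetric] by simp
  thus ?thesis by linarith
qed

section \<open>Counting clones by variable and sign\<close>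

lemma card_literal_clones:
  assumes "x < n"
  shows "card {c \<in> clones n (fst \<circ> f). fst c = x \<and> clone_sign f c} = neg_count (f x)"
    and "card {c \<in> clones n (fst \<circ> f). fst c = x \<and> \<not> clone_sign f c} = pos_count (f x)"
    and "card {c \<in> clones n (fst \<circ> f). fst c = x} = fst (f x)"
proof -
  have "{c \<in> clones n (fst \<circ> f). fst c = x \<and> clone_sign f c} = Pair x ` {j \<in> {..<fst (f x)}. snd (f x) j}"
    using assms by (auto simp: clones_def clone_sign_def)
  thus "card {c \<in> clones n (fst \<circ> f). fst c = x \<and> clone_sign f c} = neg_count (f x)"
    by (simp add: card_image inj_on_def neg_count_def)
  have "{c \<in> clones n (fst \<circ> f). fst c = x \<and> \<not> clone_sign f c} = Pair x ` {j \<in> {..<fst (f x)}. \<not> snd (f x) j}"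
    using assms by (auto simp: clones_def clone_sign_def)
  thus "card {c \<in> clones n (fst \<circ> f). fst c = x \<and> \<not> clone_sign f c} = pos_count (f x)"
    by (simp add: card_image inj_on_def pos_count_def)
  have "{c \<in> clones n (fst \<circ> f). fst c = x} = Pair x ` {..<fst (f x)}"
    using assms by (auto simp: clones_def)
  thus "card {c \<in> clones n (fst \<circ> f). fst c = x} = fst (f x)"
    by (simp add: card_image inj_on_def)
qed

text \<open>Each of the \<open>p\<close> positive clones sees \<open>q\<close> opposite ones and
  conversely, which gives \<open>2 * p * q\<close> per variable.\<close>

lemma sum_card_opposite_clones:
  "(\<Sum>b\<in>{b \<in> clones n (fst \<circ> f). fst b \<in> U}. card (opposite_clones (clone_sign f) (clones n (fst \<circ> f)) b)) =
   (\<Sum>i\<in>{..<n} \<inter> U. opposite_count (f i))"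
proof -
  let ?C = "clones n (fst \<circ> f)" and ?s = "clone_sign f"
  have opp: "card (opposite_clones ?s ?C (i, j)) = (if snd (f i) j then pos_count (f i) else neg_count (f i))"
    if "i < n" for i j
  proof -
    have "opposite_clones ?s ?C (i, j) = {c \<in> ?C. fst c = i \<and> ?s c \<noteq> snd (f i) j}"
      by (auto simp: opposite_clones_def clone_sign_def)
    thus ?thesis using card_literal_clones[OF that, of f] by simp
  qed
  have "{b \<in> ?C. fst b \<in> U} = (SIGMA i:{..<n} \<inter> U. {..<fst (f i)})"
    by (auto simp: clones_def)
  hence "(\<Sum>b\<in>{b \<in> ?C. fst b \<in> U}. card (opposite_clones ?s ?C b)) =
      (\<Sum>i\<in>{..<n} \<inter> U. \<Sum>j<fst (f i). card (opposite_clones ?s ?C (i, j)))"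
    by (simp add: sum.Sigma)
  also have "\<dots> = (\<Sum>i\<in>{..<n} \<inter> U. \<Sum>j<fst (f i). if snd (f i) j then pos_count (f i) else neg_count (f i))"
    by (intro sum.cong) (auto simp: opp)
  also have "\<dots> = (\<Sum>i\<in>{..<n} \<inter> U. opposite_count (f i))"
  proof (rule sum.cong)
    fix i
    have "(\<Sum>j<fst (f i). if snd (f i) j then pos_count (f i) else neg_count (f i)) =
        (\<Sum>j\<in>{..<fst (f i)} \<inter> {j. snd (f i) j}. pos_count (f i)) + (\<Sum>j\<in>{..<fst (f i)} \<inter> - {j. snd (f i) j}. neg_count (f i))"
      by (rule sum.If_cases) simp
    also have "{..<fst (f i)} \<inter> {j. snd (f i) j} = {j \<in> {..<fst (f i)}. snd (f i) j}" by auto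
    also have "{..<fst (f i)} \<inter> - {j. snd (f i) j} = {j \<in> {..<fst (f i)}. \<not> snd (f i) j}" by auto
    finally show "(\<Sum>j<fst (f i). if snd (f i) j then pos_count (f i) else neg_count (f i)) = opposite_count (f i)"
      by (simp add: opposite_count_def pos_count_def neg_count_def)
  qed simp
  finally show ?thesis .
qed

lemma card_opposite_pairs:
  "card (opposite_pairs (clone_sign f) (clones n (fst \<circ> f))) = (\<Sum>i<n. opposite_count (f i))"
proof -
  let ?C = "clones n (fst \<circ> f)" and ?s = "clone_sign f"
  have "opposite_pairs ?s ?C = (SIGMA b:?C. opposite_clones ?s ?C b)"
    by (auto simp: opposite_pairs_def opposite_clones_def)
  hence "card (opposite_pairs ?s ?C) = (\<Sum>b\<in>?C. card (opposite_clones ?s ?C b))"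
    by (simp add: opposite_clones_def)
  thus ?thesis using sum_card_opposite_clones[where n = n and f = f and U = UNIV] by simp
qed

text \<open>Finiteness of \<open>M\<close> and of its blocks matters because \<open>mset_set\<close>
  is empty on infinite sets.\<close>

lemma satisfiable_cnf_of_iff:
  assumes "M \<in> matchings R" "finite R"
  shows "satisfiable (cnf_of M s) \<longleftrightarrow> (\<exists>\<tau>. satisfies s \<tau> M)"
proof -
  have "finite B" if "B \<in> M" for B
    using assms(1) that by (auto simp: k_partitions_def intro: card_ge_0_finite)
  moreover have "finite M"
    using assms by (auto simp: k_partitions_def intro: finite_elements)
  moreover have "lit_true \<tau> (clone_literal s c) \<longleftrightarrow> \<tau> (fst c) \<noteq> s c" for \<tau> c
    by (simp add: clone_literal_def)
  ultimately show ?thesis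
    by (simp add: satisfiable_def cnf_of_def satisfies_def)
qed

lemma matching_prob_satisfiable:
  "finite R \<Longrightarrow> matching_prob R (\<lambda>M. cnf_of M s \<in> {\<phi>. satisfiable \<phi>}) = sat_prob s R {}"
  unfolding sat_prob_def
  by (intro antisym matching_prob_mono) (auto simp: satisfiable_cnf_of_iff)

lemma matching_prob_unsatisfiable:
  "finite R \<Longrightarrow> matching_prob R (\<lambda>M. cnf_of M s \<in> - {\<phi>. satisfiable \<phi>}) =
     matching_prob R (\<lambda>M. \<nexists>\<tau>. satisfies s \<tau> M)"
  by (intro antisym matching_prob_mono) (auto simp: satisfiable_cnf_of_iff)

text \<open>Two distinct coins differ with probability 1/2, and there are
  \<open>card A * (card A - 1)\<close> ordered pairs. In the induction a new coin increases
  \<open>2 * p * q\<close> by \<open>2 * p\<close> or \<open>2 * q\<close>, hence by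
  \<open>p + q = card A\<close> on average.\<close>

lemma nn_integral_coin_flips:
  assumes "finite A"
  shows "(\<integral>\<^sup>+t. of_nat (2 * card {j \<in> A. \<not> t j} * card {j \<in> A. t j}) \<partial>coin_flips A) =
           ennreal (real (card A) * (real (card A) - 1) / 2)"
  using assms
proof (induction A rule: finite_induct)
  case empty
  show ?case by simp
next
  case (insert x A)
  let ?p = "\<lambda>t. card {j \<in> A. \<not> t j}" and ?q = "\<lambda>t. card {j \<in> A. t j}"
  have cnt: "?p t + ?q t = card A" for t :: "'a \<Rightarrow> bool"
  proof -
    have "A = {j \<in> A. \<not> t j} \<union> {j \<in> A. t j}" by auto
    hence "card A = card ({j \<in> A. \<not> t j} \<union> {j \<in> A. t j})" by simp
    also have "\<dots> = ?p t + ?q t" using insert.hyps(1) by (intro card_Un_disjoint) auto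
    finally show ?thesis by simp
  qed
  have upd: "card {j \<in> insert x A. (t(x := b)) j} = ?q t + (if b then 1 else 0)"
    "card {j \<in> insert x A. \<not> (t(x := b)) j} = ?p t + (if b then 0 else 1)" for t b
  proof -
    have "{j \<in> insert x A. (t(x := b)) j} = (if b then insert x {j \<in> A. t j} else {j \<in> A. t j})"
      "{j \<in> insert x A. \<not> (t(x := b)) j} = (if b then {j \<in> A. \<not> t j} else insert x {j \<in> A. \<not> t j})"
      using insert.hyps(2) by auto
    thus "card {j \<in> insert x A. (t(x := b)) j} = ?q t + (if b then 1 else 0)"
      "card {j \<in> insert x A. \<not> (t(x := b)) j} = ?p t + (if b then 0 else 1)"
      using insert.hyps by auto
  qed
  have "coin_flips (insert x A) = bind_pmf (coin_flips A) (\<lambda>t. map_pmf (\<lambda>b. t(x := b)) (bernoulli_pmf (1/2)))"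
    unfolding coin_flips_def map_pmf_def
    by (subst Pi_pmf_insert'[OF insert.hyps]) (rule bind_commute_pmf)
  hence "(\<integral>\<^sup>+t. of_nat (2 * card {j \<in> insert x A. \<not> t j} * card {j \<in> insert x A. t j}) \<partial>coin_flips (insert x A)) =
     (\<integral>\<^sup>+t. of_nat (2 * ?p t * (?q t + 1)) * ennreal (1/2) + of_nat (2 * (?p t + 1) * ?q t) * ennreal (1/2) \<partial>coin_flips A)"
  proof -
    assume eq: "coin_flips (insert x A) = bind_pmf (coin_flips A) (\<lambda>t. map_pmf (\<lambda>b. t(x := b)) (bernoulli_pmf (1/2)))"
    define F where "F t b = (of_nat (2 * (?p t + (if b then 0 else 1)) * (?q t + (if b then 1 else 0))) :: ennreal)" for t b
    have "(\<integral>\<^sup>+b. F t b \<partial>bernoulli_pmf (1/2)) = F t True * ennreal (1/2) + F t False * ennreal (1 - 1/2)" for t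
      by (rule nn_integral_bernoulli_pmf) auto
    hence F: "(\<integral>\<^sup>+b. F t b \<partial>bernoulli_pmf (1/2)) =
        of_nat (2 * ?p t * (?q t + 1)) * ennreal (1/2) + of_nat (2 * (?p t + 1) * ?q t) * ennreal (1/2)" for t
      by (simp add: F_def)
    show ?thesis
      unfolding eq nn_integral_bind_pmf nn_integral_map_pmf upd F_def[symmetric] F ..
  qed
  also have "\<dots> = (\<integral>\<^sup>+t. of_nat (2 * ?p t * ?q t) + of_nat (card A) \<partial>coin_flips A)"
  proof (rule nn_integral_cong)
    fix t
    have "real (2 * ?p t * (?q t + 1)) * (1/2) + real (2 * (?p t + 1) * ?q t) * (1/2) =
        real (2 * ?p t * ?q t) + real (?p t + ?q t)"
      by (simp add: algebra_simps)
    hence "ennreal (real (2 * ?p t * (?q t + 1)) * (1/2) + real (2 * (?p t + 1) * ?q t) * (1/2)) =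
        ennreal (real (2 * ?p t * ?q t) + real (card A))"
      unfolding cnt by simp
    thus "of_nat (2 * ?p t * (?q t + 1)) * ennreal (1/2) + of_nat (2 * (?p t + 1) * ?q t) * ennreal (1/2) =
        of_nat (2 * ?p t * ?q t) + (of_nat (card A) :: ennreal)"
      unfolding ennreal_of_nat_eq_real_of_nat
      by (simp only: ennreal_mult'[symmetric] ennreal_plus[symmetric] of_nat_0_le_iff mult_nonneg_nonneg) 
  qed
  also have "\<dots> = ennreal (real (card A) * (real (card A) - 1) / 2) + of_nat (card A)"
    by (simp add: nn_integral_add insert.IH del: of_nat_mult)
  also have "\<dots> = ennreal (real (card A) * (real (card A) - 1) / 2 + real (card A))"
    unfolding ennreal_of_nat_eq_real_of_nat
    by (subst ennreal_plus) (cases "card A = 0", auto)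
  also have "real (card A) * (real (card A) - 1) / 2 + real (card A) =
      real (card (insert x A)) * (real (card (insert x A)) - 1) / 2"
    using insert.hyps by (simp add: field_simps)
  finally show ?case .
qed

text \<open>The weight \<open>g\<close> depends on the degree alone and carries the truncation of
  large degrees.\<close>

lemma nn_integral_opposite_count:
  "(\<integral>\<^sup>+y. g (fst y) * of_nat (opposite_count y) \<partial>signed_degree \<xi>) =
     (\<integral>\<^sup>+d. g d * ennreal (real d * (real d - 1) / 2) \<partial>\<xi>)"
  unfolding signed_degree_def nn_integral_bind_pmf nn_integral_map_pmf opposite_count_def pos_count_def
    neg_count_def fst_conv snd_conv
proof (rule nn_integral_cong)
  fix d
  show "(\<integral>\<^sup>+t. g d * of_nat (2 * card {j \<in> {..<d}. \<not> t j} * card {j \<in> {..<d}. t j}) \<partial>coin_flips {..<d}) =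
      g d * ennreal (real d * (real d - 1) / 2)"
    using nn_integral_coin_flips[of "{..<d}"] by (subst nn_integral_cmult) (simp_all only: card_lessThan finite_lessThan borel_measurable_count_space measurable_pmf_measure1, simp)
qed

text \<open>Reverse Markov argument: \<open>2 * p * q\<close> never exceeds \<open>d^2 / 2\<close>
  and is at most \<open>3 * d^2 / 8\<close> if a sign occurs at most \<open>d / 4\<close> times,
  while its mean \<open>d * (d - 1) / 2\<close> is close to the maximum. Imbalance therefore has
  probability at most \<open>4 / d\<close>.\<close>

lemma prob_coin_flips_balanced:
  assumes "8 \<le> d" "4 * m \<le> d"
  shows "Pr (coin_flips {..<d})
     {t. m \<le> card {j \<in> {..<d}. \<not> t j} \<and> m \<le> card {j \<in> {..<d}. t j}} \<ge> 1 / 2"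
proof -
  let ?M = "measure_pmf (coin_flips {..<d})"
  let ?w = "\<lambda>t. 2 * card {j \<in> {..<d}. \<not> t j} * card {j \<in> {..<d}. t j}"
  let ?G = "{t. m \<le> card {j \<in> {..<d}. \<not> t j} \<and> m \<le> card {j \<in> {..<d}. t j}}"
  define \<pi> where "\<pi> = Pr (coin_flips {..<d}) ?G"
  have \<pi>: "0 \<le> \<pi>" "\<pi> \<le> 1" by (auto simp: \<pi>_def)
  have w: "real (?w t) \<le> 3 * real d ^ 2 / 8 + real d ^ 2 / 8 * indicator ?G t" for t
  proof -
    define p q where "p = real (pos_count (d, t))" and "q = real (neg_count (d, t))"
    have pq: "p + q = real d" "p \<ge> 0" "q \<ge> 0"
      using pos_count_plus_neg_count[of "(d, t)"] by (auto simp: p_def q_def)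
    have w_eq: "real (?w t) = 2 * p * q" by (simp add: p_def q_def pos_count_def neg_count_def)
    have "2 * p * q \<le> real d ^ 2 / 2"
      using zero_le_power2[of "p - q"] by (simp add: pq(1)[symmetric] power2_eq_square algebra_simps)
    moreover have "2 * p * q \<le> 3 * real d ^ 2 / 8" if "t \<notin> ?G"
    proof -
      have *: "2 * x * y \<le> 3 * real d ^ 2 / 8" if "x + y = real d" "0 \<le> x" "x \<le> real d / 4" for x y :: real
      proof -
        have "0 \<le> (real d / 4 - x) * (3 * real d / 4 - x)" using that by (intro mult_nonneg_nonneg) auto
        moreover have "2 * x * (real d - x) = 3 * real d ^ 2 / 8 - 2 * ((real d / 4 - x) * (3 * real d / 4 - x))"
          by (simp add: power2_eq_square field_simps)
        moreover have "y = real d - x" using that by simp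
        ultimately show ?thesis by simp
      qed
      have "p < real m \<or> q < real m" using that by (auto simp: p_def q_def pos_count_def neg_count_def)
      hence "p \<le> real d / 4 \<or> q \<le> real d / 4" using assms(2) by linarith
      thus ?thesis using *[of p q] *[of q p] pq by (auto simp: mult_ac)
    qed
    ultimately show ?thesis using w_eq by (auto simp: indicator_def)
  qed
  have "ennreal (real d * (real d - 1) / 2) = (\<integral>\<^sup>+t. of_nat (?w t) \<partial>?M)"
    using nn_integral_coin_flips[of "{..<d}"] by simp
  also have "\<dots> \<le> (\<integral>\<^sup>+t. ennreal (3 * real d ^ 2 / 8) + ennreal (real d ^ 2 / 8) * indicator ?G t \<partial>?M)"
  proof (rule nn_integral_mono)
    fix t
    have "ennreal (real (?w t)) \<le> ennreal (3 * real d ^ 2 / 8 + real d ^ 2 / 8 * indicator ?G t)"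
      using w by (rule ennreal_leI)
    thus "of_nat (?w t) \<le> ennreal (3 * real d ^ 2 / 8) + ennreal (real d ^ 2 / 8) * indicator ?G t"
      unfolding ennreal_of_nat_eq_real_of_nat[symmetric]
      by (subst (asm) ennreal_plus) (auto simp: indicator_def split: if_splits)
  qed
  also have "\<dots> = ennreal (3 * real d ^ 2 / 8) + ennreal (real d ^ 2 / 8) * ennreal \<pi>"
    by (simp add: nn_integral_add nn_integral_cmult \<pi>_def measure_pmf.emeasure_eq_measure)
  also have "\<dots> = ennreal (3 * real d ^ 2 / 8 + real d ^ 2 / 8 * \<pi>)"
    using \<pi> by (subst ennreal_plus, simp, simp, subst ennreal_mult) auto
  finally have "real d * (real d - 1) / 2 \<le> 3 * real d ^ 2 / 8 + real d ^ 2 / 8 * \<pi>"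
    using \<pi> by (subst (asm) ennreal_le_iff) auto
  hence "real d * (real d * (1 - \<pi>)) \<le> real d * 4"
    by (simp add: power2_eq_square field_simps)
  hence "real d * (1 - \<pi>) \<le> 4" using assms(1) by (subst (asm) mult_le_cancel_left_pos) auto
  moreover have "8 * (1 - \<pi>) \<le> real d * (1 - \<pi>)" using assms(1) \<pi> by (intro mult_right_mono) auto
  ultimately show ?thesis by (simp add: \<pi>_def)
qed

text \<open>The threshold \<open>4 * m + 8\<close> guarantees both degree conditions of the balance
  bound.\<close>

lemma prob_hub_ge:
  "Pr (signed_degree \<xi>) {y. m \<le> pos_count y \<and> m \<le> neg_count y} \<ge> tail \<xi> (4 * m + 8) / 2"
proof -
  let ?G = "{y. m \<le> pos_count y \<and> m \<le> neg_count y}"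
  define h :: real where "h = 1 / 2"
  have h: "h \<ge> 0" by (simp add: h_def)
  have "ennreal (h * tail \<xi> (4 * m + 8)) = (\<integral>\<^sup>+d. ennreal h * indicator {4 * m + 8..} d \<partial>\<xi>)"
    using h by (simp add: nn_integral_cmult tail_def measure_pmf.emeasure_eq_measure ennreal_mult)
  also have "\<dots> \<le> (\<integral>\<^sup>+d. emeasure (coin_flips {..<d}) (Pair d -` ?G) \<partial>\<xi>)"
  proof (rule nn_integral_mono)
    fix d
    show "ennreal h * indicator {4 * m + 8..} d \<le> emeasure (coin_flips {..<d}) (Pair d -` ?G)"
    proof (cases "4 * m + 8 \<le> d")
      case True
      hence "h \<le> Pr (coin_flips {..<d}) (Pair d -` ?G)"
        using prob_coin_flips_balanced[of d m] by (simp add: vimage_def pos_count_def neg_count_def h_def)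
      thus ?thesis using True by (simp add: measure_pmf.emeasure_eq_measure ennreal_leI)
    qed simp
  qed
  also have "\<dots> = emeasure (signed_degree \<xi>) ?G"
    by (simp add: signed_degree_def)
  finally show ?thesis
    by (simp add: measure_pmf.emeasure_eq_measure h_def)
qed


section \<open>Transfer between the degree law and signed degrees\<close>

lemma map_fst_signed_degree: "map_pmf fst (signed_degree \<xi>) = \<xi>"
  by (simp add: signed_degree_def map_bind_pmf pmf.map_comp o_def map_pmf_const bind_return_pmf')

lemma prob_signed_degree_fst: "Pr (signed_degree \<xi>) {y. fst y \<in> A} = Pr \<xi> A"
proof -
  have "Pr \<xi> A = Pr (map_pmf fst (signed_degree \<xi>)) A"
    by (simp add: map_fst_signed_degree)
  thus ?thesis by (simp add: vimage_def)
qed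

lemma prob_max_degree_ge_le:
  "Pr (signed_degrees n \<xi>) {f. \<exists>i<n. l \<le> fst (f i)} \<le> real n * tail \<xi> l"
  using prob_Pi_pmf_Bex_le[of n "(0, \<lambda>_. False)" "signed_degree \<xi>" "{y. fst y \<in> {l..}}"]
  by (simp add: signed_degrees_def tail_def flip: prob_signed_degree_fst)

lemma
  fixes g :: "nat \<Rightarrow> real"
  shows integrable_signed_degree_fst:
      "integrable (signed_degree \<xi>) (\<lambda>y. g (fst y)) \<longleftrightarrow> integrable (measure_pmf \<xi>) g"
    and expectation_signed_degree_fst:
      "Exp (signed_degree \<xi>) (\<lambda>y. g (fst y)) = Exp \<xi> g"
proof -
  have "integrable (measure_pmf (map_pmf fst (signed_degree \<xi>))) g \<longleftrightarrow> integrable (measure_pmf \<xi>) g"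
    by (simp add: map_fst_signed_degree)
  thus "integrable (signed_degree \<xi>) (\<lambda>y. g (fst y)) \<longleftrightarrow> integrable (measure_pmf \<xi>) g"
    by (simp add: integrable_map_pmf_eq)
  have "Exp (map_pmf fst (signed_degree \<xi>)) g = Exp \<xi> g"
    by (simp add: map_fst_signed_degree)
  thus "Exp (signed_degree \<xi>) (\<lambda>y. g (fst y)) = Exp \<xi> g"
    by simp
qed

lemma
  fixes g :: "nat \<Rightarrow> real"
  assumes g: "\<And>d. g d \<ge> 0" and int: "integrable (measure_pmf \<xi>) (\<lambda>d. g d * real d ^ 2)"
  shows integrable_opposite_count:
      "integrable (signed_degree \<xi>) (\<lambda>y. g (fst y) * real (opposite_count y))"
    and expectation_opposite_count:
      "Exp (signed_degree \<xi>) (\<lambda>y. g (fst y) * real (opposite_count y)) =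
         Exp \<xi> (\<lambda>d. g d * (real d * (real d - 1) / 2))"
proof -
  have "integrable (signed_degree \<xi>) (\<lambda>y. g (fst y) * real (fst y) ^ 2)"
    using integrable_signed_degree_fst[of \<xi> "\<lambda>d. g d * real d ^ 2"] int by simp
  thus int': "integrable (signed_degree \<xi>) (\<lambda>y. g (fst y) * real (opposite_count y))"
  proof (rule Bochner_Integration.integrable_bound)
    have "g (fst y) * real (opposite_count y) \<le> g (fst y) * real (fst y) ^ 2" for y
    proof (rule mult_left_mono)
      have "opposite_count y \<le> (fst y)\<^sup>2" using opposite_count_le[of y] by linarith
      thus "real (opposite_count y) \<le> real (fst y) ^ 2" by (metis of_nat_le_iff of_nat_power)
    qed (rule g)
    thus "AE y in measure_pmf (signed_degree \<xi>). norm (g (fst y) * real (opposite_count y)) \<le> norm (g (fst y) * real (fst y) ^ 2)"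
      using g by (intro AE_pmfI) (simp add: abs_mult)
  qed simp
  have dd: "real d * (real d - 1) / 2 \<ge> 0" for d :: nat by (cases "d = 0") auto
  have int2: "integrable (measure_pmf \<xi>) (\<lambda>d. g d * (real d * (real d - 1) / 2))"
  proof (rule Bochner_Integration.integrable_bound[OF int])
    have ineq: "g d * (real d * (real d - 1) / 2) \<le> g d * real d ^ 2" for d
      using g by (intro mult_left_mono) (auto simp: power2_eq_square field_simps)
    have eq: "\<bar>g d * (real d * (real d - 1) / 2)\<bar> = g d * (real d * (real d - 1) / 2)" for d
      by (intro abs_of_nonneg mult_nonneg_nonneg g dd)
    show "AE d in measure_pmf \<xi>. norm (g d * (real d * (real d - 1) / 2)) \<le> norm (g d * real d ^ 2)"
      unfolding real_norm_def eq by (intro AE_pmfI order_trans[OF ineq abs_ge_self])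
  qed simp
  have "ennreal (Exp (signed_degree \<xi>) (\<lambda>y. g (fst y) * real (opposite_count y))) =
      (\<integral>\<^sup>+y. ennreal (g (fst y) * real (opposite_count y)) \<partial>signed_degree \<xi>)"
    using g by (intro nn_integral_eq_integral[symmetric] int') (auto intro!: AE_pmfI mult_nonneg_nonneg)
  also have "\<dots> = (\<integral>\<^sup>+y. ennreal (g (fst y)) * of_nat (opposite_count y) \<partial>signed_degree \<xi>)"
    using g by (simp add: ennreal_mult ennreal_of_nat_eq_real_of_nat)
  also have "\<dots> = (\<integral>\<^sup>+d. ennreal (g d) * ennreal (real d * (real d - 1) / 2) \<partial>\<xi>)"
    by (rule nn_integral_opposite_count)
  also have "\<dots> = (\<integral>\<^sup>+d. ennreal (g d * (real d * (real d - 1) / 2)) \<partial>\<xi>)"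
    using g dd by (intro nn_integral_cong ennreal_mult[symmetric]) auto
  also have "\<dots> = ennreal (Exp \<xi> (\<lambda>d. g d * (real d * (real d - 1) / 2)))"
    using g dd by (intro nn_integral_eq_integral int2) (auto intro!: AE_pmfI mult_nonneg_nonneg)
  finally show "Exp (signed_degree \<xi>) (\<lambda>y. g (fst y) * real (opposite_count y)) =
         Exp \<xi> (\<lambda>d. g d * (real d * (real d - 1) / 2))"
    using g dd by (subst (asm) ennreal_inj) (auto intro!: integral_nonneg mult_nonneg_nonneg)
qed

lemma set_signed_degrees:
  assumes "f \<in> set_pmf (signed_degrees n \<xi>)" "i < n"
  shows "fst (f i) \<in> set_pmf \<xi>"
proof -
  have "f i \<in> set_pmf (signed_degree \<xi>)"
    using assms by (auto simp: signed_degrees_def set_Pi_pmf PiE_dflt_def)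
  hence "fst (f i) \<in> set_pmf (map_pmf fst (signed_degree \<xi>))" by simp
  thus ?thesis by (simp add: map_fst_signed_degree)
qed

text \<open>Positivity of the degrees turns large \<open>n\<close> into a large number of clones, as
  the matching estimates demand.\<close>

lemma card_clones_ge:
  assumes "f \<in> set_pmf (signed_degrees n \<xi>)" "0 \<notin> set_pmf \<xi>"
  shows "n \<le> card (clones n (fst \<circ> f))"
proof -
  have "(\<Sum>i<n. 1) \<le> (\<Sum>i<n. fst (f i))"
    using set_signed_degrees[OF assms(1)] assms(2) by (intro sum_mono) (metis One_nat_def Suc_leI gr0I lessThan_iff)
  thus ?thesis by (simp add: card_clones)
qed

section \<open>Moments and truncated means of power laws\<close>

lemma moment_eq_expectation:
  assumes "integrable (measure_pmf \<xi>) (\<lambda>x. real x ^ r)"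
  shows "moment r \<xi> = ennreal (Exp \<xi> (\<lambda>x. real x ^ r))"
proof -
  have "moment r \<xi> = (\<integral>\<^sup>+x. ennreal (real x ^ r) \<partial>\<xi>)"
    by (simp add: moment_def ennreal_of_nat_eq_real_of_nat flip: of_nat_power)
  thus ?thesis using nn_integral_eq_integral[OF assms] by simp
qed

lemma integrable_power_if_moment_finite:
  assumes "moment r \<xi> < \<top>"
  shows "integrable (measure_pmf \<xi>) (\<lambda>x. real x ^ r)"
proof (rule integrableI_bounded)
  have "(\<integral>\<^sup>+x. ennreal (norm (real x ^ r)) \<partial>\<xi>) = moment r \<xi>"
    by (simp add: moment_def ennreal_of_nat_eq_real_of_nat flip: of_nat_power)
  thus "(\<integral>\<^sup>+x. ennreal (norm (real x ^ r)) \<partial>\<xi>) < \<infinity>" using assms by simp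
qed simp

lemma integrable_indicator_pmf: "integrable (measure_pmf p) (indicator A :: 'a \<Rightarrow> real)"
  by (rule measure_pmf.integrable_const_bound[where B = 1]) auto

text \<open>As \<open>x^2\<close> is at least the sum of all \<open>l \<le> x\<close>, the second
  moment dominates the sum of \<open>l * tail \<xi> l \<ge> W / l\<close>, a harmonic
  series.\<close>

lemma moment_2_infinite:
  assumes "W > 0" "\<And>l. l \<ge> 1 \<Longrightarrow> W * real l powr (- \<alpha>) \<le> tail \<xi> l" "\<alpha> \<le> 2"
  shows "moment 2 \<xi> = \<top>"
proof (rule ccontr)
  assume "moment 2 \<xi> \<noteq> \<top>"
  hence int: "integrable (measure_pmf \<xi>) (\<lambda>x. real x ^ 2)"
    by (intro integrable_power_if_moment_finite) (simp add: less_top)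
  define r where "r = Exp \<xi> (\<lambda>x. real x ^ 2)"
  have bound: "W * harm T \<le> r" for T
  proof -
    have "W * harm T = (\<Sum>l=1..T. W * inverse (real l))"
      by (simp add: harm_def sum_distrib_left)
    also have "\<dots> \<le> (\<Sum>l=1..T. real l * tail \<xi> l)"
    proof (rule sum_mono)
      fix l assume "l \<in> {1..T}"
      hence l: "l \<ge> 1" by simp
      have "W * inverse (real l) = real l * (W * real l powr (- 2))"
        using l by (simp add: powr_minus powr_numeral field_simps power2_eq_square)
      also have "\<dots> \<le> real l * (W * real l powr (- \<alpha>))"
        using l assms(1,3) by (intro mult_left_mono powr_mono) auto
      also have "\<dots> \<le> real l * tail \<xi> l" using assms(2)[OF l] by (intro mult_left_mono) auto
      finally show "W * inverse (real l) \<le> real l * tail \<xi> l" .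
    qed
    also have "\<dots> = Exp \<xi> (\<lambda>x. \<Sum>l=1..T. real l * indicator {l..} x)"
      by (subst Bochner_Integration.integral_sum) (auto simp: tail_def integrable_indicator_pmf)
    also have "\<dots> \<le> r"
      unfolding r_def
    proof (rule integral_mono[OF _ int])
      fix x :: nat
      have "(\<Sum>l=1..T. real l * indicator {l..} x) = (\<Sum>l=1..T. if l \<in> {..x} then real l else 0)"
        by (intro sum.cong) (auto simp: indicator_def)
      also have "\<dots> = (\<Sum>l\<in>{1..T} \<inter> {..x}. real l)"
        by (rule sum.inter_restrict[symmetric]) simp
      also have "\<dots> \<le> (\<Sum>l\<in>{1..x}. real x)"
      proof (rule order_trans)
        show "(\<Sum>l\<in>{1..T} \<inter> {..x}. real l) \<le> (\<Sum>l\<in>{1..T} \<inter> {..x}. real x)"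
          by (intro sum_mono) auto
        show "(\<Sum>l\<in>{1..T} \<inter> {..x}. real x) \<le> (\<Sum>l\<in>{1..x}. real x)"
          by (intro sum_mono2) auto
      qed
      also have "\<dots> = real x ^ 2" by (simp add: power2_eq_square)
      finally show "(\<Sum>l=1..T. real l * indicator {l..} x) \<le> real x ^ 2" .
    qed (intro Bochner_Integration.integrable_sum integrable_mult_right integrable_indicator_pmf)
    finally show ?thesis .
  qed
  have "\<forall>\<^sub>F T in sequentially. harm T \<ge> (r / W + 1 :: real)"
    using harm_at_top by (auto simp: filterlim_at_top)
  then obtain T where "harm T \<ge> (r / W + 1 :: real)" by (auto simp: eventually_sequentially)
  hence "W * (r / W + 1) \<le> W * harm T" using assms(1) by (intro mult_left_mono) auto
  moreover have "W * (r / W + 1) = r + W" using assms(1) by (simp add: distrib_left)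
  ultimately have "r + W \<le> r" using bound[of T] by linarith
  thus False using assms(1) by simp
qed

text \<open>Covers infinite means. The truncated mean is the sum of the first \<open>T\<close>
  tails; giving away a factor \<open>T powr \<kappa>\<close> raises the exponent to
  \<open>\<alpha> + \<kappa> > 1\<close>, where the series converges.\<close>

lemma expectation_min_le:
  assumes "V > 0" "\<And>l. l \<ge> 1 \<Longrightarrow> tail \<xi> l \<le> V * real l powr (- \<alpha>)" "\<kappa> \<ge> 0" "\<alpha> + \<kappa> > 1"
  obtains C where "C > 0"
    "\<And>T. Exp \<xi> (\<lambda>x. min (real x) (real T)) \<le> C * real T powr \<kappa>"
proof -
  have sm: "summable (\<lambda>l. real l powr (- (\<alpha> + \<kappa>)))"
    using summable_real_powr_iff[of "- (\<alpha> + \<kappa>)"] assms(4) by simp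
  define C where "C = V * ((\<Sum>l. real l powr (- (\<alpha> + \<kappa>))) + 1)"
  have pos: "(\<Sum>l. real l powr (- (\<alpha> + \<kappa>))) \<ge> 0" by (intro suminf_nonneg sm) simp
  show ?thesis
  proof (rule that[of C])
    show "C > 0" unfolding C_def using pos assms(1) by (intro mult_pos_pos) auto
    fix T :: nat
    have min_eq: "min (real x) (real T) = (\<Sum>l=1..T. indicator {l..} x)" for x :: nat
    proof -
      have "(\<Sum>l=1..T. indicator {l..} x :: real) = (\<Sum>l=1..T. if l \<in> {..x} then 1 else 0)"
        by (intro sum.cong) (auto simp: indicator_def)
      also have "\<dots> = (\<Sum>l\<in>{1..T} \<inter> {..x}. 1)"
        by (rule sum.inter_restrict[symmetric]) simp
      also have "{1..T} \<inter> {..x} = {1..min T x}" by auto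
      finally show ?thesis by simp
    qed
    have "Exp \<xi> (\<lambda>x. min (real x) (real T)) = (\<Sum>l=1..T. tail \<xi> l)"
      unfolding min_eq by (subst Bochner_Integration.integral_sum) (auto simp: tail_def integrable_indicator_pmf)
    also have "\<dots> \<le> (\<Sum>l=1..T. V * real T powr \<kappa> * real l powr (- (\<alpha> + \<kappa>)))"
    proof (rule sum_mono)
      fix l assume l: "l \<in> {1..T}"
      have "tail \<xi> l \<le> V * real l powr (- \<alpha>)" using l by (intro assms(2)) auto
      also have "\<dots> = V * real l powr \<kappa> * real l powr (- (\<alpha> + \<kappa>))"
        using l by (simp add: powr_add[symmetric])
      also have "\<dots> \<le> V * real T powr \<kappa> * real l powr (- (\<alpha> + \<kappa>))"
        using l assms(1,3) by (intro mult_right_mono mult_left_mono powr_mono2) auto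
      finally show "tail \<xi> l \<le> V * real T powr \<kappa> * real l powr (- (\<alpha> + \<kappa>))" .
    qed
    also have "\<dots> = V * real T powr \<kappa> * (\<Sum>l=1..T. real l powr (- (\<alpha> + \<kappa>)))"
      by (simp add: sum_distrib_left)
    also have "(\<Sum>l=1..T. real l powr (- (\<alpha> + \<kappa>))) \<le> (\<Sum>l. real l powr (- (\<alpha> + \<kappa>)))"
      by (intro sum_le_suminf sm) auto
    also have "V * real T powr \<kappa> * (\<Sum>l. real l powr (- (\<alpha> + \<kappa>))) \<le> V * real T powr \<kappa> * ((\<Sum>l. real l powr (- (\<alpha> + \<kappa>))) + 1)"
      using assms(1) by (intro mult_left_mono) auto
    also have "\<dots> = C * real T powr \<kappa>" by (simp add: C_def)
    finally show "Exp \<xi> (\<lambda>x. min (real x) (real T)) \<le> C * real T powr \<kappa>"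
      using assms(1) by (simp add: mult_left_mono)
  qed
qed

lemma moment_1_finite:
  assumes "V > 0" "\<And>l. l \<ge> 1 \<Longrightarrow> tail \<xi> l \<le> V * real l powr (- \<alpha>)" "\<alpha> > 1"
  shows "moment 1 \<xi> < \<top>"
proof -
  have "moment 1 \<xi> = (\<Sum>t. emeasure (measure_pmf \<xi>) {x \<in> space (measure_pmf \<xi>). t < x})"
    unfolding moment_def power_one_right by (rule nn_integral_nat_function) simp
  also have "\<dots> = (\<Sum>t. ennreal (tail \<xi> (Suc t)))"
    by (simp add: tail_def measure_pmf.emeasure_eq_measure atLeast_def Suc_le_eq)
  also have "\<dots> \<le> (\<Sum>t. ennreal (V * real (Suc t) powr (- \<alpha>)))"
    by (intro suminf_le ennreal_leI assms(2)) auto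
  also have "\<dots> < \<top>"
    unfolding less_top[symmetric]
  proof (rule ennreal_suminf_neq_top)
    have "summable (\<lambda>t. real (Suc t) powr (- \<alpha>))"
      using summable_real_powr_iff[of "- \<alpha>"] assms(3) summable_Suc_iff[of "\<lambda>t. real t powr (- \<alpha>)"] by simp
    thus "summable (\<lambda>t. V * real (Suc t) powr (- \<alpha>))" by (rule summable_mult)
  qed (use assms(1) in simp)
  finally show ?thesis .
qed


section \<open>The three regimes\<close>

text \<open>For \<alpha> \<le> 1 the mean is infinite, so the degree sum is controlled by truncation
  and Markov instead of a law of large numbers.\<close>

lemma config_model_unsat_heavy_tail:
  assumes pos: "0 \<notin> set_pmf \<xi>" and \<alpha>: "0 < \<alpha>" "\<alpha> < 2" and VW: "V > 0" "W > 0"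
    and upper: "\<And>l. l \<ge> 1 \<Longrightarrow> tail \<xi> l \<le> V * real l powr (- \<alpha>)"
    and lower: "\<And>l. l \<ge> 1 \<Longrightarrow> W * real l powr (- \<alpha>) \<le> tail \<xi> l"
  shows "((\<lambda>n. Pr (config_model 2 n \<xi>) {\<phi>. satisfiable \<phi>}) \<longlongrightarrow> 0) (admissible_sequentially 2 \<xi>)"
proof (rule config_model_prob_tendsto_0)
  fix \<epsilon> :: real assume \<epsilon>: "\<epsilon> > 0"
  \<comment> \<open>With high probability the largest degree exceeds \<open>n powr b\<close>, no degree exceeds
     \<open>n powr \<tau>\<close>, and hence the degree sum is below \<open>n powr \<sigma>\<close>; the choice of \<open>\<theta>\<close>
     ensures \<open>\<sigma> < 2 * b\<close>.\<close>
  define \<rho> where "\<rho> = (max 1 \<alpha> + 2) / 2"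
  have \<rho>: "1 < \<rho>" "\<alpha> < \<rho>" "\<rho> < 2" using \<alpha> by (auto simp: \<rho>_def)
  define \<kappa> where "\<kappa> = \<rho> - \<alpha>"
  define \<theta> where "\<theta> = (2 - \<rho>) / 8"
  define b where "b = (1 - \<theta>) / \<alpha>"
  define \<tau> where "\<tau> = (1 + \<theta>) / \<alpha>"
  define \<sigma> where "\<sigma> = 1 + \<tau> * \<kappa> + \<theta>"
  define \<gamma> where "\<gamma> = 2 * b - \<sigma>"
  have \<theta>: "0 < \<theta>" "\<theta> < 1" using \<rho> by (auto simp: \<theta>_def)
  have b: "b > 0" and \<tau>: "\<tau> > 0" using \<theta> \<alpha> by (auto simp: b_def \<tau>_def)
  have \<kappa>: "\<kappa> > 0" using \<rho> by (simp add: \<kappa>_def)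
  \<comment> \<open>For \<theta> = 0 the value would be \<open>(2 - \<rho>) / \<alpha> > 0\<close>;
    \<theta> is small enough to preserve the sign. The bound \<open>\<rho> > 1\<close> gives
    \<open>\<alpha> + \<kappa> > 1\<close>.\<close>
  have \<gamma>: "\<gamma> > 0"
  proof -
    have "\<alpha> * \<gamma> = 2 * (1 - \<theta>) - (\<alpha> + (1 + \<theta>) * (\<rho> - \<alpha>) + \<theta> * \<alpha>)"
      using \<alpha> by (simp add: \<gamma>_def \<sigma>_def b_def \<tau>_def \<kappa>_def field_simps)
    also have "\<dots> = (2 - \<rho>) - \<theta> * (2 + \<rho>)" by (simp add: algebra_simps)
    also have "\<theta> * (2 + \<rho>) \<le> \<theta> * 4" using \<rho> \<theta> by (intro mult_left_mono) auto
    hence "(2 - \<rho>) - \<theta> * (2 + \<rho>) > 0" using \<rho> by (simp add: \<theta>_def)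
    finally show ?thesis using \<alpha> by (simp add: zero_less_mult_iff)
  qed
  obtain C where C: "C > 0"
    "\<And>T. Exp \<xi> (\<lambda>x. min (real x) (real T)) \<le> C * real T powr \<kappa>"
    using expectation_min_le[OF VW(1) upper, of \<kappa>] \<kappa> \<rho> by (auto simp: \<kappa>_def)
  define m where "m n = nat \<lfloor>real n powr b\<rfloor>" for n
  define T where "T n = nat \<lceil>real n powr \<tau>\<rceil>" for n
  \<comment> \<open>The failures are a degree above \<open>T n\<close>, a large truncated degree
    sum, and the absence of a hub. Off \<open>B1\<close> the truncated sum is the true degree
    sum.\<close>
  define B1 where "B1 n = {f :: nat \<Rightarrow> nat \<times> (nat \<Rightarrow> bool). \<exists>i<n. Suc (T n) \<le> fst (f i)}" for n
  define B2 where "B2 n = {f :: nat \<Rightarrow> nat \<times> (nat \<Rightarrow> bool). (\<Sum>i<n. min (real (fst (f i))) (real (T n))) \<ge> real n powr \<sigma>}" for n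
  define B3 where "B3 n = {f. \<forall>i<n. f i \<notin> {y. m n \<le> pos_count y \<and> m n \<le> neg_count y}}" for n :: nat
  have m: "real (m n) \<le> real n powr b" "real n powr b - 1 \<le> real (m n)" for n
    by (auto simp: m_def)
  have T: "real n powr \<tau> \<le> real (T n)" "real (T n) \<le> real n powr \<tau> + 1" for n
    by (auto simp: T_def)
  have bound: "\<forall>\<^sub>F n in sequentially. Pr (signed_degrees n \<xi>) (B1 n \<union> B2 n \<union> B3 n) \<le>
     V * real n powr (- \<theta>) + C * 2 powr \<kappa> * real n powr (- \<theta>) +
     exp (- (W / 2 * 12 powr (- \<alpha>) * real n powr \<theta>))"
    using eventually_gt_at_top[of 0]
  proof eventually_elim
    case (elim n)
    have n1: "real n powr x \<ge> 1" if "x \<ge> 0" for x using elim that by (simp add: ge_one_powr_ge_zero)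
    have T1: "T n \<ge> 1" using T(1)[of n] n1[of \<tau>] \<tau> by linarith
    have p1: "Pr (signed_degrees n \<xi>) (B1 n) \<le> V * real n powr (- \<theta>)"
    proof -
      have "Pr (signed_degrees n \<xi>) (B1 n) \<le> real n * tail \<xi> (Suc (T n))"
        unfolding B1_def by (rule prob_max_degree_ge_le)
      also have "\<dots> \<le> real n * (V * real (Suc (T n)) powr (- \<alpha>))"
        by (intro mult_left_mono upper) auto
      also have "\<dots> \<le> real n * (V * (real n powr \<tau>) powr (- \<alpha>))"
        using VW T(1)[of n] \<alpha> elim by (intro mult_left_mono powr_mono2') auto
      also have "(real n powr \<tau>) powr (- \<alpha>) = real n powr (- 1 - \<theta>)"
        using \<alpha> by (simp add: powr_powr \<tau>_def)
      also have "real n * (V * real n powr (- 1 - \<theta>)) = V * (real n powr 1 * real n powr (- 1 - \<theta>))"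
        using elim by simp
      also have "\<dots> = V * real n powr (- \<theta>)" by (simp only: powr_add[symmetric]) simp
      finally show ?thesis .
    qed
    have p2: "Pr (signed_degrees n \<xi>) (B2 n) \<le> C * 2 powr \<kappa> * real n powr (- \<theta>)"
    proof -
      have int: "integrable (measure_pmf \<xi>) (\<lambda>x. min (real x) (real (T n)))"
        by (rule measure_pmf.integrable_const_bound[where B = "real (T n)"]) auto
      have "Pr (signed_degrees n \<xi>) (B2 n) \<le>
          real n * Exp (signed_degree \<xi>) (\<lambda>y. min (real (fst y)) (real (T n))) / real n powr \<sigma>"
        unfolding B2_def signed_degrees_def
        by (rule prob_Pi_pmf_sum_ge_le)
           (use int elim in \<open>auto simp: integrable_signed_degree_fst[of \<xi> "\<lambda>x. min (real x) (real (T n))"]\<close>)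
      also have "Exp (signed_degree \<xi>) (\<lambda>y. min (real (fst y)) (real (T n))) =
          Exp \<xi> (\<lambda>x. min (real x) (real (T n)))"
        by (rule expectation_signed_degree_fst)
      also have "real n * Exp \<xi> (\<lambda>x. min (real x) (real (T n))) / real n powr \<sigma> \<le>
          real n * (C * real (T n) powr \<kappa>) / real n powr \<sigma>"
        by (intro divide_right_mono mult_left_mono C) auto
      also have "\<dots> \<le> real n * (C * (2 * real n powr \<tau>) powr \<kappa>) / real n powr \<sigma>"
        using C(1) T(2)[of n] n1[of \<tau>] \<tau> \<kappa> by (intro divide_right_mono mult_left_mono powr_mono2) auto
      also have "\<dots> = C * 2 powr \<kappa> * (real n powr 1 * real n powr (\<tau> * \<kappa>) * real n powr (- \<sigma>))"
        using elim by (simp add: powr_mult powr_powr powr_minus field_simps)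
      also have "real n powr 1 * real n powr (\<tau> * \<kappa>) * real n powr (- \<sigma>) = real n powr (- \<theta>)"
        by (simp only: powr_add[symmetric]) (simp add: \<sigma>_def)
      finally show ?thesis .
    qed
    have p3: "Pr (signed_degrees n \<xi>) (B3 n) \<le> exp (- (W / 2 * 12 powr (- \<alpha>) * real n powr \<theta>))"
    proof -
      define \<pi> where "\<pi> = Pr (signed_degree \<xi>) {y. m n \<le> pos_count y \<and> m n \<le> neg_count y}"
      have "Pr (signed_degrees n \<xi>) (B3 n) = (1 - \<pi>) ^ n"
        unfolding B3_def signed_degrees_def \<pi>_def by (rule prob_Pi_pmf_none)
      also have "\<dots> \<le> exp (- \<pi>) ^ n"
        using exp_ge_add_one_self[of "- \<pi>"] by (intro power_mono) (auto simp: \<pi>_def)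
      also have "\<dots> = exp (- (real n * \<pi>))" by (simp add: exp_of_nat_mult[symmetric])
      also have "\<dots> \<le> exp (- (W / 2 * 12 powr (- \<alpha>) * real n powr \<theta>))"
      proof -
        \<comment> \<open>Up to a constant this is a lower bound for the expected number of hubs;
          the 12 comes from \<open>4 * m n + 8 \<le> 12 * real n powr b\<close>.\<close>
        have "real n powr (1 - b * \<alpha>) = real n powr \<theta>" using \<alpha> by (simp add: b_def)
        hence "W / 2 * 12 powr (- \<alpha>) * real n powr \<theta> =
            real n * (W * (12 * real n powr b) powr (- \<alpha>) / 2)"
          using elim by (simp add: powr_mult powr_powr powr_diff powr_minus field_simps)
        also have "\<dots> \<le> real n * (W * real (4 * m n + 8) powr (- \<alpha>) / 2)"
          using VW \<alpha> m(1)[of n] n1[of b] b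
          by (intro mult_left_mono divide_right_mono powr_mono2') auto
        also have "\<dots> \<le> real n * (tail \<xi> (4 * m n + 8) / 2)"
          by (intro mult_left_mono divide_right_mono lower) auto
        also have "\<dots> \<le> real n * \<pi>"
          unfolding \<pi>_def by (intro mult_left_mono prob_hub_ge) auto
        finally show ?thesis by simp
      qed
      finally show ?thesis .
    qed
    have "Pr (signed_degrees n \<xi>) (B1 n \<union> B2 n \<union> B3 n) \<le>
        Pr (signed_degrees n \<xi>) (B1 n) + Pr (signed_degrees n \<xi>) (B2 n) +
        Pr (signed_degrees n \<xi>) (B3 n)"
      by (rule order_trans[OF measure_Un_le add_right_mono[OF measure_Un_le]]) auto
    thus ?case using p1 p2 p3 by linarith
  qed
  have bound_lim: "(\<lambda>n. V * real n powr (- \<theta>) + C * 2 powr \<kappa> * real n powr (- \<theta>) +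
     exp (- (W / 2 * 12 powr (- \<alpha>) * real n powr \<theta>))) \<longlonglongrightarrow> 0"
  proof -
    have c: "W / 2 * 12 powr (- \<alpha>) > 0" using VW by simp
    have t: "(\<lambda>n. real n powr (- \<theta>)) \<longlonglongrightarrow> 0" using \<theta> by real_asymp
    have u: "(\<lambda>n. exp (- (c * real n powr \<theta>))) \<longlonglongrightarrow> 0" if "c > 0" for c using that \<theta> by real_asymp
    show ?thesis
      using tendsto_add[OF tendsto_add[OF tendsto_mult_left[OF t, of V]
        tendsto_mult_left[OF t, of "C * 2 powr \<kappa>"]] u[OF c]] by simp
  qed
  have lim: "(\<lambda>n. Pr (signed_degrees n \<xi>) (B1 n \<union> B2 n \<union> B3 n)) \<longlonglongrightarrow> 0"
    by (rule tendsto_sandwich[OF _ bound tendsto_const bound_lim]) simp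
  have "(\<lambda>n. 2 * exp (- (real n powr \<gamma> / 8))) \<longlonglongrightarrow> 0" using \<gamma> by real_asymp
  hence ev1: "\<forall>\<^sub>F n in sequentially. 2 * exp (- (real n powr \<gamma> / 8)) < \<epsilon>"
    using \<epsilon> by (rule order_tendstoD)
  \<comment> \<open>The constant 4 makes even \<open>m n - 1\<close> at least
    \<open>real n powr b / 2\<close> after rounding.\<close>
  have ev2: "\<forall>\<^sub>F n in sequentially. real n powr b \<ge> 4" using b by real_asymp
  have ev: "\<forall>\<^sub>F n in sequentially. 2 * exp (- (real n powr \<gamma> / 8)) < \<epsilon> \<and> real n powr b \<ge> 4 \<and> 0 < n"
    using ev1 ev2 eventually_gt_at_top[of 0] by eventually_elim simp
  have "negligible_exception \<xi> {\<phi>. satisfiable \<phi>} \<epsilon> (\<lambda>n. B1 n \<union> B2 n \<union> B3 n)"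
  proof (rule negligible_exceptionI[OF lim ev])
    fix n f assume "2 * exp (- (real n powr \<gamma> / 8)) < \<epsilon> \<and> real n powr b \<ge> 4 \<and> 0 < n"
    then have elim: "2 * exp (- (real n powr \<gamma> / 8)) < \<epsilon>" "real n powr b \<ge> 4" "0 < n" by auto
    assume f: "f \<in> set_pmf (signed_degrees n \<xi>)" "f \<notin> B1 n \<union> B2 n \<union> B3 n" and ev: "even (\<Sum>i<n. fst (f i))"
    let ?R = "clones n (fst \<circ> f)"
    have "n \<le> card ?R" using f pos by (intro card_clones_ge) auto
    hence R: "card ?R > 0" "?R \<noteq> {}" using elim(3) by auto
    have "\<forall>i<n. fst (f i) \<le> T n" using f by (auto simp: B1_def not_less_eq_eq)
    hence "(\<Sum>i<n. min (real (fst (f i))) (real (T n))) = (\<Sum>i<n. real (fst (f i)))"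
      by (intro sum.cong) auto
    also have "\<dots> = real (card ?R)" by (simp add: card_clones)
    finally have cR: "real (card ?R) \<le> real n powr \<sigma>" using f by (simp add: B2_def)
    obtain x where x: "x < n" "m n \<le> pos_count (f x)" "m n \<le> neg_count (f x)"
      using f by (auto simp: B3_def)
    have "sat_prob (clone_sign f) ?R {} \<le> 2 * exp (- (real (m n) * (real (m n) - 1) / (2 * real (card ?R))))"
      using R ev x card_literal_clones[OF x(1), of f]
      by (intro sat_prob_hub[where x = x]) (auto simp: card_clones)
    also have "\<dots> \<le> 2 * exp (- (real n powr \<gamma> / 8))"
    proof -
      have "real n powr b / 2 \<le> real (m n)" "real n powr b / 2 \<le> real (m n) - 1"
        using m(2)[of n] elim(2) by auto
      hence "real n powr b / 2 * (real n powr b / 2) \<le> real (m n) * (real (m n) - 1)"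
        by (intro mult_mono) auto
      also have "real n powr b / 2 * (real n powr b / 2) = real n powr (2 * b) / 4"
        by (simp add: powr_add[symmetric])
      finally have num: "real n powr (2 * b) / 4 \<le> real (m n) * (real (m n) - 1)" .
      have "real n powr (2 * b) / 4 / (2 * real n powr \<sigma>) \<le>
          real (m n) * (real (m n) - 1) / (2 * real (card ?R))"
        by (rule frac_le[OF order_trans[OF _ num] num]) (use cR R in auto)
      moreover have "real n powr \<gamma> / 8 \<le> real n powr (2 * b) / 4 / (2 * real n powr \<sigma>)"
        by (simp add: \<gamma>_def powr_diff)
      ultimately show ?thesis by simp
    qed
    finally show "matching_prob ?R (\<lambda>M. cnf_of M (clone_sign f) \<in> {\<phi>. satisfiable \<phi>}) \<le> \<epsilon>"
      using elim(1) by (simp only: matching_prob_satisfiable finite_clones)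
  qed
  thus "\<exists>B. negligible_exception \<xi> {\<phi>. satisfiable \<phi>} \<epsilon> B" by blast
qed

text \<open>Positive tails provide, for each constant \<open>D\<close>, a starting variable with
  \<open>D\<close> clones of either sign. The second moment may be infinite, so the drift is taken
  from variables of bounded degree only.\<close>

lemma config_model_unsat_supercritical:
  assumes pos: "0 \<notin> set_pmf \<xi>" and tail_pos: "\<And>l. tail \<xi> l > 0"
    and m1: "moment 1 \<xi> < \<top>" and m21: "3 * moment 1 \<xi> < moment 2 \<xi>"
  shows "((\<lambda>n. Pr (config_model 2 n \<xi>) {\<phi>. satisfiable \<phi>}) \<longlongrightarrow> 0) (admissible_sequentially 2 \<xi>)"
proof (rule config_model_prob_tendsto_0)
  fix \<epsilon> :: real assume \<epsilon>: "\<epsilon> > 0"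
  define E1 where "E1 = Exp \<xi> real"
  have int1: "integrable (measure_pmf \<xi>) real"
    using integrable_power_if_moment_finite[OF m1] by simp
  have E1: "moment 1 \<xi> = ennreal E1" "E1 \<ge> 0"
    using moment_eq_expectation[of \<xi> 1] int1 by (auto simp: E1_def)
  \<comment> \<open>By monotone convergence the strict inequality already holds for degrees cut off
    at a finite \<open>K0\<close>.\<close>
  have "moment 2 \<xi> = (\<integral>\<^sup>+x. (SUP K. of_nat (x ^ 2) * indicator {..K} x) \<partial>\<xi>)"
    unfolding moment_def
  proof (rule nn_integral_cong)
    fix x :: nat
    show "(of_nat (x ^ 2) :: ennreal) = (SUP K. of_nat (x ^ 2) * indicator {..K} x)"
      by (intro antisym SUP_least SUP_upper2[of x]) (auto simp: indicator_def)
  qed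
  also have "\<dots> = (SUP K. \<integral>\<^sup>+x. of_nat (x ^ 2) * indicator {..K} x \<partial>\<xi>)"
    by (rule nn_integral_monotone_convergence_SUP) (auto simp: incseq_def le_fun_def indicator_def)
  finally obtain K0 :: nat where K0: "3 * moment 1 \<xi> < (\<integral>\<^sup>+x. of_nat (x ^ 2) * indicator {..K0} x \<partial>\<xi>)"
    using m21 by (auto simp: less_SUP_iff)
  define K where "K = max 1 K0"
  define g :: "nat \<Rightarrow> real" where "g = indicator {..K}"
  have g: "g d \<ge> 0" "g d \<le> 1" for d by (auto simp: g_def indicator_def)
  have gK: "g d * real d ^ k \<le> real K ^ k" for d k
    by (auto simp: g_def indicator_def intro: power_mono)
  have intg: "integrable (measure_pmf \<xi>) (\<lambda>d. g d * real d ^ k)" for k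
    using gK[of _ k] g by (intro measure_pmf.integrable_const_bound[where B = "real K ^ k"]) (auto simp: abs_mult)
  define A where "A = Exp \<xi> (\<lambda>d. g d * real d ^ 2)"
  have "3 * moment 1 \<xi> < (\<integral>\<^sup>+x. ennreal (g x * real x ^ 2) \<partial>\<xi>)"
    using K0
  proof (rule less_le_trans)
    show "(\<integral>\<^sup>+x. of_nat (x ^ 2) * indicator {..K0} x \<partial>\<xi>) \<le> (\<integral>\<^sup>+x. ennreal (g x * real x ^ 2) \<partial>\<xi>)"
      by (intro nn_integral_mono) (auto simp: g_def K_def indicator_def ennreal_of_nat_eq_real_of_nat simp flip: of_nat_power)
  qed
  also have "\<dots> = ennreal A"
    unfolding A_def using g by (intro nn_integral_eq_integral intg) auto
  finally have "ennreal (3 * E1) < ennreal A"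
    unfolding E1(1) by (simp add: ennreal_mult')
  hence A: "3 * E1 < A" using E1(2) by (simp add: ennreal_less_iff)
  \<comment> \<open>Small enough that \<open>(1 + 2 * \<delta>) * E1 < (A - E1) / 2\<close>; the
    summand 1 in the denominator excludes division by zero.\<close>
  define \<delta> where "\<delta> = min 1 ((A - 3 * E1) / (8 * (E1 + 1)))"
  have \<delta>: "0 < \<delta>" "\<delta> \<le> 1" using A E1(2) by (auto simp: \<delta>_def)
  have \<delta>E: "2 * \<delta> * E1 < (A - 3 * E1) / 2"
  proof -
    have "\<delta> * E1 \<le> (A - 3 * E1) / (8 * (E1 + 1)) * (E1 + 1)"
      using \<delta> E1(2) by (intro mult_mono) (auto simp: \<delta>_def)
    also have "\<dots> = (A - 3 * E1) / 8"
    proof -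
      have "x / (c * e) * e = x / c" if "e \<noteq> 0" for x c e :: real using that by simp
      moreover have "E1 + 1 \<noteq> 0" using E1(2) by linarith
      ultimately show ?thesis by blast
    qed
    finally show ?thesis using A by simp
  qed
  \<comment> \<open>A negative sum of \<open>X\<close> is the drift condition with \<open>U\<close>
    the variables of degree at most \<open>K\<close>.\<close>
  define X where "X y = (1 + 2 * \<delta>) * real (fst y) - g (fst y) * real (opposite_count y)" for y
  have iX1: "integrable (signed_degree \<xi>) (\<lambda>y. real (fst y))"
    using integrable_signed_degree_fst[of \<xi> real] int1 by simp
  note iX2 = integrable_opposite_count[OF g(1) intg[of 2]]
  have intX: "integrable (signed_degree \<xi>) X"
    unfolding X_def using iX1 iX2 by simp
  have "Exp (signed_degree \<xi>) X = (1 + 2 * \<delta>) * E1 -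
      Exp \<xi> (\<lambda>d. g d * (real d * (real d - 1) / 2))"
    unfolding X_def using iX1 iX2 expectation_opposite_count[OF g(1) intg[of 2]]
      expectation_signed_degree_fst[of \<xi> real] by (simp add: E1_def)
  also have "Exp \<xi> (\<lambda>d. g d * (real d * (real d - 1) / 2)) =
      Exp \<xi> (\<lambda>d. (g d * real d ^ 2 - g d * real d ^ 1) / 2)"
    by (intro Bochner_Integration.integral_cong) (auto simp: power2_eq_square algebra_simps)
  also have "\<dots> = (A - Exp \<xi> (\<lambda>d. g d * real d ^ 1)) / 2"
    using intg[of 2] intg[of 1] by (simp add: A_def)
  also have "Exp \<xi> (\<lambda>d. g d * real d ^ 1) \<le> E1"
    unfolding E1_def using intg[of 1] int1 g by (intro integral_mono) (auto intro: mult_left_le_one_le)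
  hence "(1 + 2 * \<delta>) * E1 - (A - Exp \<xi> (\<lambda>d. g d * real d ^ 1)) / 2 < 0"
    using \<delta>E by (simp add: field_simps)
  finally have EX: "Exp (signed_degree \<xi>) X < 0" .
  have K1: "1 \<le> K" by (simp add: K_def)
  show "\<exists>B. negligible_exception \<xi> {\<phi>. satisfiable \<phi>} \<epsilon> B"
  proof (rule sat_prob_supercritical[OF \<delta> K1 \<epsilon>])
    fix D N0 :: nat assume main: "\<And>(s :: nat \<times> nat \<Rightarrow> bool) R U x. finite R \<Longrightarrow> even (card R) \<Longrightarrow> N0 \<le> card R \<Longrightarrow>
         (\<And>v. v \<in> U \<Longrightarrow> card {c \<in> R. fst c = v} \<le> K) \<Longrightarrow>
         (1 + 2 * \<delta>) * real (card R) \<le> (\<Sum>b\<in>{b \<in> R. fst b \<in> U}. real (card (opposite_clones s R b))) \<Longrightarrow>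
         D \<le> card {c \<in> R. fst c = x \<and> s c} \<Longrightarrow> D \<le> card {c \<in> R. fst c = x \<and> \<not> s c} \<Longrightarrow>
         sat_prob s R {} \<le> \<epsilon>"
    define B1 where "B1 n = {f :: nat \<Rightarrow> nat \<times> (nat \<Rightarrow> bool). (\<Sum>i<n. X (f i)) \<ge> 0}" for n
    \<comment> \<open>\<open>D\<close> does not grow with \<open>n\<close>, so a variable is a
      suitable start with fixed positive probability and \<open>B2\<close> decays
      geometrically.\<close>
    define B2 where "B2 n = {f. \<forall>i<n. f i \<notin> {y. D \<le> pos_count y \<and> D \<le> neg_count y}}" for n :: nat
    have "(\<lambda>n. Pr (signed_degrees n \<xi>) (B1 n)) \<longlonglongrightarrow> 0"
      unfolding B1_def signed_degrees_def by (rule prob_Pi_pmf_sum_nonneg_tendsto_0[OF intX EX])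
    moreover have "(\<lambda>n. Pr (signed_degrees n \<xi>) (B2 n)) \<longlonglongrightarrow> 0"
    proof -
      have "Pr (signed_degree \<xi>) {y. D \<le> pos_count y \<and> D \<le> neg_count y} > 0"
        using prob_hub_ge[of \<xi> D] tail_pos[of "4 * D + 8"] by linarith
      thus ?thesis
        unfolding B2_def signed_degrees_def prob_Pi_pmf_none by (intro LIMSEQ_realpow_zero) auto
    qed
    ultimately have lim: "(\<lambda>n. Pr (signed_degrees n \<xi>) (B1 n \<union> B2 n)) \<longlonglongrightarrow> 0"
      by (rule prob_Un_tendsto_0)
    have "negligible_exception \<xi> {\<phi>. satisfiable \<phi>} \<epsilon> (\<lambda>n. B1 n \<union> B2 n)"
    proof (rule negligible_exceptionI[OF lim eventually_ge_at_top[of N0]])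
      fix n f assume elim: "N0 \<le> n"
      assume f: "f \<in> set_pmf (signed_degrees n \<xi>)" "f \<notin> B1 n \<union> B2 n" and ev: "even (\<Sum>i<n. fst (f i))"
      let ?R = "clones n (fst \<circ> f)" and ?s = "clone_sign f" and ?U = "{i. i < n \<and> fst (f i) \<le> K}"
      have cR: "n \<le> card ?R" using f pos by (intro card_clones_ge) auto
      obtain x where x: "x < n" "D \<le> pos_count (f x)" "D \<le> neg_count (f x)"
        using f by (auto simp: B2_def)
      have "(\<Sum>i<n. g (fst (f i)) * real (opposite_count (f i))) =
          (\<Sum>i<n. if i \<in> ?U then real (opposite_count (f i)) else 0)"
        by (intro sum.cong) (auto simp: g_def indicator_def)
      also have "\<dots> = (\<Sum>i\<in>{..<n} \<inter> ?U. real (opposite_count (f i)))"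
        by (rule sum.inter_restrict[symmetric]) simp
      also have "\<dots> = (\<Sum>b\<in>{b \<in> ?R. fst b \<in> ?U}. real (card (opposite_clones ?s ?R b)))"
        unfolding of_nat_sum[symmetric] by (subst sum_card_opposite_clones) (rule refl)
      finally have sumU: "(\<Sum>i<n. g (fst (f i)) * real (opposite_count (f i))) =
          (\<Sum>b\<in>{b \<in> ?R. fst b \<in> ?U}. real (card (opposite_clones ?s ?R b)))" .
      have "(\<Sum>i<n. X (f i)) < 0" using f by (simp add: B1_def)
      hence "(1 + 2 * \<delta>) * (\<Sum>i<n. real (fst (f i))) < (\<Sum>i<n. g (fst (f i)) * real (opposite_count (f i)))"
        by (simp add: X_def sum_subtractf sum_distrib_left)
      hence drift: "(1 + 2 * \<delta>) * real (card ?R) \<le> (\<Sum>b\<in>{b \<in> ?R. fst b \<in> ?U}. real (card (opposite_clones ?s ?R b)))"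
        unfolding sumU by (simp add: card_clones)
      have "sat_prob ?s ?R {} \<le> \<epsilon>"
      proof (rule main[where U = ?U and x = x])
        show "card {c \<in> ?R. fst c = v} \<le> K" if "v \<in> ?U" for v
          using card_literal_clones(3)[of v n f] that by simp
        show "D \<le> card {c \<in> ?R. fst c = x \<and> ?s c}" "D \<le> card {c \<in> ?R. fst c = x \<and> \<not> ?s c}"
          using card_literal_clones[OF x(1), of f] x by auto
        show "even (card ?R)" using ev by (simp add: card_clones)
        show "N0 \<le> card ?R" using cR elim by linarith
      qed (use drift in simp_all)
      thus "matching_prob ?R (\<lambda>M. cnf_of M ?s \<in> {\<phi>. satisfiable \<phi>}) \<le> \<epsilon>"
        by (simp only: matching_prob_satisfiable finite_clones)
    qed
    thus "\<exists>B. negligible_exception \<xi> {\<phi>. satisfiable \<phi>} \<epsilon> B" by blast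
  qed
qed

lemma config_model_sat_subcritical:
  assumes pos: "0 \<notin> set_pmf \<xi>" and V: "V > 0" and \<alpha>: "\<alpha> > 2"
    and upper: "\<And>l. l \<ge> 1 \<Longrightarrow> tail \<xi> l \<le> V * real l powr (- \<alpha>)"
    and m21: "moment 2 \<xi> < 3 * moment 1 \<xi>"
  shows "((\<lambda>n. Pr (config_model 2 n \<xi>) (- {\<phi>. satisfiable \<phi>})) \<longlongrightarrow> 0) (admissible_sequentially 2 \<xi>)"
proof (rule config_model_prob_tendsto_0)
  fix \<epsilon> :: real assume \<epsilon>: "\<epsilon> > 0"
  have m1: "moment 1 \<xi> < \<top>" using moment_1_finite[OF V upper] \<alpha> by simp
  have m2: "moment 2 \<xi> < \<top>" by (rule less_le_trans[OF m21 top_greatest])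
  define E1 where "E1 = Exp \<xi> real"
  define E2 where "E2 = Exp \<xi> (\<lambda>x. real x ^ 2)"
  have int1: "integrable (measure_pmf \<xi>) real"
    using integrable_power_if_moment_finite[OF m1] by simp
  note int2 = integrable_power_if_moment_finite[OF m2]
  have E: "moment 1 \<xi> = ennreal E1" "moment 2 \<xi> = ennreal E2" "E1 \<ge> 0" "E2 \<ge> 0"
    using moment_eq_expectation[of \<xi> 1] moment_eq_expectation[OF int2] int1 by (auto simp: E1_def E2_def)
  have "ennreal E2 < ennreal (3 * E1)" using m21 unfolding E(1,2) by (simp add: ennreal_mult')
  hence E12: "E2 < 3 * E1" using E by (simp add: ennreal_less_iff)
  \<comment> \<open>Small enough that \<open>(E2 - E1) / 2 < (1 - \<delta>) * E1\<close>, so that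
    the mean of \<open>X\<close> below is negative.\<close>
  define \<delta> where "\<delta> = min (1 / 2) ((3 * E1 - E2) / (4 * (E1 + 1)))"
  have \<delta>: "0 < \<delta>" "\<delta> < 1" using E12 E by (auto simp: \<delta>_def)
  have \<delta>E: "\<delta> * E1 < (3 * E1 - E2) / 2"
  proof -
    have "\<delta> * E1 \<le> (3 * E1 - E2) / (4 * (E1 + 1)) * (E1 + 1)"
      using \<delta> E by (intro mult_mono) (auto simp: \<delta>_def)
    also have "\<dots> = (3 * E1 - E2) / 4"
    proof -
      have "x / (c * e) * e = x / c" if "e \<noteq> 0" for x c e :: real using that by simp
      moreover have "E1 + 1 \<noteq> 0" using E(3) by linarith
      ultimately show ?thesis by blast
    qed
    finally show ?thesis using E12 by simp
  qed
  define X where "X y = real (opposite_count y) - (1 - \<delta>) * real (fst y)" for y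
  have iX1: "integrable (signed_degree \<xi>) (\<lambda>y. real (fst y))"
    using integrable_signed_degree_fst[of \<xi> real] int1 by simp
  have iX2: "integrable (signed_degree \<xi>) (\<lambda>y. real (opposite_count y))"
    using integrable_opposite_count[of "\<lambda>_. 1" \<xi>] int2 by simp
  have intX: "integrable (signed_degree \<xi>) X"
    unfolding X_def using iX1 iX2 by simp
  have "Exp (signed_degree \<xi>) X =
      Exp \<xi> (\<lambda>d. real d * (real d - 1) / 2) - (1 - \<delta>) * E1"
    unfolding X_def using iX1 iX2 expectation_opposite_count[of "\<lambda>_. 1" \<xi>] int2
      expectation_signed_degree_fst[of \<xi> real] by (simp add: E1_def)
  also have "Exp \<xi> (\<lambda>d. real d * (real d - 1) / 2) =
      Exp \<xi> (\<lambda>d. (real d ^ 2 - real d) / 2)"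
    by (intro Bochner_Integration.integral_cong) (auto simp: power2_eq_square algebra_simps)
  also have "\<dots> = (E2 - E1) / 2"
    using int1 int2 by (simp add: E1_def E2_def)
  also have "(E2 - E1) / 2 - (1 - \<delta>) * E1 < 0" using \<delta>E by (simp add: field_simps)
  finally have EX: "Exp (signed_degree \<xi>) X < 0" .
  show "\<exists>B. negligible_exception \<xi> (- {\<phi>. satisfiable \<phi>}) \<epsilon> B"
  proof (rule matching_prob_unsat_subcritical[OF \<delta> \<epsilon>])
    fix \<eta> :: real and N0 :: nat assume \<eta>: "\<eta> > 0" and main:
      "\<And>(s :: nat \<times> nat \<Rightarrow> bool) R \<Delta>. finite R \<Longrightarrow> even (card R) \<Longrightarrow> N0 \<le> card R \<Longrightarrow>
         real (card (opposite_pairs s R)) \<le> (1 - \<delta>) * real (card R) \<Longrightarrow>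
         (\<And>v. card {c \<in> R. fst c = v} \<le> \<Delta>) \<Longrightarrow> (real \<Delta>)\<^sup>2 \<le> \<eta> * real (card R) \<Longrightarrow>
         matching_prob R (\<lambda>M. \<nexists>\<tau>. satisfies s \<tau> M) \<le> \<epsilon>"
    \<comment> \<open>The largest degree bound that the bicycle estimate tolerates. The expected
      number of variables above it is of order \<open>n powr (1 - \<alpha> / 2)\<close>, which
      vanishes because \<alpha> > 2.\<close>
    define \<Delta> where "\<Delta> n = nat \<lfloor>sqrt (\<eta> * real n)\<rfloor>" for n
    have \<Delta>: "real (\<Delta> n) \<le> sqrt (\<eta> * real n)" "sqrt (\<eta> * real n) \<le> real (Suc (\<Delta> n))" for n
      using \<eta> real_of_int_floor_add_one_ge[of "sqrt (\<eta> * real n)"] by (auto simp: \<Delta>_def add.commute)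
    define B1 where "B1 n = {f :: nat \<Rightarrow> nat \<times> (nat \<Rightarrow> bool). (\<Sum>i<n. X (f i)) \<ge> 0}" for n
    define B2 where "B2 n = {f :: nat \<Rightarrow> nat \<times> (nat \<Rightarrow> bool). \<exists>i<n. Suc (\<Delta> n) \<le> fst (f i)}" for n
    have "(\<lambda>n. Pr (signed_degrees n \<xi>) (B1 n)) \<longlonglongrightarrow> 0"
      unfolding B1_def signed_degrees_def by (rule prob_Pi_pmf_sum_nonneg_tendsto_0[OF intX EX])
    moreover have "(\<lambda>n. Pr (signed_degrees n \<xi>) (B2 n)) \<longlonglongrightarrow> 0"
    proof (rule tendsto_sandwich[OF _ _ tendsto_const[of 0]])
      show "\<forall>\<^sub>F n in sequentially. Pr (signed_degrees n \<xi>) (B2 n) \<le>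
          V * \<eta> powr (- \<alpha> / 2) * real n powr (1 - \<alpha> / 2)"
        using eventually_gt_at_top[of 0]
      proof eventually_elim
        case (elim n)
        have "Pr (signed_degrees n \<xi>) (B2 n) \<le> real n * tail \<xi> (Suc (\<Delta> n))"
          unfolding B2_def by (rule prob_max_degree_ge_le)
        also have "\<dots> \<le> real n * (V * real (Suc (\<Delta> n)) powr (- \<alpha>))"
          by (intro mult_left_mono upper) auto
        also have "\<dots> \<le> real n * (V * sqrt (\<eta> * real n) powr (- \<alpha>))"
          using V \<alpha> \<Delta>(2)[of n] \<eta> elim by (intro mult_left_mono powr_mono2') auto
        also have "sqrt (\<eta> * real n) powr (- \<alpha>) = (\<eta> * real n) powr (- \<alpha> / 2)"
          using \<eta> elim by (simp add: powr_half_sqrt[symmetric] powr_powr)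
        also have "\<dots> = \<eta> powr (- \<alpha> / 2) * real n powr (- \<alpha> / 2)"
          using \<eta> by (simp add: powr_mult)
        also have "real n * (V * (\<eta> powr (- \<alpha> / 2) * real n powr (- \<alpha> / 2))) =
            V * \<eta> powr (- \<alpha> / 2) * (real n powr 1 * real n powr (- \<alpha> / 2))"
          using elim by simp
        also have "real n powr 1 * real n powr (- \<alpha> / 2) = real n powr (1 - \<alpha> / 2)"
          by (simp only: powr_add[symmetric]) simp
        finally show ?case .
      qed
      have "(\<lambda>n. real n powr (1 - \<alpha> / 2)) \<longlonglongrightarrow> 0"
        using \<alpha> by (intro tendsto_neg_powr filterlim_real_sequentially) auto
      thus "(\<lambda>n. V * \<eta> powr (- \<alpha> / 2) * real n powr (1 - \<alpha> / 2)) \<longlonglongrightarrow> 0"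
        by (rule tendsto_mult_right_zero)
    qed auto
    ultimately have lim: "(\<lambda>n. Pr (signed_degrees n \<xi>) (B1 n \<union> B2 n)) \<longlonglongrightarrow> 0"
      by (rule prob_Un_tendsto_0)
    have "negligible_exception \<xi> (- {\<phi>. satisfiable \<phi>}) \<epsilon> (\<lambda>n. B1 n \<union> B2 n)"
    proof (rule negligible_exceptionI[OF lim eventually_ge_at_top[of N0]])
      fix n f assume elim: "N0 \<le> n"
      assume f: "f \<in> set_pmf (signed_degrees n \<xi>)" "f \<notin> B1 n \<union> B2 n" and ev: "even (\<Sum>i<n. fst (f i))"
      let ?R = "clones n (fst \<circ> f)" and ?s = "clone_sign f"
      have cR: "n \<le> card ?R" using f pos by (intro card_clones_ge) auto
      have deg: "fst (f i) \<le> \<Delta> n" if "i < n" for i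
        using f that by (auto simp: B2_def not_less_eq_eq)
      have "matching_prob ?R (\<lambda>M. \<nexists>\<tau>. satisfies ?s \<tau> M) \<le> \<epsilon>"
      proof (rule main[where \<Delta> = "\<Delta> n"])
        show "even (card ?R)" using ev by (simp add: card_clones)
        show "N0 \<le> card ?R" using cR elim by linarith
        have "(\<Sum>i<n. X (f i)) < 0" using f by (simp add: B1_def)
        hence "(\<Sum>i<n. real (opposite_count (f i))) < (1 - \<delta>) * (\<Sum>i<n. real (fst (f i)))"
          by (simp add: X_def sum_subtractf sum_distrib_left)
        thus "real (card (opposite_pairs ?s ?R)) \<le> (1 - \<delta>) * real (card ?R)"
          by (simp add: card_opposite_pairs card_clones)
        show "card {c \<in> ?R. fst c = v} \<le> \<Delta> n" for v
        proof (cases "v < n")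
          case True
          thus ?thesis using card_literal_clones(3)[OF True, of f] deg by simp
        next
          case False
          hence "{c \<in> ?R. fst c = v} = {}" by (auto simp: clones_def)
          thus ?thesis by (simp only: card.empty)
        qed
        have "(real (\<Delta> n))\<^sup>2 \<le> (sqrt (\<eta> * real n))\<^sup>2" using \<Delta>(1) by (intro power_mono) auto
        also have "\<dots> = \<eta> * real n" using \<eta> by simp
        also have "\<dots> \<le> \<eta> * real (card ?R)" using cR \<eta> by (intro mult_left_mono) auto
        finally show "(real (\<Delta> n))\<^sup>2 \<le> \<eta> * real (card ?R)" .
      qed simp
      thus "matching_prob ?R (\<lambda>M. cnf_of M ?s \<in> - {\<phi>. satisfiable \<phi>}) \<le> \<epsilon>"
        by (simp only: matching_prob_unsatisfiable finite_clones)
    qed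
    thus "\<exists>B. negligible_exception \<xi> (- {\<phi>. satisfiable \<phi>}) \<epsilon> B" by blast
  qed
qed

theorem theorem1:
  fixes \<xi> :: "nat pmf" and \<alpha> :: real
  assumes "0 \<notin> set_pmf \<xi>"
    and "\<alpha> > 0"
    and "power_law \<alpha> \<xi>"
  defines "p_sat \<equiv> (\<lambda>n. measure_pmf.prob (config_model 2 n \<xi>) {\<phi>. satisfiable \<phi>})"
  shows "(0 < \<alpha> \<and> \<alpha> < 2 \<longrightarrow>
            (p_sat \<longlongrightarrow> 0) (admissible_sequentially 2 \<xi>)) \<and>
         (\<alpha> = 2 \<or> moment 2 \<xi> > 3 * moment 1 \<xi> \<longrightarrow>
            (p_sat \<longlongrightarrow> 0) (admissible_sequentially 2 \<xi>)) \<and>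
         (moment 2 \<xi> < 3 * moment 1 \<xi> \<longrightarrow>
            (p_sat \<longlongrightarrow> 1) (admissible_sequentially 2 \<xi>))"
proof -
  obtain V W where VW: "V > 0" "W > 0"
    and lower: "\<And>l. l \<ge> 1 \<Longrightarrow> W * real l powr (- \<alpha>) \<le> tail \<xi> l"
    and upper: "\<And>l. l \<ge> 1 \<Longrightarrow> tail \<xi> l \<le> V * real l powr (- \<alpha>)"
    using assms(3) unfolding power_law_def by blast
  have tail_pos: "tail \<xi> l > 0" for l
  proof -
    have "0 < W * real (Suc l) powr (- \<alpha>)" using VW by simp
    also have "\<dots> \<le> tail \<xi> (Suc l)" by (rule lower) simp
    also have "\<dots> \<le> tail \<xi> l"
      unfolding tail_def by (intro measure_pmf.finite_measure_mono) auto
    finally show ?thesis .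
  qed
  have heavy: "(p_sat \<longlongrightarrow> 0) (admissible_sequentially 2 \<xi>)" if "\<alpha> < 2"
    unfolding p_sat_def using config_model_unsat_heavy_tail[OF assms(1,2) that VW upper lower] .
  have super: "(p_sat \<longlongrightarrow> 0) (admissible_sequentially 2 \<xi>)"
    if "\<alpha> = 2 \<or> moment 2 \<xi> > 3 * moment 1 \<xi>"
  \<comment> \<open>The moment condition may hold together with \<alpha> < 2, where the mean can be
    infinite; the heavy-tail result covers this. Otherwise the mean is finite, and \<alpha> = 2
    satisfies the moment condition with an infinite left moment.\<close>
  proof (cases "\<alpha> < 2")
    case False
    have m1: "moment 1 \<xi> < \<top>" using moment_1_finite[OF VW(1) upper] False by simp
    have "3 * moment 1 \<xi> < moment 2 \<xi>"
      using that
    proof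
      assume "\<alpha> = 2"
      hence "moment 2 \<xi> = \<top>" using moment_2_infinite[OF VW(2) lower] by simp
      thus ?thesis using m1 by (simp add: ennreal_mult_less_top)
    qed
    thus ?thesis
      unfolding p_sat_def by (intro config_model_unsat_supercritical assms(1) tail_pos m1)
  qed (rule heavy)
  have sub: "(p_sat \<longlongrightarrow> 1) (admissible_sequentially 2 \<xi>)" if "moment 2 \<xi> < 3 * moment 1 \<xi>"
  proof -
    \<comment> \<open>The strict inequality forces a finite second moment.\<close>
    have "\<alpha> > 2"
    proof (rule ccontr)
      assume "\<not> \<alpha> > 2"
      hence "moment 2 \<xi> = \<top>" using moment_2_infinite[OF VW(2) lower] by simp
      thus False using that by simp
    qed
    hence "((\<lambda>n. Pr (config_model 2 n \<xi>) (- {\<phi>. satisfiable \<phi>})) \<longlongrightarrow> 0) (admissible_sequentially 2 \<xi>)"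
      by (intro config_model_sat_subcritical[OF assms(1) VW(1) _ upper that])
    hence "((\<lambda>n. 1 - Pr (config_model 2 n \<xi>) (- {\<phi>. satisfiable \<phi>})) \<longlongrightarrow> 1 - 0) (admissible_sequentially 2 \<xi>)"
      by (intro tendsto_diff tendsto_const)
    moreover have "1 - Pr (config_model 2 n \<xi>) (- {\<phi>. satisfiable \<phi>}) = p_sat n" for n
      unfolding p_sat_def using measure_pmf.prob_compl[of "{\<phi>. satisfiable \<phi>}" "config_model 2 n \<xi>"]
      by (simp add: Compl_eq_Diff_UNIV)
    ultimately show ?thesis by simp
  qed
  show ?thesis using heavy super sub by blast
qed

end
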